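(* Let $\{X_i\}_{i\ge1}$ and $\{Y_i\}_{i\ge1}$ be strictly stationary $m$-dependent sequences of random vectors in $\mathbb{R}^d$, where $X_1$ and $Y_1$ have densities $p_X$ and $p_Y$, and let $(k,l)\in\{(2,0),(1,1)\}$. Assume that $p_X,p_Y\in L_3(\mathbb{R}^d)$ and that the following two conditions hold: ($\mathcal{A}_1$) the sequence $\{(X_i,Y_i)\}_{i\ge1}$ of random vectors in $\mathbb{R}^{2d}$ is strictly stationary and $m$-dependent; ($\mathcal{A}_2$) for all $s,t=1,2,\ldots$, the random $d$-vectors $X_1-X_{1+s}$ and $X_s-Y_t$ have bounded densities. Let $\epsilon=\epsilon(n)>0$ with $\epsilon(n)\to0$ as $n\to\infty$, and let $\tilde Q_{k,l,n}$, $q_{k,l}$ and $\sigma^2_{k,l}$ be as defined in the context. Then: (i) If $n^2\epsilon^d\to\infty$, then $\tilde Q_{k,l,n}\to q_{k,l}$ in mean square as $n\to\infty$, i.e. $\mathrm{E}(\tilde Q_{k,l,n}-q_{k,l})^2\to0$. (ii) If $p_X,p_Y\in H_2^{(\alpha)}(K)$ with $0<\alpha\le d/4$, and $\epsilon\sim c\,n^{-2/(4\alpha+d)}$ for some $c>0$, then $$\mathrm{E}(\tilde Q_{k,l,n}-q_{k,l})^2=O\big(n^{-8\alpha/(4\alpha+d)}\big)\quad\text{as } n\to\infty.$$ (iii) If $p_X,p_Y\in H_2^{(\alpha)}(K)$ with $\alpha>d/4$, and $\epsilon\sim L(n)n^{-1/d}$, where $L(n)$, $n\ge1$, is a slowly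 varying function with $L(n)\to\infty$ as $n\to\infty$, then $$\mathrm{E}(\tilde Q_{k,l,n}-q_{k,l})^2=4\sigma^2_{k,l}\,n^{-1}+o(n^{-1})\quad\text{as } n\to\infty.$$
   Context: A sequence $\{W_i\}_{i\ge1}$ of random vectors is $m$-dependent ($m\ge0$ an integer) if $\{W_1,\ldots,W_b\}$ and $\{W_{b+k},\ldots,W_{b+k+l}\}$, $b,k,l=1,2,\ldots$, are independent sets whenever $k>m$. Dependence between the sequences $\{X_i\}$ and $\{Y_i\}$ is allowed. The functionals are $q_{2,0}=\int_{\mathbb{R}^d}p_X(x)^2\,dx$ and $q_{1,1}=\int_{\mathbb{R}^d}p_X(x)p_Y(x)\,dx$. Let $d(x,y)=|x-y|$ be the Euclidean distance in $\mathbb{R}^d$, $I(A)$ the indicator of the event $A$, $B_\epsilon(x)=\{y\in\mathbb{R}^d: d(x,y)\le\epsilon\}$, and let $b_\epsilon(d)=b_1(d)\epsilon^d$ be the volume (Lebesgue measure) of an $\epsilon$-ball in $\mathbb{R}^d$. The estimators based on $\{X_1,\ldots,X_n\}$ and $\{Y_1,\ldots,Y_n\}$ are $\tilde Q_{k,l,n}=Q_{k,l,n}/b_\epsilon(d)$ with $$Q_{2,0,n}=\frac{1}{\binom n2}\sum_{1\le i<j\le n}I(d(X_i,X_j)\le\epsilon),\qquad Q_{1,1,n}=\frac1{n^2}\sum_{i=1}^n\sum_{j=1}^nI(d(X_i,Y_j)\le\epsilon),$$ where $\epsilon=\epsilon(n)$. With $g(X_i,Y_i)=\frac12\big(p_Y(X_i)+p_X(Y_i)\big)$,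 define $$\sigma_{2,0}^2=\mathrm{Var}(p_X(X_1))+2\sum_{h=1}^m\mathrm{Cov}\big(p_X(X_1),p_X(X_{1+h})\big),$$ $$\sigma_{1,1}^2=\mathrm{Var}(g(X_1,Y_1))+2\sum_{h=1}^m\mathrm{Cov}\big(g(X_1,Y_1),g(X_{1+h},Y_{1+h})\big).$$ For $0<\alpha\le1$ and $K>0$, $H_2^{(\alpha)}(K)$ is the class of functions $p\in L_2(\mathbb{R}^d)$ such that $\left(\int_{\mathbb{R}^d}(p(x-h)-p(x))^2dx\right)^{1/2}\le K|h|^\alpha$ for all $h\in B_1(0)$. $a_n\sim b_n$ means $a_n/b_n\to1$ as $n\to\infty$. *)

theory Defs
  imports "HOL-Probability.Probability" "HOL-Library.Landau_Symbols"
begin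

text \<open>
  Sequences of random vectors are functions \<open>W :: nat \<Rightarrow> 'w \<Rightarrow> 'b\<close> of which only the members
  \<open>W i\<close> with \<open>i \<ge> 1\<close> matter. The space of dimension \<open>d\<close> is an arbitrary Euclidean space \<open>'a\<close>
  with \<open>DIM('a) = d\<close>.
\<close>

definition strictly_stationary :: "'w measure \<Rightarrow> (nat \<Rightarrow> 'w \<Rightarrow> 'b::topological_space) \<Rightarrow> bool" where
  "strictly_stationary M W \<longleftrightarrow>
     (\<forall>J h. finite J \<and> J \<subseteq> {1..} \<longrightarrow>
        distr M (PiM J (\<lambda>_. borel)) (\<lambda>\<omega>. \<lambda>i\<in>J. W (i + h) \<omega>) =
        distr M (PiM J (\<lambda>_. borel)) (\<lambda>\<omega>. \<lambda>i\<in>J. W i \<omega>))"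

definition m_dependent :: "'w measure \<Rightarrow> nat \<Rightarrow> (nat \<Rightarrow> 'w \<Rightarrow> 'b::topological_space) \<Rightarrow> bool" where
  "m_dependent M m W \<longleftrightarrow>
     (\<forall>b\<ge>1. \<forall>k\<ge>1. \<forall>l\<ge>1. k > m \<longrightarrow>
        prob_space.indep_var M
          (PiM {1..b} (\<lambda>_. borel)) (\<lambda>\<omega>. \<lambda>i\<in>{1..b}. W i \<omega>)
          (PiM {b+k..b+k+l} (\<lambda>_. borel)) (\<lambda>\<omega>. \<lambda>i\<in>{b+k..b+k+l}. W i \<omega>))"

definition has_density :: "'w measure \<Rightarrow> ('w \<Rightarrow> 'a::euclidean_space) \<Rightarrow> ('a \<Rightarrow> real) \<Rightarrow> bool" where
  "has_density M Z p \<longleftrightarrow> (\<forall>x. 0 \<le> p x) \<and> distributed M lborel Z (\<lambda>x. ennreal (p x))"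

definition has_bounded_density :: "'w measure \<Rightarrow> ('w \<Rightarrow> 'a::euclidean_space) \<Rightarrow> bool" where
  "has_bounded_density M Z \<longleftrightarrow> (\<exists>p. has_density M Z p \<and> bounded (range p))"

definition L_space :: "nat \<Rightarrow> ('a::euclidean_space \<Rightarrow> real) set" where
  "L_space r = {p. p \<in> borel_measurable lborel \<and> integrable lborel (\<lambda>x. \<bar>p x\<bar> ^ r)}"

definition H2_class :: "real \<Rightarrow> real \<Rightarrow> ('a::euclidean_space \<Rightarrow> real) set" where
  "H2_class \<alpha> K = {p \<in> L_space 2. \<forall>h\<in>cball 0 1.
     sqrt (LINT x|lborel. (p (x - h) - p x)\<^sup>2) \<le> K * norm h powr \<alpha>}"

definition ball_vol :: "'a::euclidean_space itself \<Rightarrow> real \<Rightarrow> real" where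
  "ball_vol _ e = measure lborel (cball (0::'a) e)"

definition q20 :: "('a::euclidean_space \<Rightarrow> real) \<Rightarrow> real" where
  "q20 pX = (LINT x|lborel. (pX x)\<^sup>2)"

definition q11 :: "('a::euclidean_space \<Rightarrow> real) \<Rightarrow> ('a \<Rightarrow> real) \<Rightarrow> real" where
  "q11 pX pY = (LINT x|lborel. pX x * pY x)"

definition Q20 :: "(nat \<Rightarrow> 'w \<Rightarrow> 'a::euclidean_space) \<Rightarrow> real \<Rightarrow> nat \<Rightarrow> 'w \<Rightarrow> real" where
  "Q20 X e n \<omega> =
     1 / real (n choose 2) *
     (\<Sum>(i, j) \<in> {(i, j). 1 \<le> i \<and> i < j \<and> j \<le> n}. of_bool (dist (X i \<omega>) (X j \<omega>) \<le> e))"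

definition Q11 ::
  "(nat \<Rightarrow> 'w \<Rightarrow> 'a::euclidean_space) \<Rightarrow> (nat \<Rightarrow> 'w \<Rightarrow> 'a) \<Rightarrow> real \<Rightarrow> nat \<Rightarrow> 'w \<Rightarrow> real" where
  "Q11 X Y e n \<omega> =
     1 / (real n)\<^sup>2 * (\<Sum>i=1..n. \<Sum>j=1..n. of_bool (dist (X i \<omega>) (Y j \<omega>) \<le> e))"

definition cov :: "'w measure \<Rightarrow> ('w \<Rightarrow> real) \<Rightarrow> ('w \<Rightarrow> real) \<Rightarrow> real" where
  "cov M U V = (LINT \<omega>|M. (U \<omega> - (LINT \<omega>'|M. U \<omega>')) * (V \<omega> - (LINT \<omega>'|M. V \<omega>')))"

definition long_run_variance :: "'w measure \<Rightarrow> nat \<Rightarrow> (nat \<Rightarrow> 'w \<Rightarrow> real) \<Rightarrow> real" where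
  "long_run_variance M m U =
     prob_space.variance M (U 1) + 2 * (\<Sum>h=1..m. cov M (U 1) (U (1 + h)))"

definition sigma20_sq ::
  "'w measure \<Rightarrow> nat \<Rightarrow> (nat \<Rightarrow> 'w \<Rightarrow> 'a::euclidean_space) \<Rightarrow> ('a \<Rightarrow> real) \<Rightarrow> real" where
  "sigma20_sq M m X pX = long_run_variance M m (\<lambda>i \<omega>. pX (X i \<omega>))"

definition sigma11_sq ::
  "'w measure \<Rightarrow> nat \<Rightarrow> (nat \<Rightarrow> 'w \<Rightarrow> 'a::euclidean_space) \<Rightarrow> (nat \<Rightarrow> 'w \<Rightarrow> 'a) \<Rightarrow>
   ('a \<Rightarrow> real) \<Rightarrow> ('a \<Rightarrow> real) \<Rightarrow> real" where
  "sigma11_sq M m X Y pX pY =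
     long_run_variance M m (\<lambda>i \<omega>. 1 / 2 * (pY (X i \<omega>) + pX (Y i \<omega>)))"

text \<open>
  The families indexed by \<open>(k, l)\<close>. They are meant for \<open>(k, l) \<in> {(2, 0), (1, 1)}\<close> only, so the
  \<open>else\<close> branch stands for \<open>(1, 1)\<close>.
\<close>

definition q_fun :: "nat \<Rightarrow> nat \<Rightarrow> ('a::euclidean_space \<Rightarrow> real) \<Rightarrow> ('a \<Rightarrow> real) \<Rightarrow> real" where
  "q_fun k l pX pY = (if (k, l) = (2, 0) then q20 pX else q11 pX pY)"

definition Q_est ::
  "nat \<Rightarrow> nat \<Rightarrow> (nat \<Rightarrow> 'w \<Rightarrow> 'a::euclidean_space) \<Rightarrow> (nat \<Rightarrow> 'w \<Rightarrow> 'a) \<Rightarrow>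
   real \<Rightarrow> nat \<Rightarrow> 'w \<Rightarrow> real" where
  "Q_est k l X Y e n \<omega> =
     (if (k, l) = (2, 0) then Q20 X e n \<omega> else Q11 X Y e n \<omega>) / ball_vol TYPE('a) e"

definition sigma_sq ::
  "'w measure \<Rightarrow> nat \<Rightarrow> nat \<Rightarrow> nat \<Rightarrow> (nat \<Rightarrow> 'w \<Rightarrow> 'a::euclidean_space) \<Rightarrow>
   (nat \<Rightarrow> 'w \<Rightarrow> 'a) \<Rightarrow> ('a \<Rightarrow> real) \<Rightarrow> ('a \<Rightarrow> real) \<Rightarrow> real" where
  "sigma_sq M m k l X Y pX pY =
     (if (k, l) = (2, 0) then sigma20_sq M m X pX else sigma11_sq M m X Y pX pY)"

text \<open>
  Slow variation at infinity in the sense of Karamata; measurability is part of that definition.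
\<close>

definition slowly_varying :: "(real \<Rightarrow> real) \<Rightarrow> bool" where
  "slowly_varying L \<longleftrightarrow>
     set_borel_measurable borel {1..} L \<and> (\<forall>x\<ge>1. L x > 0) \<and>
     (\<forall>t>0. ((\<lambda>x. L (t * x) / L x) \<longlongrightarrow> 1) at_top)"

end

theory Submission
  imports Defs
begin

text \<open>
Both estimators average the kernel \<open>of_bool (dist x y \<le> e) / b\<^sub>e\<close> over pairs \<open>(X\<^sub>i, Y\<^sub>j)\<close> whose index set
meets every row and every column of the square \<open>{1..n} \<times> {1..n}\<close> equally often: the whole square for
\<open>(1, 1)\<close>, and the square without its diagonal, with \<open>Y = X\<close>, for \<open>(2, 0)\<close>. The two cases are
therefore treated as one. Because of this regularity, Hoeffding's decomposition is an exact identity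
(\<open>estimator_decomposition\<close>): the error of the estimator is \<open>2 A\<^sub>n + T\<^sub>n\<close>. Here \<open>A\<^sub>n\<close> averages the centred
scores \<open>(p\<^sub>Y(X\<^sub>i) + p\<^sub>X(Y\<^sub>i)) / 2 - q\<close>, which do not involve the radius, and the remainder \<open>T\<^sub>n\<close> is a sum of three
terms.

\<^item> A normalised double sum of a degenerate kernel \<open>\<psi>\<close>, one whose mean in either argument is zero. By
  \<open>m\<close>-dependence \<open>E \<psi>\<^sub>i\<^sub>j \<psi>\<^sub>k\<^sub>l\<close> vanishes as soon as the smallest or the largest of the four indices is
  further than \<open>m\<close> from the other three. The surviving quadruples split into two pairs of neighbours,
  so there are only \<open>O(n\<^sup>2)\<close> of them, and each contributes at most a constant times \<open>1 / \<epsilon>\<^sup>d\<close>; the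
  bounded densities of the differences enter for the pairs \<open>(i, j)\<close> at distance at most \<open>m\<close>. After
  normalisation the second moment is \<open>O(1 / (n\<^sup>2 \<epsilon>\<^sup>d))\<close>.
\<^item> The average of the errors made in the scores by replacing densities by their means over balls. Its
  second moment is \<open>o(1 / n)\<close>, because \<open>\<integral> f(x) (g(x - u) - g(x))\<^sup>2 dx\<close> tends to zero with \<open>u\<close> for
  \<open>f\<close>, \<open>g\<close> in \<open>L\<^sup>1 \<inter> L\<^sup>3\<close> (\<open>translate_continuous_weighted_L2\<close>).
\<^item> The deterministic bias. It tends to zero, and it is \<open>O(\<epsilon>\<^sup>2\<^sup>\<alpha>)\<close> rather than \<open>O(\<epsilon>\<^sup>\<alpha>)\<close> under the smoothness
  assumption, since balls are symmetric and a second difference of the cross-correlation of two densities is an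
  integral of a product of first differences (\<open>shift_corr_second_difference\<close>).

For the main term, \<open>n E A\<^sub>n\<^sup>2\<close> converges to the long-run variance of the scores. The three claims follow by
comparing \<open>1 / n\<close>, \<open>1 / (n\<^sup>2 \<epsilon>\<^sup>d)\<close> and \<open>\<epsilon>\<^sup>4\<^sup>\<alpha>\<close>. In the last one the bias is negligible because
\<open>L(n) = o(n\<^sup>\<delta>)\<close> for every \<open>\<delta> > 0\<close>, which rests on the measurability of slowly varying functions
(\<open>slowly_varying_locally_bounded\<close>).
\<close>

section \<open>Translations are continuous in the mean\<close>

lemma lborel_distr_diff:
  fixes u :: "'a::euclidean_space"
  shows "distr lborel borel (\<lambda>x. x - u) = lborel"
proof -
  have "(\<lambda>x. x - u) = (+) (- u)" by auto
  then show ?thesis using lborel_distr_plus[of "- u"] by simp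
qed

lemma lborel_distr_reflect:
  fixes x :: "'a::euclidean_space"
  shows "distr lborel borel (\<lambda>u. x - u) = lborel"
proof -
  have "(lborel :: 'a measure) = density (distr lborel borel (\<lambda>u. x + (-1) *\<^sub>R u)) (\<lambda>_. \<bar>-1::real\<bar>^DIM('a))"
    by (rule lborel_affine) simp
  then show ?thesis by (simp add: density_1)
qed

lemma
  fixes f :: "'a::euclidean_space \<Rightarrow> real"
  assumes [measurable]: "f \<in> borel_measurable borel"
  shows lborel_integral_translate: "(LINT x|lborel. f (x - u)) = (LINT x|lborel. f x)"
    and lborel_integrable_translate_iff: "integrable lborel (\<lambda>x. f (x - u)) \<longleftrightarrow> integrable lborel f"
    and lborel_integral_reflect: "(LINT u|lborel. f (x - u)) = (LINT u|lborel. f u)"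
    and lborel_integrable_reflect_iff: "integrable lborel (\<lambda>u. f (x - u)) \<longleftrightarrow> integrable lborel f"
proof -
  show "(LINT x|lborel. f (x - u)) = (LINT x|lborel. f x)"
    using integral_distr[of "\<lambda>x. x - u" lborel borel f] by (simp add: lborel_distr_diff)
  show "integrable lborel (\<lambda>x. f (x - u)) \<longleftrightarrow> integrable lborel f"
    using integrable_distr_eq[of "\<lambda>x. x - u" lborel borel f] by (simp add: lborel_distr_diff)
  show "(LINT u|lborel. f (x - u)) = (LINT u|lborel. f u)"
    using integral_distr[of "\<lambda>u. x - u" lborel borel f] by (simp add: lborel_distr_reflect)
  show "integrable lborel (\<lambda>u. f (x - u)) \<longleftrightarrow> integrable lborel f"
    using integrable_distr_eq[of "\<lambda>u. x - u" lborel borel f] by (simp add: lborel_distr_reflect)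
qed

text \<open>
The integral of \<open>|a|\<close> is twice the integral of the positive part of \<open>-a\<close> when \<open>a\<close> has integral zero. For the
difference \<open>a\<close> of the translated indicator and the original one, this positive part is dominated by the indicator
itself, and since \<open>U\<close> is open it vanishes pointwise in the limit.
\<close>

lemma translate_open_indicator_L1:
  fixes U :: "'a::euclidean_space set"
  assumes U: "open U" and fin: "emeasure lborel U < \<infinity>" and u: "u \<longlonglongrightarrow> 0"
  shows "(\<lambda>n. LINT x|lborel. \<bar>indicator U (x - u n) - indicator U x\<bar> :: real) \<longlonglongrightarrow> 0"
proof -
  have [measurable]: "U \<in> sets borel" using U by simp
  let ?k = "\<lambda>x. indicator U x :: real"
  have ik: "integrable lborel ?k" using fin by (simp add: integrable_indicator_iff)
  have iku: "integrable lborel (\<lambda>x. ?k (x - v))" for v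
    using ik by (subst lborel_integrable_translate_iff) auto
  have pos: "(\<lambda>n. LINT x|lborel. max 0 (?k x - ?k (x - u n))) \<longlonglongrightarrow> (LINT x|(lborel::'a measure). 0)"
  proof (rule integral_dominated_convergence[where w="?k"])
    show "AE x in lborel. (\<lambda>n. max 0 (?k x - ?k (x - u n))) \<longlonglongrightarrow> 0"
    proof (intro AE_I2)
      fix x :: 'a
      show "(\<lambda>n. max 0 (?k x - ?k (x - u n))) \<longlonglongrightarrow> 0"
      proof (cases "x \<in> U")
        case True
        have "(\<lambda>n. x - u n) \<longlonglongrightarrow> x - 0" by (intro tendsto_intros u)
        then have "\<forall>\<^sub>F n in sequentially. x - u n \<in> U"
          using True U topological_tendstoD[of "\<lambda>n. x - u n" x _ U] by auto
        then have "\<forall>\<^sub>F n in sequentially. max 0 (?k x - ?k (x - u n)) = 0"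
          by eventually_elim auto
        then show ?thesis by (simp add: tendsto_eventually)
      qed (auto simp: indicator_def max_def intro!: tendsto_eventually)
    qed
    show "AE x in lborel. norm (max 0 (?k x - ?k (x - u n))) \<le> ?k x" for n
      by (intro AE_I2) (auto simp: indicator_def)
  qed (use ik in auto)
  have "(LINT x|lborel. \<bar>?k (x - u n) - ?k x\<bar>) = 2 * (LINT x|lborel. max 0 (?k x - ?k (x - u n)))" for n
  proof -
    have "(LINT x|lborel. \<bar>?k (x - u n) - ?k x\<bar>)
        = (LINT x|lborel. 2 * max 0 (?k x - ?k (x - u n)) - (?k x - ?k (x - u n)))"
      by (intro Bochner_Integration.integral_cong refl) (auto simp: indicator_def)
    also have "\<dots> = 2 * (LINT x|lborel. max 0 (?k x - ?k (x - u n))) - ((LINT x|lborel. ?k x) - (LINT x|lborel. ?k (x - u n)))"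
      using ik iku by (subst Bochner_Integration.integral_diff) auto
    also have "(LINT x|lborel. ?k (x - u n)) = (LINT x|lborel. ?k x)"
      by (rule lborel_integral_translate) simp
    finally show ?thesis by simp
  qed
  then show ?thesis using tendsto_mult_left[OF pos, of 2] by simp
qed

lemma translate_L1_perturb:
  fixes f g :: "'a::euclidean_space \<Rightarrow> real"
  assumes f: "integrable lborel f" and g: "integrable lborel g"
  shows "(LINT x|lborel. \<bar>f (x - u) - f x\<bar>)
    \<le> (LINT x|lborel. \<bar>g (x - u) - g x\<bar>) + 2 * (LINT x|lborel. \<bar>f x - g x\<bar>)"
proof -
  have [measurable]: "f \<in> borel_measurable borel" "g \<in> borel_measurable borel" using f g by auto
  have fu: "integrable lborel (\<lambda>x. f (x - u))" and gu: "integrable lborel (\<lambda>x. g (x - u))"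
    using f g by (simp_all add: lborel_integrable_translate_iff)
  have "(LINT x|lborel. \<bar>f (x - u) - f x\<bar>)
    \<le> (LINT x|lborel. \<bar>g (x - u) - g x\<bar> + \<bar>f (x - u) - g (x - u)\<bar> + \<bar>f x - g x\<bar>)"
    using f g fu gu by (intro integral_mono) auto
  also have "\<dots> = (LINT x|lborel. \<bar>g (x - u) - g x\<bar>) + (LINT x|lborel. \<bar>f (x - u) - g (x - u)\<bar>) + (LINT x|lborel. \<bar>f x - g x\<bar>)"
    using f g fu gu by simp
  also have "(LINT x|lborel. \<bar>f (x - u) - g (x - u)\<bar>) = (LINT x|lborel. \<bar>f x - g x\<bar>)"
    by (rule lborel_integral_translate[of "\<lambda>x. \<bar>f x - g x\<bar>"]) simp
  finally show ?thesis by simp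
qed

text \<open>
Continuity of translation passes to limits in mean, as translations preserve distances in \<open>L\<^sup>1\<close>.
\<close>

lemma translate_L1_closed:
  fixes f :: "'a::euclidean_space \<Rightarrow> real"
  assumes f: "integrable lborel f"
    and app: "\<And>e. e > 0 \<Longrightarrow> \<exists>g. integrable lborel g \<and> (LINT x|lborel. \<bar>f x - g x\<bar>) \<le> e
                  \<and> (\<lambda>n. LINT x|lborel. \<bar>g (x - u n) - g x\<bar>) \<longlonglongrightarrow> 0"
  shows "(\<lambda>n. LINT x|lborel. \<bar>f (x - u n) - f x\<bar>) \<longlonglongrightarrow> 0"
proof (rule LIMSEQ_I)
  fix r :: real assume r: "r > 0"
  obtain g where g: "integrable lborel g" "(LINT x|lborel. \<bar>f x - g x\<bar>) \<le> r / 4"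
      "(\<lambda>n. LINT x|lborel. \<bar>g (x - u n) - g x\<bar>) \<longlonglongrightarrow> 0"
    using app[of "r/4"] r by auto
  obtain N where N: "\<And>n. n \<ge> N \<Longrightarrow> norm ((LINT x|lborel. \<bar>g (x - u n) - g x\<bar>) - 0) < r / 2"
    using LIMSEQ_D[OF g(3), of "r/2"] r by auto
  have "norm ((LINT x|lborel. \<bar>f (x - u n) - f x\<bar>) - 0) < r" if "n \<ge> N" for n
  proof -
    have "(LINT x|lborel. \<bar>f (x - u n) - f x\<bar>) \<ge> 0" by (simp add: integral_nonneg_AE)
    then show ?thesis using translate_L1_perturb[OF f g(1), of "u n"] N[OF that] g(2) by auto
  qed
  then show "\<exists>no. \<forall>n\<ge>no. norm ((LINT x|lborel. \<bar>f (x - u n) - f x\<bar>) - 0) < r" by blast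
qed

text \<open>
Outer regularity reduces indicators of measurable sets to indicators of open sets; simple functions and limits in
mean give the rest.
\<close>

lemma translate_continuous_L1:
  fixes f :: "'a::euclidean_space \<Rightarrow> real"
  assumes "integrable lborel f" and u: "u \<longlonglongrightarrow> 0"
  shows "(\<lambda>n. LINT x|lborel. \<bar>f (x - u n) - f x\<bar>) \<longlonglongrightarrow> 0"
  using assms(1)
proof (induct rule: integrable_induct)
  case (base A c)
  then have A[measurable]: "A \<in> sets borel" and fin: "emeasure lborel A < \<infinity>" by auto
  have iA: "integrable lborel (\<lambda>x. indicator A x *\<^sub>R c)"
    using A fin by (intro integrable_scaleR_left integrable_real_indicator) auto
  show ?case
  proof (rule translate_L1_closed[OF iA])
    fix e :: real assume e: "e > 0"
    define e' where "e' = e / (\<bar>c\<bar> + 1)"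
    have e': "e' > 0" using e by (simp add: e'_def)
    have "A \<in> sets lebesgue" using A by (simp add: sets_completionI_sets)
    from sets_lebesgue_outer_open[OF this e']
    obtain T where T: "open T" "A \<subseteq> T" "emeasure lebesgue (T - A) < ennreal e'" by metis
    have [measurable]: "T \<in> sets borel" using T by simp
    have TA: "emeasure lborel (T - A) < ennreal e'" using T(3) by simp
    have "emeasure lborel T = emeasure lborel A + emeasure lborel (T - A)"
      using T(2) by (subst plus_emeasure) (auto intro: arg_cong[where f="emeasure lborel"])
    then have finT: "emeasure lborel T < \<infinity>"
      using fin order.strict_trans[OF TA ennreal_less_top] by simp
    have iT: "integrable lborel (\<lambda>x. indicator T x *\<^sub>R c)"
      using finT by (intro integrable_scaleR_left integrable_real_indicator) auto
    have "(LINT x|lborel. \<bar>indicator A x *\<^sub>R c - indicator T x *\<^sub>R c\<bar>) = (LINT x|lborel. indicator (T - A) x *\<^sub>R \<bar>c\<bar>)"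
      using T(2) by (intro Bochner_Integration.integral_cong) (auto simp: indicator_def)
    also have "\<dots> = measure lborel (T - A) * \<bar>c\<bar>" by simp
    also have "\<dots> \<le> e' * \<bar>c\<bar>"
      using TA e' by (intro mult_right_mono) (auto simp: measure_def intro!: enn2real_leI)
    also have "\<dots> \<le> e" using e by (simp add: e'_def field_simps)
    finally have "(LINT x|lborel. \<bar>indicator A x *\<^sub>R c - indicator T x *\<^sub>R c\<bar>) \<le> e" .
    moreover have "(\<lambda>n. LINT x|lborel. \<bar>indicator T (x - u n) *\<^sub>R c - indicator T x *\<^sub>R c\<bar>) \<longlonglongrightarrow> 0"
    proof -
      have "\<bar>indicator T (x - u n) *\<^sub>R c - indicator T x *\<^sub>R c\<bar>
          = \<bar>c\<bar> * \<bar>indicator T (x - u n) - indicator T x\<bar>" for x n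
        by (simp add: abs_mult[symmetric] algebra_simps)
      then show ?thesis
        using tendsto_mult_left[OF translate_open_indicator_L1[OF T(1) finT u], of "\<bar>c\<bar>"] by simp
    qed
    ultimately show "\<exists>g. integrable lborel g \<and> (LINT x|lborel. \<bar>indicator A x *\<^sub>R c - g x\<bar>) \<le> e
                  \<and> (\<lambda>n. LINT x|lborel. \<bar>g (x - u n) - g x\<bar>) \<longlonglongrightarrow> 0"
      using iT by blast
  qed
next
  case (add f g)
  have [measurable]: "f \<in> borel_measurable borel" "g \<in> borel_measurable borel" using add by auto
  have fu: "integrable lborel (\<lambda>x. f (x - v))" and gu: "integrable lborel (\<lambda>x. g (x - v))" for v
    using add by (simp_all add: lborel_integrable_translate_iff)
  show ?case
  proof (rule tendsto_sandwich[OF _ _ tendsto_const])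
    show "(\<lambda>n. (LINT x|lborel. \<bar>f (x - u n) - f x\<bar>) + (LINT x|lborel. \<bar>g (x - u n) - g x\<bar>)) \<longlonglongrightarrow> 0"
      using tendsto_add[OF add(2,4)] by simp
    show "\<forall>\<^sub>F n in sequentially. (LINT x|lborel. \<bar>f (x - u n) + g (x - u n) - (f x + g x)\<bar>)
       \<le> (LINT x|lborel. \<bar>f (x - u n) - f x\<bar>) + (LINT x|lborel. \<bar>g (x - u n) - g x\<bar>)"
      using add fu gu by (intro always_eventually allI)
        (simp flip: Bochner_Integration.integral_add, intro integral_mono, auto)
  qed (simp add: integral_nonneg_AE)
next
  case (lim f s)
  have "(\<lambda>i. LINT x|lborel. \<bar>f x - s i x\<bar>) \<longlonglongrightarrow> (LINT x|(lborel::'a measure). 0)"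
  proof (rule integral_dominated_convergence[where w="\<lambda>x. 3 * \<bar>f x\<bar>"])
    show "AE x in lborel. (\<lambda>i. \<bar>f x - s i x\<bar>) \<longlonglongrightarrow> 0"
    proof (intro AE_I2)
      fix x :: 'a
      have "(\<lambda>i. \<bar>f x - s i x\<bar>) \<longlonglongrightarrow> \<bar>f x - f x\<bar>" using lim(3)[of x] by (intro tendsto_intros) auto
      then show "(\<lambda>i. \<bar>f x - s i x\<bar>) \<longlonglongrightarrow> 0" by simp
    qed
    show "AE x in lborel. norm \<bar>f x - s i x\<bar> \<le> 3 * \<bar>f x\<bar>" for i
      using lim(4) by (intro AE_I2) (smt (verit) UNIV_I real_norm_def space_lborel)
  qed (use lim in auto)
  then have *: "(\<lambda>i. LINT x|lborel. \<bar>f x - s i x\<bar>) \<longlonglongrightarrow> 0" by simp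
  show ?case
  proof (rule translate_L1_closed[OF lim(5)])
    fix e :: real assume "e > 0"
    then obtain i where "norm ((LINT x|lborel. \<bar>f x - s i x\<bar>) - 0) < e"
      using LIMSEQ_D[OF *, of e] by auto
    then show "\<exists>g. integrable lborel g \<and> (LINT x|lborel. \<bar>f x - g x\<bar>) \<le> e
                  \<and> (\<lambda>n. LINT x|lborel. \<bar>g (x - u n) - g x\<bar>) \<longlonglongrightarrow> 0"
      using lim(1,2)[of i] by (intro exI[of _ "s i"]) auto
  qed
qed

section \<open>Weighted mean-square continuity of translations in \<open>L\<^sup>1 \<inter> L\<^sup>3\<close>\<close>

text \<open>
The probability densities of the theorem belong to this class, which is closed under translation. Interpolation
between first and third powers gives square integrability.
\<close>

definition nonneg_L1_L3 :: "('a::euclidean_space \<Rightarrow> real) \<Rightarrow> bool" where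
  "nonneg_L1_L3 p \<longleftrightarrow> (\<forall>x. 0 \<le> p x) \<and> integrable lborel p \<and> integrable lborel (\<lambda>x. p x ^ 3)"

lemma nonneg_L1_L3D:
  assumes "nonneg_L1_L3 p"
  shows "0 \<le> p x" "integrable lborel p" "integrable lborel (\<lambda>x. p x ^ 3)"
    and "p \<in> borel_measurable borel"
  using assms unfolding nonneg_L1_L3_def by auto

lemma nonneg_L1_L3_translate:
  assumes "nonneg_L1_L3 p" shows "nonneg_L1_L3 (\<lambda>x. p (x - u))"
proof -
  note [measurable] = nonneg_L1_L3D(4)[OF assms]
  show ?thesis
    using nonneg_L1_L3D[OF assms] lborel_integrable_translate_iff[of p u]
      lborel_integrable_translate_iff[of "\<lambda>x. p x ^ 3" u]
    by (simp add: nonneg_L1_L3_def)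
qed

lemma square_le_add_cube: "0 \<le> (t::real) \<Longrightarrow> t^2 \<le> t + t ^ 3"
proof -
  assume "0 \<le> t"
  then have "0 \<le> t * ((t - 1)^2 + t)" by simp
  then show ?thesis by (simp add: power2_eq_square power3_eq_cube algebra_simps)
qed

text \<open>
A form of Young's inequality. With \<open>\<delta> = 1\<close> it shows that \<open>p r\<^sup>2\<close> is integrable for \<open>p\<close>, \<open>r\<close> in \<open>L\<^sup>3\<close>; a small
\<open>\<delta>\<close> moves almost all of the weight to the first factor.
\<close>

lemma mult_square_le_cubes:
  assumes "0 \<le> (a::real)" "0 \<le> b" "0 < \<delta>"
  shows "a * b^2 \<le> a ^ 3 / \<delta>^2 + \<delta> * b ^ 3"
proof (cases "a \<le> \<delta> * b")
  case True
  then have "a * b^2 \<le> \<delta> * b * b^2" using assms by (intro mult_right_mono) auto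
  also have "\<dots> = \<delta> * b ^ 3" by (simp add: power2_eq_square power3_eq_cube)
  finally show ?thesis using assms by (simp add: add_increasing)
next
  case False
  then have "b^2 \<le> (a / \<delta>)^2" using assms by (intro power_mono) (auto simp: field_simps)
  then have "a * b^2 \<le> a * (a / \<delta>)^2" using assms by (intro mult_left_mono) auto
  also have "\<dots> = a ^ 3 / \<delta>^2" by (simp add: power2_eq_square power3_eq_cube)
  finally show ?thesis using assms by (simp add: add_increasing2)
qed

lemma abs_diff_cube_le:
  assumes "0 \<le> (a::real)" "0 \<le> b" shows "\<bar>a - b\<bar> ^ 3 \<le> a ^ 3 + b ^ 3"
proof -
  have "\<bar>a - b\<bar> ^ 3 \<le> (max a b) ^ 3" using assms by (intro power_mono) auto
  also have "\<dots> \<le> a ^ 3 + b ^ 3" using assms by (auto simp: max_def)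
  finally show ?thesis .
qed

lemma nonneg_L1_L3_square:
  assumes p: "nonneg_L1_L3 p" shows "integrable lborel (\<lambda>x. (p x)^2)"
proof (rule Bochner_Integration.integrable_bound)
  show "integrable lborel (\<lambda>x. p x + p x ^ 3)" using nonneg_L1_L3D(2,3)[OF p] by simp
  show "AE x in lborel. norm ((p x)^2) \<le> norm (p x + p x ^ 3)"
    using square_le_add_cube[OF nonneg_L1_L3D(1)[OF p]] by (intro AE_I2) (smt (verit) real_norm_def zero_le_power2)
qed (use nonneg_L1_L3D(4)[OF p] in simp)

lemma nonneg_L1_L3_mult:
  assumes "nonneg_L1_L3 p" "nonneg_L1_L3 r" shows "integrable lborel (\<lambda>x. p x * r x)"
proof (rule Bochner_Integration.integrable_bound[of lborel "\<lambda>x. (p x)^2 + (r x)^2"])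
  have "p x * r x \<le> (p x)^2 + (r x)^2" for x
    using sum_squares_bound[of "p x" "r x"] nonneg_L1_L3D(1)[OF assms(1), of x] nonneg_L1_L3D(1)[OF assms(2), of x] mult_nonneg_nonneg[of "p x" "r x"] by linarith
  then show "AE x in lborel. norm (p x * r x) \<le> norm ((p x)^2 + (r x)^2)"
    using nonneg_L1_L3D(1)[OF assms(1)] nonneg_L1_L3D(1)[OF assms(2)] by auto
qed (use nonneg_L1_L3_square[OF assms(1)] nonneg_L1_L3_square[OF assms(2)] nonneg_L1_L3D(4)[OF assms(1)] nonneg_L1_L3D(4)[OF assms(2)] in auto)

lemma nonneg_L1_L3_mult_square:
  assumes "nonneg_L1_L3 p" "nonneg_L1_L3 r" shows "integrable lborel (\<lambda>x. p x * (r x)^2)"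
proof (rule Bochner_Integration.integrable_bound[of lborel "\<lambda>x. p x ^ 3 + r x ^ 3"])
  show "AE x in lborel. norm (p x * (r x)^2) \<le> norm (p x ^ 3 + r x ^ 3)"
    using mult_square_le_cubes[of "p x" "r x" 1 for x] nonneg_L1_L3D(1)[OF assms(1)] nonneg_L1_L3D(1)[OF assms(2)]
    by (intro AE_I2) auto
qed (use nonneg_L1_L3D(3,4)[OF assms(1)] nonneg_L1_L3D(3,4)[OF assms(2)] in auto)

lemma nonneg_L1_L3_mult_diff_square:
  assumes f: "nonneg_L1_L3 f" and g: "nonneg_L1_L3 g"
  shows "integrable lborel (\<lambda>x. f x * (g (x - u) - g x)^2)"
proof (rule Bochner_Integration.integrable_bound[of lborel "\<lambda>x. 2 * (f x * (g (x - u))^2) + 2 * (f x * (g x)^2)"])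
  note [measurable] = nonneg_L1_L3D(4)[OF f] nonneg_L1_L3D(4)[OF g]
  show "integrable lborel (\<lambda>x. 2 * (f x * (g (x - u))^2) + 2 * (f x * (g x)^2))"
    using nonneg_L1_L3_mult_square[OF f nonneg_L1_L3_translate[OF g]] nonneg_L1_L3_mult_square[OF f g] by simp
  have "(a - b)^2 \<le> 2 * a^2 + 2 * b^2" for a b :: real
    using zero_le_power2[of "a + b"] by (simp add: power2_sum power2_diff)
  then have "f x * (g (x - u) - g x)^2 \<le> f x * (2 * (g (x - u))^2 + 2 * (g x)^2)" for x
    using nonneg_L1_L3D(1)[OF f] by (intro mult_left_mono) auto
  then show "AE x in lborel. norm (f x * (g (x - u) - g x)^2) \<le> norm (2 * (f x * (g (x - u))^2) + 2 * (f x * (g x)^2))"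
    using nonneg_L1_L3D(1)[OF f] by (intro AE_I2) (simp add: algebra_simps)
qed (use nonneg_L1_L3D(4)[OF f] nonneg_L1_L3D(4)[OF g] in measurable)

lemma truncation_tail_L3:
  assumes f: "nonneg_L1_L3 f" and "0 < e"
  obtains N :: nat where "N > 0" "(LINT x|lborel. (max 0 (f x - real N)) ^ 3) < e"
    "integrable lborel (\<lambda>x. (max 0 (f x - real N)) ^ 3)"
proof -
  note [measurable] = nonneg_L1_L3D(4)[OF f]
  have bd: "(max 0 (f x - real N)) ^ 3 \<le> f x ^ 3" for x N
    using nonneg_L1_L3D(1)[OF f, of x] by (intro power_mono) auto
  have "(\<lambda>N. LINT x|lborel. (max 0 (f x - real N)) ^ 3) \<longlonglongrightarrow> (LINT x|(lborel::'a measure). 0)"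
  proof (rule integral_dominated_convergence[where w="\<lambda>x. f x ^ 3"])
    show "AE x in lborel. (\<lambda>N. (max 0 (f x - real N)) ^ 3) \<longlonglongrightarrow> 0"
    proof (intro AE_I2 tendsto_eventually)
      fix x
      show "\<forall>\<^sub>F N in sequentially. (max 0 (f x - real N)) ^ 3 = 0"
        using eventually_ge_at_top[of "nat \<lceil>f x\<rceil>"]
      proof eventually_elim
        case (elim N)
        then have "f x \<le> real N" by linarith
        then show ?case by simp
      qed
    qed
  qed (use nonneg_L1_L3D[OF f] bd in auto)
  then have "\<forall>\<^sub>F N in sequentially. (LINT x|lborel. (max 0 (f x - real N)) ^ 3) < e \<and> N > 0"
    using \<open>0 < e\<close> by (auto intro!: eventually_conj order_tendstoD(2) eventually_gt_at_top)
  then obtain N where N: "(LINT x|lborel. (max 0 (f x - real N)) ^ 3) < e" "N > 0"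
    using eventually_happens by force
  have "integrable lborel (\<lambda>x. (max 0 (f x - real N)) ^ 3)"
    by (rule Bochner_Integration.integrable_bound[OF nonneg_L1_L3D(3)[OF f]])
       (use bd nonneg_L1_L3D(1)[OF f] in auto)
  with N that show ?thesis by blast
qed

text \<open>
The part of \<open>a\<close> below the level \<open>N\<close> is handled by \<open>b\<^sup>2 \<le> M b + b\<^sup>3 / M\<close>, which interpolates between first and third
powers, and the part above \<open>N\<close> by Young's inequality. Applied to \<open>a = f(x)\<close> and \<open>b = |g(x - u) - g(x)|\<close>,
only the first summand depends on \<open>u\<close> after bounding third moments, and it is small in \<open>L\<^sup>1\<close>.
\<close>

lemma truncated_square_bound:
  fixes a b N M \<delta> :: real
  assumes "0 \<le> a" "0 \<le> b" "0 < \<delta>" "0 < M" "0 < N"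
  shows "a * b^2 \<le> N * M * b + (N / M + \<delta>) * b ^ 3 + (max 0 (a - N)) ^ 3 / \<delta>^2"
proof -
  have 1: "b^2 \<le> M * b + b ^ 3 / M"
  proof -
    have "0 \<le> b * ((b - M)^2 + b * M)" using assms by simp
    then show ?thesis using assms by (simp add: field_simps power2_eq_square power3_eq_cube)
  qed
  have "a * b^2 \<le> N * b^2 + max 0 (a - N) * b^2"
    by (simp flip: distrib_right) (simp add: mult_right_mono)
  also have "\<dots> \<le> N * (M * b + b ^ 3 / M) + ((max 0 (a - N)) ^ 3 / \<delta>^2 + \<delta> * b ^ 3)"
    using assms by (intro add_mono mult_left_mono 1 mult_square_le_cubes) auto
  finally show ?thesis by (simp add: algebra_simps)
qed

text \<open>
Continuity in \<open>L\<^sup>2\<close> alone would not suffice, since the weight \<open>f\<close> is unbounded: the weight is the density of the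
observation at which the smoothing error is evaluated.
\<close>

lemma translate_continuous_weighted_L2:
  assumes f: "nonneg_L1_L3 f" and g: "nonneg_L1_L3 g" and u: "u \<longlonglongrightarrow> 0"
  shows "(\<lambda>n. LINT x|lborel. f x * (g (x - u n) - g x)^2) \<longlonglongrightarrow> 0"
proof (rule LIMSEQ_I)
  fix r :: real assume r: "r > 0"
  note [measurable] = nonneg_L1_L3D(4)[OF f] nonneg_L1_L3D(4)[OF g]
  have gu: "nonneg_L1_L3 (\<lambda>x. g (x - v))" for v by (rule nonneg_L1_L3_translate[OF g])
  define G where "G = 2 * (LINT x|lborel. g x ^ 3) + 1"
  have "G > 0" using nonneg_L1_L3D(1)[OF g] by (simp add: G_def add_nonneg_pos integral_nonneg_AE)
  have i3: "integrable lborel (\<lambda>x. \<bar>g (x - v) - g x\<bar> ^ 3)" for v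
  proof (rule Bochner_Integration.integrable_bound)
    show "integrable lborel (\<lambda>x. g (x - v) ^ 3 + g x ^ 3)"
      using nonneg_L1_L3D(3)[OF g] nonneg_L1_L3D(3)[OF gu, of v] by simp
    show "AE x in lborel. norm (\<bar>g (x - v) - g x\<bar> ^ 3) \<le> norm (g (x - v) ^ 3 + g x ^ 3)"
    proof (intro AE_I2)
      fix x
      show "norm (\<bar>g (x - v) - g x\<bar> ^ 3) \<le> norm (g (x - v) ^ 3 + g x ^ 3)"
        using abs_diff_cube_le[of "g (x - v)" "g x"] nonneg_L1_L3D(1)[OF g] by simp
    qed
  qed simp
  have G: "(LINT x|lborel. \<bar>g (x - v) - g x\<bar> ^ 3) \<le> G" for v
  proof -
    have "(LINT x|lborel. \<bar>g (x - v) - g x\<bar> ^ 3) \<le> (LINT x|lborel. g (x - v) ^ 3 + g x ^ 3)"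
      using i3[of v] nonneg_L1_L3D(3)[OF g] nonneg_L1_L3D(3)[OF gu, of v]
      by (intro integral_mono abs_diff_cube_le nonneg_L1_L3D(1)[OF g]) auto
    also have "\<dots> = 2 * (LINT x|lborel. g x ^ 3)"
      using nonneg_L1_L3D(3)[OF g] nonneg_L1_L3D(3)[OF gu, of v] lborel_integral_translate[of "\<lambda>x. g x ^ 3" v] by simp
    finally show ?thesis by (simp add: G_def)
  qed
  \<comment> \<open>The levels are chosen in the order \<open>\<delta>\<close>, \<open>N\<close>, \<open>M\<close> so that the three remaining terms are at most \<open>r / 4\<close> each.\<close>
  define \<delta> where "\<delta> = r / (4 * G)"
  have \<delta>: "\<delta> > 0" using r \<open>G > 0\<close> by (simp add: \<delta>_def)
  obtain N :: nat where N: "N > 0" "(LINT x|lborel. (max 0 (f x - real N)) ^ 3) < r / 4 * \<delta>^2"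
    "integrable lborel (\<lambda>x. (max 0 (f x - real N)) ^ 3)"
    using truncation_tail_L3[OF f, of "r / 4 * \<delta>^2"] r \<delta> by auto
  define M where "M = 4 * real N * G / r"
  have M: "M > 0" using r N \<open>G > 0\<close> by (simp add: M_def)
  have "(\<lambda>n. LINT x|lborel. \<bar>g (x - u n) - g x\<bar>) \<longlonglongrightarrow> 0"
    by (rule translate_continuous_L1[OF nonneg_L1_L3D(2)[OF g] u])
  then have lim: "(\<lambda>n. N * M * (LINT x|lborel. \<bar>g (x - u n) - g x\<bar>)) \<longlonglongrightarrow> 0"
    by (rule tendsto_mult_right_zero)
  obtain n0 where n0: "\<And>n. n \<ge> n0 \<Longrightarrow> norm (N * M * (LINT x|lborel. \<bar>g (x - u n) - g x\<bar>) - 0) < r / 4"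
    using LIMSEQ_D[OF lim divide_pos_pos[OF r, of 4]] by auto
  have "norm ((LINT x|lborel. f x * (g (x - u n) - g x)^2) - 0) < r" if n: "n \<ge> n0" for n
  proof -
    let ?D = "\<lambda>x. \<bar>g (x - u n) - g x\<bar>"
    have i1: "integrable lborel ?D"
      using nonneg_L1_L3D(2)[OF g] nonneg_L1_L3D(2)[OF gu[of "u n"]] by simp
    have "(LINT x|lborel. f x * (g (x - u n) - g x)^2)
        \<le> (LINT x|lborel. N * M * ?D x + (N / M + \<delta>) * ?D x ^ 3 + (max 0 (f x - N)) ^ 3 / \<delta>^2)"
    proof (intro integral_mono)
      show "integrable lborel (\<lambda>x. N * M * ?D x + (N / M + \<delta>) * ?D x ^ 3 + (max 0 (f x - N)) ^ 3 / \<delta>^2)"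
        using i1 i3[of "u n"] N(3) by simp
      show "f x * (g (x - u n) - g x)^2 \<le> N * M * ?D x + (N / M + \<delta>) * ?D x ^ 3 + (max 0 (f x - N)) ^ 3 / \<delta>^2" for x
        using truncated_square_bound[of "f x" "?D x" \<delta> M N] nonneg_L1_L3D(1)[OF f] \<delta> M N(1) by simp
    qed (use nonneg_L1_L3_mult_diff_square[OF f g] in auto)
    also have "\<dots> = N * M * (LINT x|lborel. ?D x) + (N / M + \<delta>) * (LINT x|lborel. ?D x ^ 3) + (LINT x|lborel. (max 0 (f x - N)) ^ 3) / \<delta>^2"
      using i1 i3[of "u n"] N(3) by simp
    also have "\<dots> < r / 4 + (N / M + \<delta>) * G + r / 4"
      using n0[OF n] N(2) \<delta> G[of "u n"] M
      by (intro add_less_le_mono add_less_le_mono mult_left_mono add_less_le_mono) (auto simp: field_simps)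
    also have "(N / M + \<delta>) * G = r / 2"
      using r N(1) \<open>G > 0\<close> by (simp add: M_def \<delta>_def field_simps)
    finally have "(LINT x|lborel. f x * (g (x - u n) - g x)^2) < r" by simp
    moreover have "(LINT x|lborel. f x * (g (x - u n) - g x)^2) \<ge> 0"
      using nonneg_L1_L3D(1)[OF f] by (simp add: integral_nonneg_AE)
    ultimately show ?thesis by simp
  qed
  then show "\<exists>no. \<forall>n\<ge>no. norm ((LINT x|lborel. f x * (g (x - u n) - g x)^2) - 0) < r" by blast
qed

lemma translate_weighted_L2_small:
  assumes f: "nonneg_L1_L3 f" and g: "nonneg_L1_L3 g" and "0 < \<eta>"
  shows "\<exists>r>0. \<forall>u. norm u \<le> r \<longrightarrow> (LINT x|lborel. f x * (g (x - u) - g x)^2) \<le> \<eta>"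
proof (rule ccontr)
  assume "\<not> ?thesis"
  then have "\<forall>n. \<exists>u. norm u \<le> inverse (real (Suc n)) \<and> \<not> (LINT x|lborel. f x * (g (x - u) - g x)^2) \<le> \<eta>"
    by (metis inverse_positive_iff_positive of_nat_0_less_iff zero_less_Suc)
  then obtain u where u: "\<And>n. norm (u n) \<le> inverse (real (Suc n))"
    "\<And>n. \<not> (LINT x|lborel. f x * (g (x - u n) - g x)^2) \<le> \<eta>" by metis
  have "u \<longlonglongrightarrow> 0"
    by (rule Lim_null_comparison[OF _ LIMSEQ_inverse_real_of_nat]) (use u(1) in auto)
  from order_tendstoD(2)[OF translate_continuous_weighted_L2[OF f g this] \<open>0 < \<eta>\<close>]
  have "\<forall>\<^sub>F n in sequentially. False" by eventually_elim (use u(2) less_imp_le in blast)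
  then show False by simp
qed

section \<open>Averages over small balls and their bias\<close>

definition ball_unif :: "real \<Rightarrow> 'a::euclidean_space measure" where
  "ball_unif e = uniform_measure lborel (cball 0 e)"

definition kern :: "real \<Rightarrow> 'a::euclidean_space \<Rightarrow> 'a \<Rightarrow> real" where
  "kern e x y = of_bool (dist x y \<le> e) / ball_vol TYPE('a) e"

text \<open>
The mean of \<open>p\<close> over a ball around \<open>x\<close>, that is the convolution of \<open>p\<close> with the kernel
(\<open>smooth_eq_integral_kern\<close>). Written as an expectation over a uniform shift, it is open to Jensen's inequality and
to the symmetry of the ball.
\<close>

definition smooth :: "real \<Rightarrow> ('a::euclidean_space \<Rightarrow> real) \<Rightarrow> 'a \<Rightarrow> real" where
  "smooth e p x = (LINT u|ball_unif e. p (x - u))"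

lemma ball_vol_pos: "0 < e \<Longrightarrow> 0 < ball_vol TYPE('a::euclidean_space) e"
  by (simp add: ball_vol_def content_cball_pos)

lemma ball_vol_eq: "0 \<le> e \<Longrightarrow> ball_vol TYPE('a::euclidean_space) e = unit_ball_vol (DIM('a)) * e ^ DIM('a)"
  by (simp add: ball_vol_def content_cball)

lemma emeasure_cball_ball_vol:
  "emeasure lborel (cball (0::'a::euclidean_space) e) = ennreal (ball_vol TYPE('a) e)"
  unfolding ball_vol_def by (rule emeasure_eq_ennreal_measure) (use emeasure_lborel_cball_finite[of "0::'a" e] in auto)

lemma sets_ball_unif[measurable_cong, simp]: "sets (ball_unif e) = sets borel"
  by (simp add: ball_unif_def)

lemma prob_space_ball_unif:
  "0 < e \<Longrightarrow> prob_space (ball_unif e :: 'a::euclidean_space measure)"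
  unfolding ball_unif_def
  using ball_vol_pos[where 'a='a, of e]
  by (intro prob_space_uniform_measure) (simp_all add: emeasure_cball_ball_vol)

lemma measurable_cball[measurable]: "cball (x::'a::euclidean_space) r \<in> sets borel"
  by simp

lemma ball_unif_eq_density:
  assumes "0 < e"
  shows "(ball_unif e :: 'a::euclidean_space measure)
    = density lborel (\<lambda>u. ennreal (indicator (cball 0 e) u / ball_vol TYPE('a) e))"
proof -
  have "indicator (cball 0 e) u / emeasure lborel (cball (0::'a) e)
      = ennreal (indicator (cball 0 e) u / ball_vol TYPE('a) e)" for u :: 'a
    using ball_vol_pos[where 'a='a, OF assms]
    by (auto simp: emeasure_cball_ball_vol indicator_def divide_ennreal simp flip: ennreal_1)
  then show ?thesis by (simp add: ball_unif_def uniform_measure_def)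
qed

lemma integral_ball_unif:
  fixes h :: "'a::euclidean_space \<Rightarrow> real"
  assumes "0 < e" and [measurable]: "h \<in> borel_measurable borel"
  shows "(LINT u|ball_unif e. h u) = (LINT u|lborel. indicator (cball 0 e) u * h u) / ball_vol TYPE('a) e"
proof -
  let ?b = "ball_vol TYPE('a) e"
  have b: "?b > 0" by (rule ball_vol_pos) fact
  have "(LINT u|ball_unif e. h u) = (LINT u|lborel. (indicator (cball 0 e) u / ?b) *\<^sub>R h u)"
    unfolding ball_unif_eq_density[OF assms(1)] by (rule integral_density) (use b in auto)
  then show ?thesis by simp
qed

lemma integral_ball_unif_uminus:
  fixes h :: "'a::euclidean_space \<Rightarrow> real"
  assumes "0 < e" and [measurable]: "h \<in> borel_measurable borel"
  shows "(LINT u|ball_unif e. h (- u)) = (LINT u|ball_unif e. h u)"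
proof -
  have "(LINT u|lborel. indicator (cball 0 e) u * h (- u)) = (LINT u|lborel. indicator (cball 0 e) (0 - u) * h (0 - u))"
    by (intro Bochner_Integration.integral_cong) (auto simp: indicator_def)
  also have "\<dots> = (LINT u|lborel. indicator (cball 0 e) u * h u)"
    by (rule lborel_integral_reflect[where x=0 and f="\<lambda>u. indicator (cball 0 e) u * h u"]) simp
  finally show ?thesis using assms by (simp add: integral_ball_unif)
qed

lemma AE_ball_unif: "AE u in ball_unif e. u \<in> cball 0 e"
  unfolding ball_unif_def by (rule AE_uniform_measureI) auto

lemma integrable_ball_unif_reflect:
  fixes h :: "'a::euclidean_space \<Rightarrow> real"
  assumes "0 < e" and h: "integrable lborel h"
  shows "integrable (ball_unif e) (\<lambda>u. h (x - u))"
proof -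
  have [measurable]: "h \<in> borel_measurable borel" using h by simp
  let ?b = "ball_vol TYPE('a) e"
  have b: "?b > 0" by (rule ball_vol_pos) fact
  have "integrable lborel (\<lambda>u. (indicator (cball 0 e) u / ?b) *\<^sub>R h (x - u))"
  proof (rule Bochner_Integration.integrable_bound[of lborel "\<lambda>u. (1 / ?b) * h (x - u)"])
    show "integrable lborel (\<lambda>u. (1 / ?b) * h (x - u))"
      using h by (simp add: lborel_integrable_reflect_iff)
  qed (auto simp: indicator_def)
  then show ?thesis
    unfolding ball_unif_eq_density[OF assms(1)] using b by (subst integrable_density) auto
qed

lemma smooth_eq_integral_kern:
  fixes p :: "'a::euclidean_space \<Rightarrow> real"
  assumes "0 < e" and [measurable]: "p \<in> borel_measurable borel"
  shows "smooth e p x = (LINT y|lborel. kern e x y * p y)"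
proof -
  let ?b = "ball_vol TYPE('a) e"
  have "smooth e p x = (LINT u|lborel. indicator (cball 0 e) (x - (x - u)) * p (x - u)) / ?b"
    unfolding smooth_def using assms by (simp add: integral_ball_unif)
  also have "(LINT u|lborel. indicator (cball 0 e) (x - (x - u)) * p (x - u)) = (LINT y|lborel. indicator (cball 0 e) (x - y) * p y)"
    by (rule lborel_integral_reflect[where f="\<lambda>y. indicator (cball 0 e) (x - y) * p y"]) simp
  also have "\<dots> / ?b = (LINT y|lborel. indicator (cball 0 e) (x - y) * p y / ?b)" by simp
  also have "\<dots> = (LINT y|lborel. kern e x y * p y)"
    by (intro Bochner_Integration.integral_cong) (auto simp: kern_def dist_norm indicator_def norm_minus_commute)
  finally show ?thesis .
qed

lemma kern_commute: "kern e x y = kern e y x"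
  by (simp add: kern_def dist_commute)

lemma kern_bounds: "0 \<le> kern e x y" "kern e x (y::'a::euclidean_space) \<le> 1 / ball_vol TYPE('a) e"
  by (auto simp: kern_def ball_vol_def)

lemma measurable_kern[measurable (raw)]:
  assumes [measurable]: "f \<in> borel_measurable M" "g \<in> borel_measurable M"
  shows "(\<lambda>z. kern e (f z) (g z :: 'a::euclidean_space)) \<in> borel_measurable M"
  unfolding kern_def by measurable

lemma measurable_smooth[measurable]:
  fixes p :: "'a::euclidean_space \<Rightarrow> real"
  assumes "0 < e" and [measurable]: "p \<in> borel_measurable borel"
  shows "smooth e p \<in> borel_measurable borel"
proof -
  interpret prob_space "ball_unif e :: 'a measure" by (rule prob_space_ball_unif) fact
  show ?thesis unfolding smooth_def by measurable
qed

lemma smooth_nonneg: "(\<And>x. 0 \<le> p x) \<Longrightarrow> 0 \<le> smooth e p x"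
  unfolding smooth_def by (intro integral_nonneg_AE) auto

text \<open>
This crude bound keeps every variable bounded for a fixed radius, and it trades one factor of a square for the
factor \<open>1 / b\<^sub>e\<close>.
\<close>

lemma smooth_le:
  fixes p :: "'a::euclidean_space \<Rightarrow> real"
  assumes "0 < e" and p: "integrable lborel p" "\<And>x. 0 \<le> p x"
  shows "smooth e p x \<le> (LINT y|lborel. p y) / ball_vol TYPE('a) e"
proof -
  have [measurable]: "p \<in> borel_measurable borel" using p by simp
  have b: "ball_vol TYPE('a) e > 0" by (rule ball_vol_pos) fact
  have "smooth e p x \<le> (LINT y|lborel. 1 / ball_vol TYPE('a) e * p y)"
    unfolding smooth_eq_integral_kern[OF \<open>0 < e\<close> \<open>p \<in> _\<close>]
  proof (intro integral_mono)
    show "integrable lborel (\<lambda>y. kern e x y * p y)"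
    proof (rule Bochner_Integration.integrable_bound[of lborel "\<lambda>y. 1 / ball_vol TYPE('a) e * p y"])
      show "AE y in lborel. norm (kern e x y * p y) \<le> norm (1 / ball_vol TYPE('a) e * p y)"
        using p(2) kern_bounds[of e x] b by (intro AE_I2) (auto simp: abs_mult simp del: times_divide_eq_left intro!: mult_right_mono)
    qed (use p in auto)
    show "kern e x y * p y \<le> 1 / ball_vol TYPE('a) e * p y" for y
      using p(2) kern_bounds by (intro mult_right_mono) auto
  qed (use p in auto)
  then show ?thesis by simp
qed

lemma smooth_jensen:
  fixes p :: "'a::euclidean_space \<Rightarrow> real"
  assumes e: "0 < e" and p: "nonneg_L1_L3 p"
  shows "integrable (ball_unif e) (\<lambda>u. (p (x - u) - p x)^2)"
    and "(smooth e p x - p x)^2 \<le> (LINT u|ball_unif e. (p (x - u) - p x)^2)"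
proof -
  interpret U: prob_space "ball_unif e :: 'a measure" by (rule prob_space_ball_unif) fact
  have 1: "integrable (ball_unif e) (\<lambda>u. p (x - u))"
    by (rule integrable_ball_unif_reflect[OF e nonneg_L1_L3D(2)[OF p]])
  have 2: "integrable (ball_unif e) (\<lambda>u. (p (x - u))^2)"
    by (rule integrable_ball_unif_reflect[OF e nonneg_L1_L3_square[OF p]])
  show 3: "integrable (ball_unif e) (\<lambda>u. (p (x - u) - p x)^2)"
    using 1 2 by (simp add: power2_diff)
  have "smooth e p x - p x = U.expectation (\<lambda>u. p (x - u) - p x)"
    using 1 by (simp add: smooth_def U.prob_space)
  moreover have "0 \<le> U.variance (\<lambda>u. p (x - u) - p x)" by (rule U.variance_positive)
  moreover have "U.variance (\<lambda>u. p (x - u) - p x) = U.expectation (\<lambda>u. (p (x - u) - p x)^2) - (U.expectation (\<lambda>u. p (x - u) - p x))^2"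
    using 1 3 by (intro U.variance_eq) auto
  ultimately show "(smooth e p x - p x)^2 \<le> (LINT u|ball_unif e. (p (x - u) - p x)^2)" by simp
qed

text \<open>
Jensen's inequality for the uniform shift, followed by Fubini's theorem, bounds the error of smoothing by the worst
translation error within the ball.
\<close>

lemma smooth_weighted_L2_error:
  fixes f g :: "'a::euclidean_space \<Rightarrow> real"
  assumes e: "0 < e" and f: "nonneg_L1_L3 f" and g: "nonneg_L1_L3 g"
    and \<eta>: "\<And>u. norm u \<le> e \<Longrightarrow> (LINT x|lborel. f x * (g (x - u) - g x)^2) \<le> \<eta>"
  shows "integrable lborel (\<lambda>x. f x * (smooth e g x - g x)^2)"
    and "(LINT x|lborel. f x * (smooth e g x - g x)^2) \<le> \<eta>"
proof -
  interpret U: prob_space "ball_unif e :: 'a measure" by (rule prob_space_ball_unif) fact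
  interpret P: pair_sigma_finite "lborel :: 'a measure" "ball_unif e :: 'a measure" ..
  note [measurable] = nonneg_L1_L3D(4)[OF f] nonneg_L1_L3D(4)[OF g] measurable_smooth[OF e nonneg_L1_L3D(4)[OF g]]
  note [simp] = nonneg_L1_L3D(1)[OF f]
  have \<eta>0: "0 \<le> \<eta>" using \<eta>[of 0] e by simp
  have "(\<integral>\<^sup>+x. ennreal (f x * (smooth e g x - g x)^2) \<partial>lborel)
    \<le> (\<integral>\<^sup>+x. \<integral>\<^sup>+u. ennreal (f x * (g (x - u) - g x)^2) \<partial>ball_unif e \<partial>lborel)"
  proof (rule nn_integral_mono)
    fix x
    have "ennreal (f x * (smooth e g x - g x)^2) \<le> ennreal (LINT u|ball_unif e. f x * (g (x - u) - g x)^2)"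
      using smooth_jensen(2)[OF e g, of x] by (auto intro!: ennreal_leI mult_left_mono)
    also have "\<dots> = (\<integral>\<^sup>+u. ennreal (f x * (g (x - u) - g x)^2) \<partial>ball_unif e)"
      using smooth_jensen(1)[OF e g, of x] by (subst nn_integral_eq_integral) auto
    finally show "ennreal (f x * (smooth e g x - g x)^2) \<le> (\<integral>\<^sup>+u. ennreal (f x * (g (x - u) - g x)^2) \<partial>ball_unif e)" .
  qed
  also have "\<dots> = (\<integral>\<^sup>+u. \<integral>\<^sup>+x. ennreal (f x * (g (x - u) - g x)^2) \<partial>lborel \<partial>ball_unif e)"
    by (rule P.Fubini'[symmetric]) measurable
  also have "\<dots> \<le> (\<integral>\<^sup>+u. ennreal \<eta> \<partial>(ball_unif e :: 'a measure))"
  proof (rule nn_integral_mono_AE)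
    show "AE u in ball_unif e. (\<integral>\<^sup>+x. ennreal (f x * (g (x - u) - g x)^2) \<partial>lborel) \<le> ennreal \<eta>"
      using AE_ball_unif
    proof eventually_elim
      case (elim u)
      then show ?case
        using nonneg_L1_L3_mult_diff_square[OF f g, of u] \<eta>[of u]
        by (subst nn_integral_eq_integral) (auto intro: ennreal_leI)
    qed
  qed
  also have "\<dots> = ennreal \<eta>" by (simp add: U.emeasure_space_1)
  finally have le: "(\<integral>\<^sup>+x. ennreal (f x * (smooth e g x - g x)^2) \<partial>lborel) \<le> ennreal \<eta>" .
  show int: "integrable lborel (\<lambda>x. f x * (smooth e g x - g x)^2)"
    using le by (intro integrableI_bounded) (auto simp: abs_mult intro: order.strict_trans1)
  show "(LINT x|lborel. f x * (smooth e g x - g x)^2) \<le> \<eta>"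
    using le \<eta>0 by (subst (asm) nn_integral_eq_integral[OF int]) auto
qed

text \<open>
The cross-correlation of \<open>f\<close> and \<open>g\<close>: its value at \<open>0\<close> is the functional to be estimated, and its mean over a small
ball is the expectation of the kernel at independent arguments.
\<close>

definition shift_corr :: "('a::euclidean_space \<Rightarrow> real) \<Rightarrow> ('a \<Rightarrow> real) \<Rightarrow> 'a \<Rightarrow> real" where
  "shift_corr f g u = (LINT x|lborel. f x * g (x - u))"

lemma shift_corr_uminus:
  assumes [measurable]: "f \<in> borel_measurable borel" "g \<in> borel_measurable borel"
  shows "shift_corr f g (- u) = shift_corr g f u"
  unfolding shift_corr_def
  using lborel_integral_translate[of "\<lambda>x. f x * g (x + u)" u] by (simp add: mult.commute)

lemma measurable_shift_corr[measurable]: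
  assumes [measurable]: "f \<in> borel_measurable borel" "g \<in> borel_measurable borel"
  shows "shift_corr f g \<in> borel_measurable borel"
  unfolding shift_corr_def by measurable

lemma shift_corr_bounds:
  assumes f: "nonneg_L1_L3 f" and g: "nonneg_L1_L3 g"
  shows "0 \<le> shift_corr f g u"
    and "shift_corr f g u \<le> (LINT x|lborel. (f x)^2) + (LINT x|lborel. (g x)^2)"
proof -
  note [measurable] = nonneg_L1_L3D(4)[OF f] nonneg_L1_L3D(4)[OF g]
  note gu = nonneg_L1_L3_translate[OF g, of u]
  show "0 \<le> shift_corr f g u"
    unfolding shift_corr_def using nonneg_L1_L3D(1)[OF f] nonneg_L1_L3D(1)[OF g] by (intro integral_nonneg_AE) auto
  have "a * b \<le> a^2 + b^2" for a b :: real
    using sum_squares_bound[of a b] zero_le_power2[of "a + b"] by (simp add: power2_sum)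
  then have "shift_corr f g u \<le> (LINT x|lborel. (f x)^2 + (g (x - u))^2)"
    unfolding shift_corr_def using nonneg_L1_L3_mult[OF f gu] nonneg_L1_L3_square[OF f] nonneg_L1_L3_square[OF gu]
    by (intro integral_mono) auto
  also have "\<dots> = (LINT x|lborel. (f x)^2) + (LINT x|lborel. (g x)^2)"
    using nonneg_L1_L3_square[OF f] nonneg_L1_L3_square[OF gu] lborel_integral_translate[of "\<lambda>x. (g x)^2" u] by simp
  finally show "shift_corr f g u \<le> (LINT x|lborel. (f x)^2) + (LINT x|lborel. (g x)^2)" .
qed

lemma integral_mult_smooth:
  fixes f g :: "'a::euclidean_space \<Rightarrow> real"
  assumes e: "0 < e" and f: "nonneg_L1_L3 f" and g: "nonneg_L1_L3 g"
  shows "(LINT x|lborel. f x * smooth e g x) = (LINT u|ball_unif e. shift_corr f g u)"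
proof -
  interpret U: prob_space "ball_unif e :: 'a measure" by (rule prob_space_ball_unif) fact
  interpret P: pair_sigma_finite "lborel :: 'a measure" "ball_unif e :: 'a measure" ..
  note [measurable] = nonneg_L1_L3D(4)[OF f] nonneg_L1_L3D(4)[OF g] measurable_smooth[OF e nonneg_L1_L3D(4)[OF g]]
  note [simp] = nonneg_L1_L3D(1)[OF f] nonneg_L1_L3D(1)[OF g]
  have [simp]: "0 \<le> smooth e g x" for x by (rule smooth_nonneg) simp
  have "(\<integral>\<^sup>+x. ennreal (f x * smooth e g x) \<partial>lborel)
    = (\<integral>\<^sup>+x. \<integral>\<^sup>+u. ennreal (f x * g (x - u)) \<partial>ball_unif e \<partial>lborel)"
  proof (rule nn_integral_cong)
    fix x
    have "(\<integral>\<^sup>+u. ennreal (f x * g (x - u)) \<partial>ball_unif e) = ennreal (LINT u|ball_unif e. f x * g (x - u))"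
      using integrable_ball_unif_reflect[OF e nonneg_L1_L3D(2)[OF g], of x]
      by (subst nn_integral_eq_integral) auto
    then show "ennreal (f x * smooth e g x) = (\<integral>\<^sup>+u. ennreal (f x * g (x - u)) \<partial>ball_unif e)"
      by (simp add: smooth_def)
  qed
  also have "\<dots> = (\<integral>\<^sup>+u. \<integral>\<^sup>+x. ennreal (f x * g (x - u)) \<partial>lborel \<partial>ball_unif e)"
    by (rule P.Fubini'[symmetric]) measurable
  also have "\<dots> = (\<integral>\<^sup>+u. ennreal (shift_corr f g u) \<partial>ball_unif e)"
    unfolding shift_corr_def using nonneg_L1_L3_mult[OF f nonneg_L1_L3_translate[OF g]]
    by (intro nn_integral_cong nn_integral_eq_integral) auto
  finally show ?thesis
    using shift_corr_bounds(1)[OF f g] by (simp add: integral_eq_nn_integral)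
qed

lemma integrable_shift_corr:
  fixes f g :: "'a::euclidean_space \<Rightarrow> real"
  assumes e: "0 < e" and f: "nonneg_L1_L3 f" and g: "nonneg_L1_L3 g"
  shows "integrable (ball_unif e) (shift_corr f g)"
proof -
  interpret U: prob_space "ball_unif e :: 'a measure" by (rule prob_space_ball_unif) fact
  note [measurable] = nonneg_L1_L3D(4)[OF f] nonneg_L1_L3D(4)[OF g]
  show ?thesis
    using shift_corr_bounds[OF f g]
    by (intro U.integrable_const_bound[where B="(LINT x|lborel. (f x)^2) + (LINT x|lborel. (g x)^2)"]) auto
qed

lemma integral_mult_smooth_commute:
  fixes f g :: "'a::euclidean_space \<Rightarrow> real"
  assumes e: "0 < e" and f: "nonneg_L1_L3 f" and g: "nonneg_L1_L3 g"
  shows "(LINT x|lborel. g x * smooth e f x) = (LINT x|lborel. f x * smooth e g x)"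
  using integral_ball_unif_uminus[OF e, of "shift_corr f g"] nonneg_L1_L3D(4)[OF f] nonneg_L1_L3D(4)[OF g]
  by (simp add: integral_mult_smooth[OF e f g] integral_mult_smooth[OF e g f] shift_corr_uminus)

lemma integral_mult_smooth_bounds:
  fixes f g :: "'a::euclidean_space \<Rightarrow> real"
  assumes e: "0 < e" and f: "nonneg_L1_L3 f" and g: "nonneg_L1_L3 g"
  shows "(LINT x|lborel. f x * smooth e g x) \<le> (LINT x|lborel. (f x)^2) + (LINT x|lborel. (g x)^2)"
proof -
  interpret U: prob_space "ball_unif e :: 'a measure" by (rule prob_space_ball_unif) fact
  show ?thesis unfolding integral_mult_smooth[OF assms]
    by (rule U.integral_le_const[OF integrable_shift_corr[OF e f g]]) (use shift_corr_bounds(2)[OF f g] in simp)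
qed

lemma abs_mult_le_half_squares: "\<bar>a * b\<bar> \<le> (a^2 + b^2) / (2::real)"
  using sum_squares_bound[of "\<bar>a\<bar>" "\<bar>b\<bar>"] by (simp add: abs_mult)

text \<open>
By translation invariance, the second difference of \<open>shift_corr f g\<close> at \<open>0\<close> equals
\<open>- \<integral> (f(x - u) - f(x)) (g(x - u) - g(x)) dx\<close>. Each factor has the smoothness of one density, which doubles the order
of the bias.
\<close>

lemma shift_corr_second_difference:
  fixes f g :: "'a::euclidean_space \<Rightarrow> real"
  assumes f: "nonneg_L1_L3 f" and g: "nonneg_L1_L3 g"
    and "(LINT x|lborel. (f (x - u) - f x)^2) \<le> D" "(LINT x|lborel. (g (x - u) - g x)^2) \<le> D"
  shows "\<bar>shift_corr f g u + shift_corr f g (- u) - 2 * shift_corr f g 0\<bar> \<le> D"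
proof -
  note [measurable] = nonneg_L1_L3D(4)[OF f] nonneg_L1_L3D(4)[OF g]
  note fu = nonneg_L1_L3_translate[OF f, of u] and gu = nonneg_L1_L3_translate[OF g, of u]
  note ints = nonneg_L1_L3_mult[OF f g] nonneg_L1_L3_mult[OF f gu] nonneg_L1_L3_mult[OF fu g] nonneg_L1_L3_mult[OF fu gu]
  have sqs: "integrable lborel (\<lambda>x. (f (x - u) - f x)^2)" "integrable lborel (\<lambda>x. (g (x - u) - g x)^2)"
    using nonneg_L1_L3_square[OF f] nonneg_L1_L3_square[OF fu] nonneg_L1_L3_mult[OF fu f]
      nonneg_L1_L3_square[OF g] nonneg_L1_L3_square[OF gu] nonneg_L1_L3_mult[OF gu g]
    by (simp_all add: power2_diff mult.assoc)
  have "shift_corr f g u + shift_corr f g (- u) - 2 * shift_corr f g 0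
      = - (LINT x|lborel. (f (x - u) - f x) * (g (x - u) - g x))"
  proof -
    have "(LINT x|lborel. (f (x - u) - f x) * (g (x - u) - g x))
        = (LINT x|lborel. f (x - u) * g (x - u) - f (x - u) * g x - f x * g (x - u) + f x * g x)"
      by (intro Bochner_Integration.integral_cong) (auto simp: algebra_simps)
    also have "\<dots> = (LINT x|lborel. f (x - u) * g (x - u)) - (LINT x|lborel. f (x - u) * g x)
        - (LINT x|lborel. f x * g (x - u)) + (LINT x|lborel. f x * g x)"
      using ints by simp
    also have "(LINT x|lborel. f (x - u) * g (x - u)) = (LINT x|lborel. f x * g x)"
      by (rule lborel_integral_translate[of "\<lambda>x. f x * g x" u]) simp
    also have "(LINT x|lborel. f (x - u) * g x) = shift_corr f g (- u)"
      by (subst shift_corr_uminus) (simp_all add: shift_corr_def mult.commute)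
    finally show ?thesis by (simp add: shift_corr_def)
  qed
  also have "\<bar>\<dots>\<bar> \<le> (LINT x|lborel. \<bar>(f (x - u) - f x) * (g (x - u) - g x)\<bar>)"
    unfolding abs_minus_cancel by (rule integral_abs_bound)
  also have "\<dots> \<le> (LINT x|lborel. ((f (x - u) - f x)^2 + (g (x - u) - g x)^2) / 2)"
  proof (rule integral_mono)
    show "integrable lborel (\<lambda>x. \<bar>(f (x - u) - f x) * (g (x - u) - g x)\<bar>)"
    proof (rule Bochner_Integration.integrable_bound)
      show "integrable lborel (\<lambda>x. ((f (x - u) - f x)^2 + (g (x - u) - g x)^2) / 2)"
        using sqs by simp
      show "AE x in lborel. norm \<bar>(f (x - u) - f x) * (g (x - u) - g x)\<bar>
          \<le> norm (((f (x - u) - f x)^2 + (g (x - u) - g x)^2) / 2)"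
        by (intro AE_I2) (simp only: real_norm_def abs_idempotent order_trans[OF abs_mult_le_half_squares abs_ge_self])
    qed measurable
    show "integrable lborel (\<lambda>x. ((f (x - u) - f x)^2 + (g (x - u) - g x)^2) / 2)"
      using sqs by simp
  qed (rule abs_mult_le_half_squares)
  also have "\<dots> \<le> D" using sqs assms(3,4) by simp
  finally show ?thesis .
qed

lemma smooth_bias_le:
  fixes f g :: "'a::euclidean_space \<Rightarrow> real"
  assumes e: "0 < e" and f: "nonneg_L1_L3 f" and g: "nonneg_L1_L3 g"
    and D: "\<And>u. norm u \<le> e \<Longrightarrow> (LINT x|lborel. (f (x - u) - f x)^2) \<le> D"
      "\<And>u. norm u \<le> e \<Longrightarrow> (LINT x|lborel. (g (x - u) - g x)^2) \<le> D"
  shows "\<bar>(LINT x|lborel. f x * smooth e g x) - (LINT x|lborel. f x * g x)\<bar> \<le> D"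
proof -
  interpret U: prob_space "ball_unif e :: 'a measure" by (rule prob_space_ball_unif) fact
  note [measurable] = nonneg_L1_L3D(4)[OF f] nonneg_L1_L3D(4)[OF g]
  let ?c = "shift_corr f g"
  have ic: "integrable (ball_unif e) ?c" by (rule integrable_shift_corr[OF e f g])
  have ic': "integrable (ball_unif e) (\<lambda>u. ?c (- u))"
    using integrable_shift_corr[OF e g f] by (simp add: shift_corr_uminus)
  \<comment> \<open>The uniform distribution is symmetric, so only the even part of the cross-correlation contributes.\<close>
  have i: "integrable (ball_unif e) (\<lambda>u. ?c u + ?c (- u) - 2 * ?c 0)" using ic ic' by simp
  have "\<bar>LINT u|ball_unif e. ?c u + ?c (- u) - 2 * ?c 0\<bar> \<le> (LINT u|ball_unif e. \<bar>?c u + ?c (- u) - 2 * ?c 0\<bar>)"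
    by (rule integral_abs_bound)
  also have "\<dots> \<le> D"
  proof (rule U.integral_le_const)
    show "AE u in ball_unif e. \<bar>?c u + ?c (- u) - 2 * ?c 0\<bar> \<le> D"
      using AE_ball_unif by eventually_elim (auto intro!: shift_corr_second_difference f g D)
  qed (use i in auto)
  also have "(LINT u|ball_unif e. ?c u + ?c (- u) - 2 * ?c 0) = 2 * ((LINT u|ball_unif e. ?c u) - ?c 0)"
    using ic ic' integral_ball_unif_uminus[OF e, of ?c] by (simp add: U.prob_space)
  also have "?c 0 = (LINT x|lborel. f x * g x)" by (simp add: shift_corr_def)
  finally have "2 * \<bar>(LINT u|ball_unif e. ?c u) - (LINT x|lborel. f x * g x)\<bar> \<le> D" by linarith
  then have "2 * \<bar>(LINT x|lborel. f x * smooth e g x) - (LINT x|lborel. f x * g x)\<bar> \<le> D"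
    unfolding integral_mult_smooth[OF e f g] .
  then show ?thesis using abs_ge_zero[of "(LINT x|lborel. f x * smooth e g x) - (LINT x|lborel. f x * g x)"] by argo
qed

section \<open>Independence in stationary \<open>m\<close>-dependent sequences\<close>

text \<open>
This and the next lemma transfer the assumptions on \<open>X\<close> to the sequence of pairs \<open>(X\<^sub>i, X\<^sub>i)\<close>, which turns the
one-sample estimator into an instance of the two-sample one.
\<close>

lemma strictly_stationary_compose:
  fixes f :: "'b::topological_space \<Rightarrow> 'c::topological_space"
  assumes stat: "strictly_stationary M W" and W: "\<And>i. 1 \<le> i \<Longrightarrow> W i \<in> borel_measurable M"
    and f: "f \<in> borel_measurable borel"
  shows "strictly_stationary M (\<lambda>i w. f (W i w))"
  unfolding strictly_stationary_def
proof (intro allI impI, elim conjE)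
  fix J :: "nat set" and h assume J: "finite J" "J \<subseteq> {1..}"
  let ?F = "\<lambda>x. \<lambda>i\<in>J. f (x i)"
  have F: "?F \<in> PiM J (\<lambda>_. borel) \<rightarrow>\<^sub>M PiM J (\<lambda>_. borel)"
    using f by measurable
  have *: "distr M (PiM J (\<lambda>_. borel)) (\<lambda>w. \<lambda>i\<in>J. f (W (i + h) w))
      = distr (distr M (PiM J (\<lambda>_. borel)) (\<lambda>w. \<lambda>i\<in>J. W (i + h) w)) (PiM J (\<lambda>_. borel)) ?F" for h
  proof -
    have "(\<lambda>w. \<lambda>i\<in>J. W (i + h) w) \<in> M \<rightarrow>\<^sub>M PiM J (\<lambda>_. borel)"
      using J W by (intro measurable_restrict) auto
    then show ?thesis
      by (subst distr_distr[OF F]) (auto intro!: arg_cong[where f="distr _ _"] simp: fun_eq_iff)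
  qed
  show "distr M (PiM J (\<lambda>_. borel)) (\<lambda>w. \<lambda>i\<in>J. f (W (i + h) w))
      = distr M (PiM J (\<lambda>_. borel)) (\<lambda>w. \<lambda>i\<in>J. f (W i w))"
    using *[of h] *[of 0] stat J unfolding strictly_stationary_def by simp
qed

lemma m_dependent_compose:
  fixes f :: "'b::topological_space \<Rightarrow> 'c::topological_space"
  assumes "prob_space M" and mdep: "m_dependent M m W" and f: "f \<in> borel_measurable borel"
  shows "m_dependent M m (\<lambda>i w. f (W i w))"
  unfolding m_dependent_def
proof (intro allI impI)
  interpret prob_space M by fact
  fix b k l :: nat assume *: "1 \<le> b" "1 \<le> k" "1 \<le> l" "m < k"
  have F: "(\<lambda>x. \<lambda>i\<in>J. f (x i)) \<in> PiM J (\<lambda>_. borel) \<rightarrow>\<^sub>M PiM J (\<lambda>_. borel)" for J :: "nat set"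
    using f by measurable
  have "indep_var (PiM {1..b} (\<lambda>_. borel)) (\<lambda>w. \<lambda>i\<in>{1..b}. W i w)
      (PiM {b+k..b+k+l} (\<lambda>_. borel)) (\<lambda>w. \<lambda>i\<in>{b+k..b+k+l}. W i w)"
    using mdep * unfolding m_dependent_def by blast
  from indep_var_compose[OF this F F]
  show "indep_var (PiM {1..b} (\<lambda>_. borel)) (\<lambda>w. \<lambda>i\<in>{1..b}. f (W i w))
      (PiM {b+k..b+k+l} (\<lambda>_. borel)) (\<lambda>w. \<lambda>i\<in>{b+k..b+k+l}. f (W i w))"
    by (auto simp: comp_def cong: restrict_cong)
qed

lemma strictly_stationary_pair:
  fixes W :: "nat \<Rightarrow> 'w \<Rightarrow> 'b::topological_space"
  assumes stat: "strictly_stationary M W" and W: "\<And>i. 1 \<le> i \<Longrightarrow> W i \<in> borel_measurable M"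
    and ij: "1 \<le> i" "1 \<le> j"
  shows "distr M (borel \<Otimes>\<^sub>M borel) (\<lambda>w. (W (i + h) w, W (j + h) w))
       = distr M (borel \<Otimes>\<^sub>M borel) (\<lambda>w. (W i w, W j w))"
proof -
  let ?P = "PiM {i, j} (\<lambda>_. borel :: 'b measure)"
  let ?F = "\<lambda>x::nat \<Rightarrow> 'b. (x i, x j)"
  have F: "?F \<in> ?P \<rightarrow>\<^sub>M borel \<Otimes>\<^sub>M borel" by measurable
  have *: "distr M (borel \<Otimes>\<^sub>M borel) (\<lambda>w. (W (i + h) w, W (j + h) w))
      = distr (distr M ?P (\<lambda>w. \<lambda>i\<in>{i, j}. W (i + h) w)) (borel \<Otimes>\<^sub>M borel) ?F" for h
  proof -
    have "(\<lambda>w. \<lambda>i\<in>{i, j}. W (i + h) w) \<in> M \<rightarrow>\<^sub>M ?P"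
      using ij W by (intro measurable_restrict) auto
    then show ?thesis by (subst distr_distr[OF F]) (auto simp: comp_def)
  qed
  show ?thesis
    using *[of h] *[of 0] stat ij unfolding strictly_stationary_def by simp
qed

text \<open>
Isolation is required on one side of \<open>J\<close> only: a smallest or largest index far from the others is separated from
them by a single gap, which is exactly the situation that \<open>m\<close>-dependence speaks about.
\<close>

definition isolated :: "nat \<Rightarrow> nat \<Rightarrow> nat set \<Rightarrow> bool" where
  "isolated m i J \<longleftrightarrow> (\<forall>j\<in>J. i + m < j) \<or> (\<forall>j\<in>J. j + m < i)"

definition near :: "nat \<Rightarrow> nat \<Rightarrow> nat \<Rightarrow> bool" where
  "near m i j \<longleftrightarrow> i \<le> j + m \<and> j \<le> i + m"

lemma near_commute: "near m i j \<longleftrightarrow> near m j i"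
  by (auto simp: near_def)

text \<open>
If neither end of the sorted quadruple is separated by a gap, its two lower and its two upper members are neighbours.
\<close>

lemma paired_or_isolated_sorted:
  assumes "i \<le> j" "j \<le> k" "k \<le> l"
  shows "near m i j \<and> near m k l \<or> isolated m i {j, k, l} \<or> isolated m l {i, j, k}"
proof (cases "j \<le> i + m \<and> l \<le> k + m")
  case True
  then show ?thesis using assms by (simp add: near_def)
next
  case False
  then show ?thesis using assms by (auto simp: isolated_def)
qed

lemma paired_or_isolated:
  "near m i j \<and> near m k l \<or> near m i k \<and> near m j l \<or> near m i l \<and> near m j k \<or>
   isolated m i {j, k, l} \<or> isolated m j {i, k, l} \<or> isolated m k {i, j, l} \<or> isolated m l {i, j, k}"
  (is "?P i j k l")
proof -
  note comm = insert_commute near_commute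
  have *: "?P i j k l" if "i \<le> j" "k \<le> l" "i \<le> k" for i j k l
  proof -
    consider "j \<le> k" | "k \<le> j" "j \<le> l" | "k \<le> j" "l \<le> j" using that by linarith
    then show ?thesis
    proof cases
      case 1
      then show ?thesis using paired_or_isolated_sorted[of i j k l m] that by blast
    next
      case 2
      then show ?thesis using paired_or_isolated_sorted[of i k j l m] that by (auto simp: comm)
    next
      case 3
      then show ?thesis using paired_or_isolated_sorted[of i k l j m] that by (auto simp: comm)
    qed
  qed
  have **: "?P i j k l" if "i \<le> j" "k \<le> l" for i j k l
    using *[of i j k l] *[of k l i j] that linear[of i k] by (auto simp: comm)
  have ***: "?P i j k l" if "i \<le> j" for i j k l
    using **[of i j k l] **[of i j l k] that linear[of k l] by (auto simp: comm)
  show ?thesis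
    using ***[of i j k l] ***[of j i k l] linear[of i j] by (auto simp: comm)
qed

context prob_space
begin

text \<open>
Independence of two random variables with possibly different ranges, as needed for one observation against a triple;
\<open>indep_var\<close> is confined to a common range.
\<close>

definition indep_rv :: "'b measure \<Rightarrow> ('a \<Rightarrow> 'b) \<Rightarrow> 'c measure \<Rightarrow> ('a \<Rightarrow> 'c) \<Rightarrow> bool" where
  "indep_rv S U T V \<longleftrightarrow> U \<in> M \<rightarrow>\<^sub>M S \<and> V \<in> M \<rightarrow>\<^sub>M T \<and>
     distr M S U \<Otimes>\<^sub>M distr M T V = distr M (S \<Otimes>\<^sub>M T) (\<lambda>w. (U w, V w))"

lemma indep_rv_compose:
  assumes ind: "indep_rv A U B V" and f: "f \<in> A \<rightarrow>\<^sub>M S" and g: "g \<in> B \<rightarrow>\<^sub>M T"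
  shows "indep_rv S (\<lambda>w. f (U w)) T (\<lambda>w. g (V w))"
proof -
  have UV[measurable]: "U \<in> M \<rightarrow>\<^sub>M A" "V \<in> M \<rightarrow>\<^sub>M B" using ind by (auto simp: indep_rv_def)
  note [measurable] = f g
  have gV: "prob_space (distr M T (\<lambda>w. g (V w)))" by (rule prob_space_distr) measurable
  have dU: "distr M S (\<lambda>w. f (U w)) = distr (distr M A U) S f"
    and dV: "distr M T (\<lambda>w. g (V w)) = distr (distr M B V) T g"
    by (simp_all add: distr_distr comp_def)
  have "distr M S (\<lambda>w. f (U w)) \<Otimes>\<^sub>M distr M T (\<lambda>w. g (V w))
      = distr (distr M A U \<Otimes>\<^sub>M distr M B V) (S \<Otimes>\<^sub>M T) (\<lambda>(x, y). (f x, g y))"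
    unfolding dU dV using gV dV by (intro pair_measure_distr) (auto simp: prob_space_imp_sigma_finite)
  also have "distr M A U \<Otimes>\<^sub>M distr M B V = distr M (A \<Otimes>\<^sub>M B) (\<lambda>w. (U w, V w))"
    using ind by (simp add: indep_rv_def)
  also have "distr \<dots> (S \<Otimes>\<^sub>M T) (\<lambda>(x, y). (f x, g y)) = distr M (S \<Otimes>\<^sub>M T) (\<lambda>w. (f (U w), g (V w)))"
    by (subst distr_distr) (auto simp: comp_def)
  finally show ?thesis by (simp add: indep_rv_def)
qed

lemma indep_rv_swap:
  assumes "indep_rv S U T V" shows "indep_rv T V S U"
proof -
  have UV[measurable]: "U \<in> M \<rightarrow>\<^sub>M S" "V \<in> M \<rightarrow>\<^sub>M T" using assms by (auto simp: indep_rv_def)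
  interpret U: prob_space "distr M S U" by (rule prob_space_distr) fact
  interpret V: prob_space "distr M T V" by (rule prob_space_distr) fact
  interpret P: pair_sigma_finite "distr M T V" "distr M S U" ..
  have "distr M T V \<Otimes>\<^sub>M distr M S U = distr (distr M S U \<Otimes>\<^sub>M distr M T V) (T \<Otimes>\<^sub>M S) (\<lambda>(x, y). (y, x))"
    by (subst P.distr_pair_swap) (auto intro: distr_cong)
  also have "\<dots> = distr M (T \<Otimes>\<^sub>M S) (\<lambda>w. (V w, U w))"
    using assms by (simp add: indep_rv_def distr_distr comp_def)
  finally show ?thesis by (simp add: indep_rv_def)
qed

text \<open>
The index \<open>i\<close> lies in one of two blocks separated by more than \<open>m\<close> and the indices \<open>j\<close>, \<open>k\<close>, \<open>l\<close> lie in the other;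
the blocks are independent and the observations are coordinates of them.
\<close>

lemma m_dependent_isolated_indep:
  fixes W :: "nat \<Rightarrow> 'a \<Rightarrow> 'b::topological_space"
  assumes mdep: "m_dependent M m W" and pos: "1 \<le> i" "1 \<le> j" "1 \<le> k" "1 \<le> l"
    and iso: "isolated m i {j, k, l}"
  shows "indep_rv borel (W i) (borel \<Otimes>\<^sub>M borel \<Otimes>\<^sub>M borel) (\<lambda>w. (W j w, W k w, W l w))"
proof -
  consider "i + m < j \<and> i + m < k \<and> i + m < l" | "j + m < i \<and> k + m < i \<and> l + m < i"
    using iso by (auto simp: isolated_def)
  then show ?thesis
  proof cases
    case *: 1
    let ?B = "{i + (m + 1)..i + (m + 1) + (j + k + l)}"
    have "indep_var (PiM {1..i} (\<lambda>_. borel)) (\<lambda>w. \<lambda>i\<in>{1..i}. W i w)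
        (PiM ?B (\<lambda>_. borel)) (\<lambda>w. \<lambda>i\<in>?B. W i w)"
      using mdep pos unfolding m_dependent_def by (auto simp del: One_nat_def)
    then have ind: "indep_rv (PiM {1..i} (\<lambda>_. borel)) (\<lambda>w. \<lambda>i\<in>{1..i}. W i w)
        (PiM ?B (\<lambda>_. borel)) (\<lambda>w. \<lambda>i\<in>?B. W i w)"
      by (simp only: indep_rv_def indep_var_distribution_eq)
    have "i \<in> {1..i}" and jkl: "j \<in> ?B" "k \<in> ?B" "l \<in> ?B" using * pos by auto
    then have 1: "(\<lambda>x. x i) \<in> PiM {1..i} (\<lambda>_. borel :: 'b measure) \<rightarrow>\<^sub>M borel"
      and 2: "(\<lambda>x. (x j, x k, x l)) \<in> PiM ?B (\<lambda>_. borel :: 'b measure) \<rightarrow>\<^sub>M borel \<Otimes>\<^sub>M borel \<Otimes>\<^sub>M borel"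
      by (auto intro!: measurable_Pair measurable_component_singleton)
    show ?thesis using indep_rv_compose[OF ind 1 2] jkl pos by (simp add: comp_def)
  next
    case *: 2
    define b where "b = max j (max k l)"
    have b: "1 \<le> b" "b + m < i" using * pos by (auto simp: b_def)
    let ?B = "{b + (i - b)..b + (i - b) + 1}"
    have "indep_var (PiM {1..b} (\<lambda>_. borel)) (\<lambda>w. \<lambda>i\<in>{1..b}. W i w)
        (PiM ?B (\<lambda>_. borel)) (\<lambda>w. \<lambda>i\<in>?B. W i w)"
      by (rule mdep[unfolded m_dependent_def, rule_format]) (use b in auto)
    then have ind: "indep_rv (PiM {1..b} (\<lambda>_. borel)) (\<lambda>w. \<lambda>i\<in>{1..b}. W i w)
        (PiM ?B (\<lambda>_. borel)) (\<lambda>w. \<lambda>i\<in>?B. W i w)"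
      by (simp only: indep_rv_def indep_var_distribution_eq)
    have i: "i \<in> ?B" and jkl: "j \<in> {1..b}" "k \<in> {1..b}" "l \<in> {1..b}" using b pos by (auto simp: b_def)
    then have 1: "(\<lambda>x. x i) \<in> PiM ?B (\<lambda>_. borel :: 'b measure) \<rightarrow>\<^sub>M borel"
      and 2: "(\<lambda>x. (x j, x k, x l)) \<in> PiM {1..b} (\<lambda>_. borel :: 'b measure) \<rightarrow>\<^sub>M borel \<Otimes>\<^sub>M borel \<Otimes>\<^sub>M borel"
      by (auto intro!: measurable_Pair measurable_component_singleton)
    have "indep_rv (borel \<Otimes>\<^sub>M borel \<Otimes>\<^sub>M borel) (\<lambda>w. (W j w, W k w, W l w)) borel (W i)"
      using indep_rv_compose[OF ind 2 1] i jkl by (simp add: comp_def)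
    then show ?thesis by (rule indep_rv_swap)
  qed
qed

lemma indep_rv_fubini:
  fixes F :: "_ \<Rightarrow> real"
  assumes ind: "indep_rv S U T V" and F: "F \<in> borel_measurable (S \<Otimes>\<^sub>M T)"
    and int: "integrable M (\<lambda>w. F (U w, V w))"
  shows "expectation (\<lambda>w. F (U w, V w)) = (LINT v|distr M T V. (LINT u|distr M S U. F (u, v)))"
proof -
  have UV[measurable]: "U \<in> M \<rightarrow>\<^sub>M S" "V \<in> M \<rightarrow>\<^sub>M T" using ind by (auto simp: indep_rv_def)
  interpret U: prob_space "distr M S U" by (rule prob_space_distr) fact
  interpret V: prob_space "distr M T V" by (rule prob_space_distr) fact
  interpret UV: pair_sigma_finite "distr M S U" "distr M T V" ..
  have eq: "distr M S U \<Otimes>\<^sub>M distr M T V = distr M (S \<Otimes>\<^sub>M T) (\<lambda>w. (U w, V w))"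
    using ind by (simp add: indep_rv_def)
  have "expectation (\<lambda>w. F (U w, V w)) = integral\<^sup>L (distr M S U \<Otimes>\<^sub>M distr M T V) F"
    unfolding eq using F by (subst integral_distr) auto
  also have "\<dots> = (LINT v|distr M T V. (LINT u|distr M S U. F (u, v)))"
  proof -
    have "integrable (distr M S U \<Otimes>\<^sub>M distr M T V) F"
      unfolding eq using F int by (subst integrable_distr_eq) auto
    then have "integrable (distr M S U \<Otimes>\<^sub>M distr M T V) (case_prod (\<lambda>u v. F (u, v)))"
      by simp
    from UV.integral_snd[OF this] show ?thesis by simp
  qed
  finally show ?thesis .
qed

text \<open>
The reason for the cancellation in the degenerate double sum: conditionally on the other three observations, the
factor containing the isolated one has mean zero.
\<close>

lemma m_dependent_isolated_expectation_zero:
  fixes W :: "nat \<Rightarrow> 'a \<Rightarrow> 'b::topological_space" and F H :: "'b \<times> 'b \<Rightarrow> real"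
  assumes mdep: "m_dependent M m W" and pos: "1 \<le> i" "1 \<le> j" "1 \<le> k" "1 \<le> l"
    and iso: "isolated m i {j, k, l}"
    and F[measurable]: "F \<in> borel_measurable (borel \<Otimes>\<^sub>M borel)"
    and H[measurable]: "H \<in> borel_measurable (borel \<Otimes>\<^sub>M borel)"
    and int: "integrable M (\<lambda>w. F (W i w, W j w) * H (W k w, W l w))"
    and zero: "\<And>z. expectation (\<lambda>w. F (W i w, z)) = 0"
  shows "expectation (\<lambda>w. F (W i w, W j w) * H (W k w, W l w)) = 0"
proof -
  let ?V = "\<lambda>w. (W j w, W k w, W l w)"
  let ?T = "borel \<Otimes>\<^sub>M borel \<Otimes>\<^sub>M borel :: ('b \<times> 'b \<times> 'b) measure"
  let ?G = "\<lambda>(z, z', v). F (z, z') * H v"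
  note ind = m_dependent_isolated_indep[OF mdep pos iso]
  have [measurable]: "W i \<in> borel_measurable M" using ind by (simp add: indep_rv_def)
  have "expectation (\<lambda>w. F (W i w, W j w) * H (W k w, W l w)) = expectation (\<lambda>w. ?G (W i w, ?V w))"
    by simp
  also have "\<dots> = (LINT v|distr M ?T ?V. (LINT u|distr M borel (W i). ?G (u, v)))"
    by (rule indep_rv_fubini[OF ind]) (use int in auto)
  also have "\<dots> = (LINT v|distr M ?T ?V. 0)"
  proof (rule Bochner_Integration.integral_cong[OF refl])
    fix v :: "'b \<times> 'b \<times> 'b"
    obtain z p where v: "v = (z, p)" by (cases v)
    have "(LINT u|distr M borel (W i). ?G (u, v)) = (LINT u|distr M borel (W i). F (u, z)) * H p"
      by (simp add: v)
    also have "(LINT u|distr M borel (W i). F (u, z)) = 0"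
      using zero[of z] by (subst integral_distr) auto
    finally show "(LINT u|distr M borel (W i). ?G (u, v)) = 0" by simp
  qed
  finally show ?thesis by simp
qed

lemma m_dependent_far_expectation:
  fixes W :: "nat \<Rightarrow> 'a \<Rightarrow> 'b::topological_space" and F :: "'b \<times> 'b \<Rightarrow> real"
  assumes mdep: "m_dependent M m W" and pos: "1 \<le> i" "1 \<le> j" and far: "\<not> near m i j"
    and F[measurable]: "F \<in> borel_measurable (borel \<Otimes>\<^sub>M borel)"
    and int: "integrable M (\<lambda>w. F (W i w, W j w))"
  shows "expectation (\<lambda>w. F (W i w, W j w)) = (LINT v|distr M borel (W j). (LINT u|distr M borel (W i). F (u, v)))"
proof -
  have "isolated m i {j, j, j}" using far by (auto simp: near_def isolated_def)
  note ind = indep_rv_compose[OF m_dependent_isolated_indep[OF mdep pos(1,2,2,2) this] measurable_ident measurable_fst]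
  then have "indep_rv borel (W i) borel (W j)" by (simp add: comp_def)
  from indep_rv_fubini[OF this F int] show ?thesis .
qed

end

section \<open>Mean squares of averages along a stationary \<open>m\<close>-dependent sequence\<close>

text \<open>
The value \<open>c h\<close> occurs on the two diagonals at distance \<open>h\<close>, each of length \<open>n - h\<close>. The truncated subtraction is
intended: a diagonal with \<open>h \<ge> n\<close> is empty.
\<close>

lemma sum_toeplitz_banded:
  fixes c :: "nat \<Rightarrow> real"
  assumes "\<And>h. m < h \<Longrightarrow> c h = 0"
  shows "(\<Sum>i=1..n. \<Sum>j=1..n. c (if i \<le> j then j - i else i - j))
    = real n * c 0 + 2 * (\<Sum>h=1..m. real (n - h) * c h)"
proof (induction n)
  case (Suc n)
  let ?d = "\<lambda>i j. c (if i \<le> j then j - i else i - j)"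
  have last: "(\<Sum>i=1..n. c (Suc n - i)) = (\<Sum>h=1..m. of_bool (h \<le> n) * c h)"
  proof -
    have "(\<Sum>i=1..n. c (Suc n - i)) = (\<Sum>h=1..n. c h)"
      by (rule sum.reindex_bij_witness[of _ "\<lambda>h. Suc n - h" "\<lambda>i. Suc n - i"]) auto
    also have "\<dots> = (\<Sum>h\<in>{1..n} \<inter> {1..m}. c h)"
      using assms by (intro sum.mono_neutral_right) auto
    also have "\<dots> = (\<Sum>h=1..m. of_bool (h \<le> n) * c h)"
      by (rule sum.mono_neutral_cong_left) auto
    finally show ?thesis .
  qed
  have "(\<Sum>i=1..Suc n. \<Sum>j=1..Suc n. ?d i j)
      = (\<Sum>i=1..n. \<Sum>j=1..n. ?d i j) + (\<Sum>i=1..n. ?d i (Suc n)) + (\<Sum>j=1..n. ?d (Suc n) j) + c 0"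
    by (simp add: sum.distrib)
  also have "(\<Sum>i=1..n. ?d i (Suc n)) = (\<Sum>i=1..n. c (Suc n - i))" by (intro sum.cong) auto
  also have "(\<Sum>j=1..n. ?d (Suc n) j) = (\<Sum>i=1..n. c (Suc n - i))" by (intro sum.cong) auto
  finally have "(\<Sum>i=1..Suc n. \<Sum>j=1..Suc n. ?d i j)
      = real (Suc n) * c 0 + 2 * ((\<Sum>h=1..m. real (n - h) * c h) + (\<Sum>h=1..m. of_bool (h \<le> n) * c h))"
    unfolding Suc.IH last by (simp add: algebra_simps)
  also have "(\<Sum>h=1..m. real (n - h) * c h) + (\<Sum>h=1..m. of_bool (h \<le> n) * c h) = (\<Sum>h=1..m. real (Suc n - h) * c h)"
    unfolding sum.distrib[symmetric] by (intro sum.cong refl) (auto simp: Suc_diff_le algebra_simps)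
  finally show ?case .
qed simp

lemma (in prob_space) integrable_mult_of_square_integrable:
  fixes U V :: "'a \<Rightarrow> real"
  assumes [measurable]: "U \<in> borel_measurable M" "V \<in> borel_measurable M"
    and U: "integrable M (\<lambda>w. (U w)^2)" and V: "integrable M (\<lambda>w. (V w)^2)"
  shows "integrable M (\<lambda>w. U w * V w)"
    and "\<bar>expectation (\<lambda>w. U w * V w)\<bar> \<le> (expectation (\<lambda>w. (U w)^2) + expectation (\<lambda>w. (V w)^2)) / 2"
proof -
  have i: "integrable M (\<lambda>w. ((U w)^2 + (V w)^2) / 2)" using U V by simp
  show int: "integrable M (\<lambda>w. U w * V w)"
  proof (rule Bochner_Integration.integrable_bound[OF i])
    show "AE w in M. norm (U w * V w) \<le> norm (((U w)^2 + (V w)^2) / 2)"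
      by (intro AE_I2) (simp only: real_norm_def order_trans[OF abs_mult_le_half_squares abs_ge_self])
  qed measurable
  have "\<bar>expectation (\<lambda>w. U w * V w)\<bar> \<le> expectation (\<lambda>w. \<bar>U w * V w\<bar>)"
    by (rule integral_abs_bound)
  also have "\<dots> \<le> expectation (\<lambda>w. ((U w)^2 + (V w)^2) / 2)"
    using int i by (intro integral_mono abs_mult_le_half_squares) auto
  also have "\<dots> = (expectation (\<lambda>w. (U w)^2) + expectation (\<lambda>w. (V w)^2)) / 2" using U V by simp
  finally show "\<bar>expectation (\<lambda>w. U w * V w)\<bar> \<le> (expectation (\<lambda>w. (U w)^2) + expectation (\<lambda>w. (V w)^2)) / 2" .
qed

locale stationary_m_dependent = prob_space M for M :: "'w measure" +
  fixes W :: "nat \<Rightarrow> 'w \<Rightarrow> 'b::topological_space" and m :: nat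
  assumes measurable_W: "\<And>i. 1 \<le> i \<Longrightarrow> W i \<in> borel_measurable M"
    and stationary: "strictly_stationary M W"
    and m_dependent: "m_dependent M m W"
begin

lemma distr_pair_shift:
  assumes "1 \<le> i" "1 \<le> j"
  shows "distr M (borel \<Otimes>\<^sub>M borel) (\<lambda>w. (W (i + h) w, W (j + h) w))
       = distr M (borel \<Otimes>\<^sub>M borel) (\<lambda>w. (W i w, W j w))"
  by (rule strictly_stationary_pair[OF stationary measurable_W assms])

lemma expectation_shift:
  fixes F :: "'b \<times> 'b \<Rightarrow> real"
  assumes ij: "1 \<le> i" "1 \<le> j" and F: "F \<in> borel_measurable (borel \<Otimes>\<^sub>M borel)"
  shows "expectation (\<lambda>w. F (W (i + h) w, W (j + h) w)) = expectation (\<lambda>w. F (W i w, W j w))"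
proof -
  have "expectation (\<lambda>w. F (W (i + h) w, W (j + h) w))
      = (LINT z|distr M (borel \<Otimes>\<^sub>M borel) (\<lambda>w. (W (i + h) w, W (j + h) w)). F z)" for h
    using ij measurable_W F by (subst integral_distr) auto
  from this[of h] this[of 0] distr_pair_shift[OF ij, of h] show ?thesis by simp
qed

lemma distr_W:
  assumes f: "f \<in> borel \<rightarrow>\<^sub>M N" and i: "1 \<le> i"
  shows "distr M N (\<lambda>w. f (W i w)) = distr M N (\<lambda>w. f (W 1 w))"
proof -
  have *: "distr M N (\<lambda>w. f (W i w))
      = distr (distr M (borel \<Otimes>\<^sub>M borel) (\<lambda>w. (W i w, W i w))) N (\<lambda>z. f (fst z))" if "1 \<le> i" for i
    using that measurable_W f by (subst distr_distr) (auto simp: comp_def)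
  show ?thesis using *[OF i] *[of 1] distr_pair_shift[of 1 1 "i - 1"] i by simp
qed

lemma
  fixes f :: "'b \<Rightarrow> real"
  assumes [measurable]: "f \<in> borel_measurable borel" and i: "1 \<le> i"
  shows expectation_W: "expectation (\<lambda>w. f (W i w)) = expectation (\<lambda>w. f (W 1 w))"
    and integrable_W_iff: "integrable M (\<lambda>w. f (W i w)) \<longleftrightarrow> integrable M (\<lambda>w. f (W 1 w))"
proof -
  have [measurable]: "W i \<in> borel_measurable M" "W 1 \<in> borel_measurable M"
    using measurable_W i by auto
  note eq = distr_W[OF assms(1) i]
  have *: "expectation (\<lambda>w. f (W i w)) = (LINT x|distr M borel (\<lambda>w. f (W i w)). x)" if "1 \<le> i" for i
    using measurable_W[OF that] by (subst integral_distr) auto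
  have **: "integrable M (\<lambda>w. f (W i w)) \<longleftrightarrow> integrable (distr M borel (\<lambda>w. f (W i w))) (\<lambda>x. x)" if "1 \<le> i" for i
    using measurable_W[OF that] by (subst integrable_distr_eq) auto
  show "expectation (\<lambda>w. f (W i w)) = expectation (\<lambda>w. f (W 1 w))"
    using *[OF i] *[of 1] eq by simp
  show "integrable M (\<lambda>w. f (W i w)) \<longleftrightarrow> integrable M (\<lambda>w. f (W 1 w))"
    using **[OF i] **[of 1] eq by simp
qed

definition average :: "('b \<Rightarrow> real) \<Rightarrow> nat \<Rightarrow> 'w \<Rightarrow> real" where
  "average f n w = (\<Sum>i=1..n. f (W i w)) / real n"

lemma measurable_average:
  assumes "f \<in> borel_measurable borel" shows "average f n \<in> borel_measurable M"
  unfolding average_def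
  using measurable_compose[OF measurable_W assms] by (intro borel_measurable_divide borel_measurable_sum) auto

lemma far_uncorrelated:
  fixes f :: "'b \<Rightarrow> real"
  assumes f[measurable]: "f \<in> borel_measurable borel" and sq: "integrable M (\<lambda>w. (f (W 1 w))^2)"
    and zero: "expectation (\<lambda>w. f (W 1 w)) = 0"
    and pos: "1 \<le> i" "1 \<le> j" and far: "\<not> near m i j"
  shows "expectation (\<lambda>w. f (W i w) * f (W j w)) = 0"
proof -
  have [measurable]: "W i \<in> borel_measurable M" "W j \<in> borel_measurable M" using pos measurable_W by auto
  have sq': "integrable M (\<lambda>w. (f (W i w))^2)" if "1 \<le> i" for i
    using integrable_W_iff[of "\<lambda>x. (f x)^2", OF _ that] sq by simp
  have "integrable M (\<lambda>w. f (W i w) * f (W j w))"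
    using sq' pos by (intro integrable_mult_of_square_integrable) auto
  from m_dependent_far_expectation[OF m_dependent pos far, of "\<lambda>z. f (fst z) * f (snd z)"] this
  have "expectation (\<lambda>w. f (W i w) * f (W j w))
      = (LINT v|distr M borel (W j). (LINT u|distr M borel (W i). f u) * f v)" by simp
  also have "(LINT u|distr M borel (W i). f u) = 0"
    using zero expectation_W[OF f pos(1)] by (subst integral_distr) auto
  finally show ?thesis by simp
qed

lemma
  fixes f :: "'b \<Rightarrow> real"
  assumes f[measurable]: "f \<in> borel_measurable borel" and sq: "integrable M (\<lambda>w. (f (W 1 w))^2)"
    and zero: "expectation (\<lambda>w. f (W 1 w)) = 0"
  defines "\<gamma> \<equiv> \<lambda>h. expectation (\<lambda>w. f (W 1 w) * f (W (1 + h) w))"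
  shows mean_square_average_le: "0 < n \<Longrightarrow> expectation (\<lambda>w. (average f n w)^2)
      \<le> real (2 * m + 1) * expectation (\<lambda>w. (f (W 1 w))^2) / real n"
    and mean_square_average_limit:
      "(\<lambda>n. real n * expectation (\<lambda>w. (average f n w)^2))
        \<longlonglongrightarrow> \<gamma> 0 + 2 * (\<Sum>h=1..m. \<gamma> h)"
    and integrable_average_square: "integrable M (\<lambda>w. (average f n w)^2)"
proof -
  have fm[measurable]: "(\<lambda>w. f (W i w)) \<in> borel_measurable M" if "1 \<le> i" for i
    using measurable_W[OF that] by measurable
  have sq': "integrable M (\<lambda>w. (f (W i w))^2)" if "1 \<le> i" for i
    using integrable_W_iff[of "\<lambda>x. (f x)^2", OF _ that] sq by simp
  have int: "integrable M (\<lambda>w. f (W i w) * f (W j w))" if "1 \<le> i" "1 \<le> j" for i j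
    using sq' that fm by (intro integrable_mult_of_square_integrable) auto
  have \<gamma>_zero: "\<gamma> h = 0" if "m < h" for h
    unfolding \<gamma>_def using that by (intro far_uncorrelated f sq zero) (auto simp: near_def)
  \<comment> \<open>An autocovariance is largest at lag zero, by stationarity and \<open>2 a b \<le> a\<^sup>2 + b\<^sup>2\<close>.\<close>
  have \<gamma>_le: "\<gamma> h \<le> \<gamma> 0" for h
  proof -
    have "\<gamma> h \<le> (expectation (\<lambda>w. (f (W 1 w))^2) + expectation (\<lambda>w. (f (W (1 + h) w))^2)) / 2"
      using integrable_mult_of_square_integrable(2)[OF fm fm sq' sq', of 1 "1 + h"] by (simp add: \<gamma>_def)
    also have "\<dots> = \<gamma> 0"
      using expectation_W[of "\<lambda>x. (f x)^2" "1 + h"] by (simp add: \<gamma>_def power2_eq_square)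
    finally show ?thesis .
  qed
  have cov: "expectation (\<lambda>w. f (W i w) * f (W j w)) = \<gamma> (if i \<le> j then j - i else i - j)"
    if "1 \<le> i" "1 \<le> j" for i j
  proof (cases "i \<le> j")
    case True
    then show ?thesis
      using expectation_shift[of 1 "1 + (j - i)" "\<lambda>z. f (fst z) * f (snd z)" "i - 1"] that by (simp add: \<gamma>_def)
  next
    case False
    then show ?thesis
      using expectation_shift[of "1 + (i - j)" 1 "\<lambda>z. f (fst z) * f (snd z)" "j - 1"] that by (simp add: \<gamma>_def mult.commute)
  qed
  have square: "(\<Sum>i=1..n. f (W i w))^2 = (\<Sum>i=1..n. \<Sum>j=1..n. f (W i w) * f (W j w))" for n w
    by (simp add: power2_eq_square sum_product)
  show "integrable M (\<lambda>w. (average f n w)^2)" for n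
    unfolding average_def power_divide square using int by (intro integrable_divide Bochner_Integration.integrable_sum) auto
  have eq: "expectation (\<lambda>w. (average f n w)^2)
      = (real n * \<gamma> 0 + 2 * (\<Sum>h=1..m. real (n - h) * \<gamma> h)) / (real n)^2" for n
  proof -
    have "expectation (\<lambda>w. (average f n w)^2)
        = expectation (\<lambda>w. \<Sum>i=1..n. \<Sum>j=1..n. f (W i w) * f (W j w)) / (real n)^2"
      unfolding average_def power_divide square by simp
    also have "expectation (\<lambda>w. \<Sum>i=1..n. \<Sum>j=1..n. f (W i w) * f (W j w))
        = (\<Sum>i=1..n. \<Sum>j=1..n. expectation (\<lambda>w. f (W i w) * f (W j w)))"
      using int by (subst Bochner_Integration.integral_sum, force)
        (intro sum.cong refl Bochner_Integration.integral_sum, auto)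
    also have "\<dots> = (\<Sum>i=1..n. \<Sum>j=1..n. \<gamma> (if i \<le> j then j - i else i - j))"
      using cov by (intro sum.cong refl) auto
    also have "\<dots> = real n * \<gamma> 0 + 2 * (\<Sum>h=1..m. real (n - h) * \<gamma> h)"
      by (rule sum_toeplitz_banded[OF \<gamma>_zero])
    finally show ?thesis .
  qed
  have \<gamma>0: "\<gamma> 0 = expectation (\<lambda>w. (f (W 1 w))^2)" by (simp add: \<gamma>_def power2_eq_square)
  have \<gamma>0_nonneg: "0 \<le> \<gamma> 0" unfolding \<gamma>0 by (simp add: integral_nonneg_AE)
  show "expectation (\<lambda>w. (average f n w)^2)
      \<le> real (2 * m + 1) * expectation (\<lambda>w. (f (W 1 w))^2) / real n" if "0 < n"
  proof -
    have "(\<Sum>h=1..m. real (n - h) * \<gamma> h) \<le> (\<Sum>h=1..m. real n * \<gamma> 0)"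
    proof (rule sum_mono)
      fix h
      have "real (n - h) * \<gamma> h \<le> real (n - h) * \<gamma> 0" using \<gamma>_le by (intro mult_left_mono) auto
      also have "\<dots> \<le> real n * \<gamma> 0" using \<gamma>0_nonneg by (intro mult_right_mono) auto
      finally show "real (n - h) * \<gamma> h \<le> real n * \<gamma> 0" .
    qed
    then have "real n * \<gamma> 0 + 2 * (\<Sum>h=1..m. real (n - h) * \<gamma> h) \<le> real n * (real (2 * m + 1) * \<gamma> 0)"
      by (simp add: algebra_simps)
    then have "expectation (\<lambda>w. (average f n w)^2) \<le> real n * (real (2 * m + 1) * \<gamma> 0) / (real n)^2"
      unfolding eq by (intro divide_right_mono) auto
    also have "\<dots> = real (2 * m + 1) * \<gamma> 0 / real n" using that by (simp add: power2_eq_square)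
    finally show ?thesis by (simp add: \<gamma>0)
  qed
  have "(\<lambda>n. \<gamma> 0 + 2 * (\<Sum>h=1..m. (1 - real h / real n) * \<gamma> h)) \<longlonglongrightarrow> \<gamma> 0 + 2 * (\<Sum>h=1..m. (1 - 0) * \<gamma> h)"
    by (intro tendsto_intros lim_const_over_n)
  moreover have "\<forall>\<^sub>F n in sequentially. \<gamma> 0 + 2 * (\<Sum>h=1..m. (1 - real h / real n) * \<gamma> h)
      = real n * expectation (\<lambda>w. (average f n w)^2)"
    using eventually_gt_at_top[of m]
  proof eventually_elim
    case (elim n)
    then have n: "real n > 0" by simp
    have "(1 - real h / real n) * \<gamma> h = real (n - h) * \<gamma> h / real n" if "h \<in> {1..m}" for h
      using that elim by (simp add: of_nat_diff field_simps)
    then have "(\<Sum>h=1..m. (1 - real h / real n) * \<gamma> h) = (\<Sum>h=1..m. real (n - h) * \<gamma> h) / real n"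
      by (simp add: sum_divide_distrib)
    then show ?case unfolding eq using n by (simp add: power2_eq_square field_simps)
  qed
  ultimately show "(\<lambda>n. real n * expectation (\<lambda>w. (average f n w)^2))
        \<longlonglongrightarrow> \<gamma> 0 + 2 * (\<Sum>h=1..m. \<gamma> h)"
    by (simp add: filterlim_cong[OF refl refl])
qed

end

section \<open>The degenerate part of the ball kernel\<close>

lemma measurable_fst_borel[measurable]:
  "fst \<in> borel_measurable (borel :: ('a::second_countable_topology \<times> 'b::second_countable_topology) measure)"
  by (simp flip: borel_prod)

lemma measurable_snd_borel[measurable]:
  "snd \<in> borel_measurable (borel :: ('a::second_countable_topology \<times> 'b::second_countable_topology) measure)"
  by (simp flip: borel_prod)

text \<open>
The set \<open>P\<close> consists of the index pairs at which the estimator may evaluate the kernel; the diagonal has to be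
excluded when \<open>Y = X\<close>. Close indices need the bound \<open>near_ball\<close>, whereas \<open>X\<^sub>i\<close> and \<open>Y\<^sub>j\<close> are independent for distant
ones.
\<close>

locale two_sample = stationary_m_dependent M "\<lambda>i w. (X i w, Y i w)" m
  for M :: "'w measure" and X Y :: "nat \<Rightarrow> 'w \<Rightarrow> 'a::euclidean_space" and m :: nat +
  fixes pX pY :: "'a \<Rightarrow> real" and P :: "(nat \<times> nat) set" and C :: real
  assumes X_law: "distributed M lborel (X 1) (\<lambda>x. ennreal (pX x))"
    and Y_law: "distributed M lborel (Y 1) (\<lambda>x. ennreal (pY x))"
    and pX: "nonneg_L1_L3 pX" and pY: "nonneg_L1_L3 pY"
    and near_ball: "\<And>i j e. (i, j) \<in> P \<Longrightarrow> 1 \<le> i \<Longrightarrow> 1 \<le> j \<Longrightarrow> near m i j \<Longrightarrow> 0 < e \<Longrightarrow>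
      measure M {w \<in> space M. dist (X i w) (Y j w) \<le> e} \<le> C * ball_vol TYPE('a) e"
begin

lemma measurable_X[measurable (raw)]: "1 \<le> i \<Longrightarrow> X i \<in> borel_measurable M"
  using measurable_compose[OF measurable_W measurable_fst_borel, of i] by simp

lemma measurable_Y[measurable (raw)]: "1 \<le> i \<Longrightarrow> Y i \<in> borel_measurable M"
  using measurable_compose[OF measurable_W measurable_snd_borel, of i] by simp

lemma pX_nonneg[simp]: "0 \<le> pX x" and pY_nonneg[simp]: "0 \<le> pY x"
  using nonneg_L1_L3D(1) pX pY by auto

lemma measurable_pX[measurable]: "pX \<in> borel_measurable borel"
  and measurable_pY[measurable]: "pY \<in> borel_measurable borel"
  using nonneg_L1_L3D(4) pX pY by auto

lemma
  fixes h :: "'a \<Rightarrow> real"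
  assumes [measurable]: "h \<in> borel_measurable borel" and i: "1 \<le> i"
  shows expectation_X: "expectation (\<lambda>w. h (X i w)) = (LINT x|lborel. pX x * h x)"
    and expectation_Y: "expectation (\<lambda>w. h (Y i w)) = (LINT x|lborel. pY x * h x)"
    and integrable_X_iff: "integrable M (\<lambda>w. h (X i w)) \<longleftrightarrow> integrable lborel (\<lambda>x. pX x * h x)"
    and integrable_Y_iff: "integrable M (\<lambda>w. h (Y i w)) \<longleftrightarrow> integrable lborel (\<lambda>x. pY x * h x)"
  using expectation_W[of "\<lambda>z. h (fst z)" i] expectation_W[of "\<lambda>z. h (snd z)" i]
    integrable_W_iff[of "\<lambda>z. h (fst z)" i] integrable_W_iff[of "\<lambda>z. h (snd z)" i] i
    distributed_integral[OF X_law, of h] distributed_integral[OF Y_law, of h]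
    distributed_integrable[OF X_law, of h] distributed_integrable[OF Y_law, of h]
  by simp_all

lemma integral_pX: "(LINT x|lborel. pX x) = 1" and integral_pY: "(LINT x|lborel. pY x) = 1"
  using expectation_X[of "\<lambda>_. 1" 1] expectation_Y[of "\<lambda>_. 1" 1] by (simp_all add: prob_space)

definition bound_q :: real where
  "bound_q = (LINT x|lborel. (pX x)^2) + (LINT x|lborel. (pY x)^2)"

definition qe :: "real \<Rightarrow> real" where
  "qe e = (LINT x|lborel. pX x * smooth e pY x)"

text \<open>
The kernel minus its two conditional expectations, recentred: Hoeffding's projection onto the degenerate part. The
number \<open>qe e\<close> is the expectation of the kernel at independent arguments.
\<close>

definition psi :: "real \<Rightarrow> 'a \<Rightarrow> 'a \<Rightarrow> real" where
  "psi e x y = kern e x y - smooth e pY x - smooth e pX y + qe e"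

context
  fixes e :: real assumes e: "0 < e"
begin

lemma b_pos: "0 < ball_vol TYPE('a) e" by (rule ball_vol_pos[OF e])

lemma measurable_smooths[measurable]:
  "smooth e pX \<in> borel_measurable borel" "smooth e pY \<in> borel_measurable borel"
  by (simp_all add: measurable_smooth e)

lemma measurable_psi[measurable (raw)]:
  assumes [measurable]: "f \<in> borel_measurable N" "g \<in> borel_measurable N"
  shows "(\<lambda>z. psi e (f z) (g z)) \<in> borel_measurable N"
  unfolding psi_def by measurable

lemma smooth_bounds:
  "0 \<le> smooth e pX x" "smooth e pX x \<le> 1 / ball_vol TYPE('a) e" "0 \<le> smooth e pY x" "smooth e pY x \<le> 1 / ball_vol TYPE('a) e"
  using smooth_nonneg[of pX e x] smooth_nonneg[of pY e x]
    smooth_le[OF e nonneg_L1_L3D(2)[OF pX], of x] smooth_le[OF e nonneg_L1_L3D(2)[OF pY], of x]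
  by (simp_all add: integral_pX integral_pY)

lemma expectation_smooth:
  assumes "1 \<le> i"
  shows "expectation (\<lambda>w. smooth e pY (X i w)) = qe e" "expectation (\<lambda>w. smooth e pX (Y i w)) = qe e"
    and "integrable M (\<lambda>w. smooth e pY (X i w))" "integrable M (\<lambda>w. smooth e pX (Y i w))"
proof -
  show "expectation (\<lambda>w. smooth e pY (X i w)) = qe e"
    using assms by (simp add: expectation_X qe_def)
  show "expectation (\<lambda>w. smooth e pX (Y i w)) = qe e"
    using assms integral_mult_smooth_commute[OF e pX pY] by (simp add: expectation_Y qe_def)
  show "integrable M (\<lambda>w. smooth e pY (X i w))" "integrable M (\<lambda>w. smooth e pX (Y i w))"
    using assms smooth_bounds by (auto intro!: integrable_const_bound[where B="1 / ball_vol TYPE('a) e"])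
qed

lemma qe_bounds: "0 \<le> qe e" "qe e \<le> bound_q" "qe e \<le> 1 / ball_vol TYPE('a) e"
proof -
  show "0 \<le> qe e" unfolding qe_def by (intro integral_nonneg_AE) (simp add: smooth_bounds)
  show "qe e \<le> bound_q" unfolding qe_def bound_q_def by (rule integral_mult_smooth_bounds[OF e pX pY])
  have "expectation (\<lambda>w. smooth e pY (X 1 w)) \<le> 1 / ball_vol TYPE('a) e"
    by (rule integral_le_const) (use expectation_smooth(3)[of 1] smooth_bounds in auto)
  then show "qe e \<le> 1 / ball_vol TYPE('a) e" using expectation_smooth(1)[of 1] by simp
qed

lemma expectation_kern:
  assumes "1 \<le> i"
  shows "expectation (\<lambda>w. kern e (X i w) y) = smooth e pX y"
    and "expectation (\<lambda>w. kern e x (Y i w)) = smooth e pY x"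
  using assms
  by (simp_all add: expectation_X expectation_Y smooth_eq_integral_kern[OF e] mult.commute kern_commute[of e _ y])

lemma integrable_kern:
  fixes f g :: "'w \<Rightarrow> 'a"
  assumes "f \<in> borel_measurable M" "g \<in> borel_measurable M"
  shows "integrable M (\<lambda>w. kern e (f w) (g w))"
proof (rule integrable_const_bound[where B="1 / ball_vol TYPE('a) e"])
  have "\<bar>kern e x y\<bar> \<le> 1 / ball_vol TYPE('a) e" for x y :: 'a using kern_bounds[of e x y] by simp
  then show "AE w in M. norm (kern e (f w) (g w)) \<le> 1 / ball_vol TYPE('a) e" by simp
qed (use assms in measurable)

lemma expectation_psi_zero:
  assumes "1 \<le> i"
  shows "expectation (\<lambda>w. psi e (X i w) y) = 0" "expectation (\<lambda>w. psi e x (Y i w)) = 0"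
  unfolding psi_def
  using assms expectation_kern[OF assms] expectation_smooth[OF assms]
    integrable_kern[of "X i" "\<lambda>_. y"] integrable_kern[of "\<lambda>_. x" "Y i"]
  by (simp_all add: prob_space)

lemma psi_bound: "\<bar>psi e x y\<bar> \<le> 4 / ball_vol TYPE('a) e"
proof -
  have "\<bar>psi e x y\<bar> \<le> kern e x y + smooth e pY x + smooth e pX y + qe e"
    unfolding psi_def using smooth_bounds[of x] smooth_bounds[of y] qe_bounds kern_bounds[of e x y] by linarith
  also have "\<dots> \<le> 1 / ball_vol TYPE('a) e + 1 / ball_vol TYPE('a) e + 1 / ball_vol TYPE('a) e + 1 / ball_vol TYPE('a) e"
    by (intro add_mono smooth_bounds qe_bounds kern_bounds)
  finally show ?thesis by simp
qed

text \<open>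
One factor of the square is bounded by \<open>4 / b\<^sub>e\<close>, and all terms of the other have bounded expectation. This gives a
second moment of order \<open>1 / b\<^sub>e\<close> instead of \<open>1 / b\<^sub>e\<^sup>2\<close>.
\<close>

lemma psi_square_le: "(psi e x y)^2 \<le> 4 / ball_vol TYPE('a) e * (kern e x y + smooth e pY x + smooth e pX y + qe e)"
proof -
  have "\<bar>psi e x y\<bar> \<le> kern e x y + smooth e pY x + smooth e pX y + qe e"
    unfolding psi_def using smooth_bounds[of x] smooth_bounds[of y] qe_bounds kern_bounds[of e x y] by linarith
  then have "\<bar>psi e x y\<bar> * \<bar>psi e x y\<bar> \<le> 4 / ball_vol TYPE('a) e * (kern e x y + smooth e pY x + smooth e pX y + qe e)"
    using b_pos by (intro mult_mono psi_bound) auto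
  then show ?thesis by (simp add: power2_eq_square)
qed

lemma integrable_psi_products:
  assumes "1 \<le> i" "1 \<le> j" "1 \<le> k" "1 \<le> l"
  shows "integrable M (\<lambda>w. psi e (X i w) (Y j w))"
    and "integrable M (\<lambda>w. psi e (X i w) (Y j w) * psi e (X k w) (Y l w))"
proof -
  show "integrable M (\<lambda>w. psi e (X i w) (Y j w))"
    using assms psi_bound by (intro integrable_const_bound[where B="4 / ball_vol TYPE('a) e"]) auto
  have "\<bar>psi e x y * psi e x' y'\<bar> \<le> 4 / ball_vol TYPE('a) e * (4 / ball_vol TYPE('a) e)" for x y x' y'
    unfolding abs_mult using b_pos by (intro mult_mono psi_bound) auto
  then show "integrable M (\<lambda>w. psi e (X i w) (Y j w) * psi e (X k w) (Y l w))"
    using assms by (intro integrable_const_bound[where B="4 / ball_vol TYPE('a) e * (4 / ball_vol TYPE('a) e)"]) auto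
qed

lemma expectation_kern_pair_le:
  assumes "(i, j) \<in> P" "1 \<le> i" "1 \<le> j"
  shows "expectation (\<lambda>w. kern e (X i w) (Y j w)) \<le> \<bar>C\<bar> + bound_q"
proof (cases "near m i j")
  case True
  have "expectation (\<lambda>w. kern e (X i w) (Y j w))
      = expectation (\<lambda>w. indicator {w \<in> space M. dist (X i w) (Y j w) \<le> e} w / ball_vol TYPE('a) e)"
    by (intro Bochner_Integration.integral_cong refl) (auto simp: kern_def indicator_def)
  also have "\<dots> = measure M {w \<in> space M. dist (X i w) (Y j w) \<le> e} / ball_vol TYPE('a) e"
    using assms by simp
  also have "\<dots> \<le> C" using near_ball[OF assms True e] b_pos by (simp add: field_simps)
  finally show ?thesis using qe_bounds by linarith
next
  case False
  have meas: "(\<lambda>z. fst (fst z)) \<in> borel_measurable (borel \<Otimes>\<^sub>M borel :: (('a \<times> 'a) \<times> 'a \<times> 'a) measure)"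
    "(\<lambda>z. snd (snd z)) \<in> borel_measurable (borel \<Otimes>\<^sub>M borel :: (('a \<times> 'a) \<times> 'a \<times> 'a) measure)"
    by (rule measurable_compose[OF measurable_fst measurable_fst_borel])
       (rule measurable_compose[OF measurable_snd measurable_snd_borel])
  have "expectation (\<lambda>w. kern e (X i w) (Y j w))
      = (LINT v|distr M borel (\<lambda>w. (X j w, Y j w)). (LINT u|distr M borel (\<lambda>w. (X i w, Y i w)). kern e (fst u) (snd v)))"
    using m_dependent_far_expectation[OF m_dependent assms(2,3) False, of "\<lambda>z. kern e (fst (fst z)) (snd (snd z))"]
      integrable_kern[OF measurable_X[OF assms(2)] measurable_Y[OF assms(3)]] measurable_kern[OF meas] by simp
  also have "(\<lambda>v. LINT u|distr M borel (\<lambda>w. (X i w, Y i w)). kern e (fst u) (snd v)) = (\<lambda>v. smooth e pX (snd v))"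
    using measurable_W[OF assms(2)] assms by (subst integral_distr) (auto simp: expectation_kern)
  also have "(LINT v|distr M borel (\<lambda>w. (X j w, Y j w)). smooth e pX (snd v)) = qe e"
    using measurable_W[OF assms(3)] assms by (subst integral_distr) (auto simp: expectation_smooth)
  finally show ?thesis using qe_bounds by linarith
qed

lemma expectation_psi_square_le:
  assumes "(i, j) \<in> P" "1 \<le> i" "1 \<le> j"
  shows "expectation (\<lambda>w. (psi e (X i w) (Y j w))^2) \<le> 4 * (\<bar>C\<bar> + 4 * bound_q) / ball_vol TYPE('a) e"
proof -
  note ints = integrable_kern[of "X i" "Y j"] expectation_smooth[OF assms(2)] expectation_smooth[OF assms(3)]
  have "expectation (\<lambda>w. (psi e (X i w) (Y j w))^2)
      \<le> expectation (\<lambda>w. 4 / ball_vol TYPE('a) e * (kern e (X i w) (Y j w) + smooth e pY (X i w) + smooth e pX (Y j w) + qe e))"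
    using integrable_psi_products(2)[OF assms(2,3,2,3)] ints assms
    by (intro integral_mono psi_square_le) (auto simp: power2_eq_square)
  also have "\<dots> = 4 / ball_vol TYPE('a) e * (expectation (\<lambda>w. kern e (X i w) (Y j w)) + 3 * qe e)"
    using ints assms by (simp add: prob_space)
  also have "\<dots> \<le> 4 / ball_vol TYPE('a) e * ((\<bar>C\<bar> + bound_q) + 3 * bound_q)"
    using expectation_kern_pair_le[OF assms] qe_bounds(2) b_pos by (intro mult_left_mono add_mono) auto
  also have "\<dots> = 4 * (\<bar>C\<bar> + 4 * bound_q) / ball_vol TYPE('a) e" by simp
  finally show ?thesis .
qed

text \<open>
Either argument of either factor may be the isolated one; exchanging the two factors leaves two cases.
\<close>

lemma expectation_psi_product_zero:
  assumes pos: "1 \<le> i" "1 \<le> j" "1 \<le> k" "1 \<le> l"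
    and iso: "isolated m i {j, k, l} \<or> isolated m j {i, k, l} \<or> isolated m k {i, j, l} \<or> isolated m l {i, j, k}"
  shows "expectation (\<lambda>w. psi e (X i w) (Y j w) * psi e (X k w) (Y l w)) = 0"
proof -
  note zero = m_dependent_isolated_expectation_zero[OF m_dependent]
  have F: "(\<lambda>z :: ('a \<times> 'a) \<times> 'a \<times> 'a. psi e (fst (fst z)) (snd (snd z))) \<in> borel_measurable (borel \<Otimes>\<^sub>M borel)"
    by (rule measurable_psi[OF measurable_compose[OF measurable_fst measurable_fst_borel]
          measurable_compose[OF measurable_snd measurable_snd_borel]])
  have F': "(\<lambda>z :: ('a \<times> 'a) \<times> 'a \<times> 'a. psi e (fst (snd z)) (snd (fst z))) \<in> borel_measurable (borel \<Otimes>\<^sub>M borel)"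
    by (rule measurable_psi[OF measurable_compose[OF measurable_snd measurable_fst_borel]
          measurable_compose[OF measurable_fst measurable_snd_borel]])
  have 1: "expectation (\<lambda>w. psi e (X i w) (Y j w) * psi e (X k w) (Y l w)) = 0"
    if "1 \<le> i" "1 \<le> j" "1 \<le> k" "1 \<le> l" "isolated m i {j, k, l}" for i j k l
    using zero[OF that F F] integrable_psi_products(2)[OF that(1-4)] expectation_psi_zero(1)[OF that(1)] by simp
  have 2: "expectation (\<lambda>w. psi e (X i w) (Y j w) * psi e (X k w) (Y l w)) = 0"
    if "1 \<le> i" "1 \<le> j" "1 \<le> k" "1 \<le> l" "isolated m j {i, k, l}" for i j k l
    using zero[OF that(2,1,3,4,5) F' F] integrable_psi_products(2)[OF that(1-4)] expectation_psi_zero(2)[OF that(2)] by simp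
  consider "isolated m i {j, k, l}" | "isolated m j {i, k, l}" | "isolated m k {l, i, j}" | "isolated m l {k, i, j}"
    using iso by (auto simp: insert_commute)
  then show ?thesis
  proof cases
    case 3 then show ?thesis using 1[of k l i j] pos by (simp add: mult.commute)
  next
    case 4 then show ?thesis using 2[of k l i j] pos by (simp add: mult.commute)
  qed (use 1 2 pos in auto)
qed

end
end

section \<open>Hoeffding decomposition of the estimator\<close>

lemma card_near_pairs:
  "card {(i, j) \<in> {1..n} \<times> {1..n}. near m i j} \<le> n * (2 * m + 1)"
proof -
  have "{(i, j) \<in> {1..n} \<times> {1..n}. near m i j} \<subseteq> (SIGMA i:{1..n}. {i - m..i + m})"
    by (auto simp: near_def)
  then have "card {(i, j) \<in> {1..n} \<times> {1..n}. near m i j} \<le> card (SIGMA i:{1..n}. {i - m..i + m})"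
    by (intro card_mono) auto
  also have "\<dots> = (\<Sum>i=1..n. card {i - m..i + m})" by (rule card_SigmaI) auto
  also have "\<dots> \<le> (\<Sum>i=1..n. 2 * m + 1)" by (intro sum_mono) auto
  finally show ?thesis by simp
qed

definition paired_quadruples :: "nat \<Rightarrow> nat \<Rightarrow> ((nat \<times> nat) \<times> nat \<times> nat) set" where
  "paired_quadruples m n = {((i, j), k, l). {i, j, k, l} \<subseteq> {1..n} \<and>
     (near m i j \<and> near m k l \<or> near m i k \<and> near m j l \<or> near m i l \<and> near m j k)}"

lemma card_paired_quadruples:
  "finite (paired_quadruples m n)" "card (paired_quadruples m n) \<le> 3 * (n * (2 * m + 1))^2"
proof -
  let ?N = "{(i, j) \<in> {1..n} \<times> {1..n}. near m i j}"
  let ?f = "\<lambda>((i, j), k, l). ((i, j), k, l)" and ?g = "\<lambda>((i, k), j, l). ((i, j), k, l)"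
    and ?h = "\<lambda>((i, l), j, k). ((i, j), k, l) :: (nat \<times> nat) \<times> nat \<times> nat"
  have fin: "finite ?N" by (rule finite_subset[of _ "{1..n} \<times> {1..n}"]) auto
  have sub: "paired_quadruples m n \<subseteq> ?f ` (?N \<times> ?N) \<union> ?g ` (?N \<times> ?N) \<union> ?h ` (?N \<times> ?N)"
  proof
    fix q assume q: "q \<in> paired_quadruples m n"
    obtain i j k l where [simp]: "q = ((i, j), k, l)" by (metis surj_pair)
    have pos: "i \<in> {1..n}" "j \<in> {1..n}" "k \<in> {1..n}" "l \<in> {1..n}"
      using q by (auto simp: paired_quadruples_def)
    consider "near m i j" "near m k l" | "near m i k" "near m j l" | "near m i l" "near m j k"
      using q by (auto simp: paired_quadruples_def)
    then show "q \<in> ?f ` (?N \<times> ?N) \<union> ?g ` (?N \<times> ?N) \<union> ?h ` (?N \<times> ?N)"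
    proof cases
      case 1
      then have "q \<in> ?f ` (?N \<times> ?N)" using pos by (intro image_eqI[of _ _ "((i, j), k, l)"]) auto
      then show ?thesis by blast
    next
      case 2
      then have "q \<in> ?g ` (?N \<times> ?N)" using pos by (intro image_eqI[of _ _ "((i, k), j, l)"]) auto
      then show ?thesis by blast
    next
      case 3
      then have "q \<in> ?h ` (?N \<times> ?N)" using pos by (intro image_eqI[of _ _ "((i, l), j, k)"]) auto
      then show ?thesis by blast
    qed
  qed
  have fin': "finite (?f ` (?N \<times> ?N) \<union> ?g ` (?N \<times> ?N) \<union> ?h ` (?N \<times> ?N))"
    using fin by (intro finite_UnI finite_imageI finite_cartesian_product)
  show "finite (paired_quadruples m n)" by (rule finite_subset[OF sub fin'])
  have "card (paired_quadruples m n) \<le> card (?f ` (?N \<times> ?N) \<union> ?g ` (?N \<times> ?N) \<union> ?h ` (?N \<times> ?N))"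
    by (rule card_mono[OF fin' sub])
  also have "\<dots> \<le> card (?f ` (?N \<times> ?N)) + card (?g ` (?N \<times> ?N)) + card (?h ` (?N \<times> ?N))"
    by (intro order_trans[OF card_Un_le] add_right_mono card_Un_le)
  also have "\<dots> \<le> card (?N \<times> ?N) + card (?N \<times> ?N) + card (?N \<times> ?N)"
    using fin by (intro add_mono card_image_le finite_cartesian_product)
  also have "\<dots> = 3 * (card ?N)^2" by (simp add: card_cartesian_product power2_eq_square)
  also have "\<dots> \<le> 3 * (n * (2 * m + 1))^2"
    by (intro mult_left_mono power_mono card_near_pairs) auto
  finally show "card (paired_quadruples m n) \<le> 3 * (n * (2 * m + 1))^2" .
qed

text \<open>
Equal row and column counts make the sum of a function of one index over \<open>I\<close> a multiple of its sum over \<open>{1..n}\<close>, so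
that the linear part of the decomposition is an ordinary average.
\<close>

definition regular_index_set :: "nat \<Rightarrow> nat \<Rightarrow> (nat \<times> nat) set \<Rightarrow> bool" where
  "regular_index_set n r I \<longleftrightarrow> I \<subseteq> {1..n} \<times> {1..n} \<and>
     (\<forall>i\<in>{1..n}. card {j. (i, j) \<in> I} = r) \<and> (\<forall>j\<in>{1..n}. card {i. (i, j) \<in> I} = r)"

lemma
  fixes f :: "nat \<Rightarrow> real"
  assumes reg: "regular_index_set n r I"
  shows regular_index_set_sum_fst: "(\<Sum>(i, j)\<in>I. f i) = real r * (\<Sum>i=1..n. f i)"
    and regular_index_set_sum_snd: "(\<Sum>(i, j)\<in>I. f j) = real r * (\<Sum>j=1..n. f j)"
    and regular_index_set_card: "card I = n * r"
    and regular_index_set_finite: "finite I"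
proof -
  have sub: "I \<subseteq> {1..n} \<times> {1..n}" using reg by (simp add: regular_index_set_def)
  show fin: "finite I" by (rule finite_subset[OF sub]) auto
  have 1: "I = (SIGMA i:{1..n}. {j. (i, j) \<in> I})" using sub by auto
  have finj: "finite {j. (i, j) \<in> I}" for i by (rule finite_subset[of _ "{1..n}"]) (use sub in auto)
  have fini: "finite {i. (i, j) \<in> I}" for j by (rule finite_subset[of _ "{1..n}"]) (use sub in auto)
  have fst_sum: "(\<Sum>(i, j)\<in>I. f i) = real r * (\<Sum>i=1..n. f i)" for f :: "nat \<Rightarrow> real"
  proof -
    have "(\<Sum>(i, j)\<in>I. f i) = (\<Sum>i=1..n. \<Sum>j\<in>{j. (i, j) \<in> I}. f i)"
      by (subst (1) 1, subst sum.Sigma) (use finj in auto)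
    also have "\<dots> = (\<Sum>i=1..n. real r * f i)"
      using reg by (intro sum.cong) (auto simp: regular_index_set_def)
    finally show ?thesis by (simp add: sum_distrib_left)
  qed
  then show "(\<Sum>(i, j)\<in>I. f i) = real r * (\<Sum>i=1..n. f i)" .
  have "(\<Sum>(i, j)\<in>I. f j) = (\<Sum>(j, i)\<in>(SIGMA j:{1..n}. {i. (i, j) \<in> I}). f j)"
    by (rule sum.reindex_bij_witness[of _ prod.swap prod.swap]) (use sub in auto)
  also have "\<dots> = (\<Sum>j=1..n. \<Sum>i\<in>{i. (i, j) \<in> I}. f j)"
    by (subst sum.Sigma) (use fini in auto)
  also have "\<dots> = (\<Sum>j=1..n. real r * f j)"
    using reg by (intro sum.cong) (auto simp: regular_index_set_def)
  finally show "(\<Sum>(i, j)\<in>I. f j) = real r * (\<Sum>j=1..n. f j)" by (simp add: sum_distrib_left)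
  have "real (card I) = real r * (\<Sum>i=1..n. 1)" using fst_sum[of "\<lambda>_. 1"] by (simp add: case_prod_unfold)
  also have "\<dots> = real (n * r)" by simp
  finally show "card I = n * r" using of_nat_eq_iff by blast
qed

context two_sample
begin

lemma expectation_degenerate_sum_square_le:
  assumes e: "0 < e" and I: "I \<subseteq> {1..n} \<times> {1..n}" "I \<subseteq> P"
  shows "integrable M (\<lambda>w. (\<Sum>(i, j)\<in>I. psi e (X i w) (Y j w))^2)"
    and "expectation (\<lambda>w. (\<Sum>(i, j)\<in>I. psi e (X i w) (Y j w))^2)
      \<le> 12 * (real n * real (2 * m + 1))^2 * (\<bar>C\<bar> + 4 * bound_q) / ball_vol TYPE('a) e"
proof -
  let ?V = "4 * (\<bar>C\<bar> + 4 * bound_q) / ball_vol TYPE('a) e"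
  let ?p = "\<lambda>a w. psi e (X (fst a) w) (Y (snd a) w)"
  have fin: "finite I" by (rule finite_subset[OF I(1)]) auto
  have pos: "1 \<le> fst a" "1 \<le> snd a" if "a \<in> I" for a using that I(1) by auto
  have V: "0 \<le> ?V"
    using order_trans[OF qe_bounds(1,2)[OF e]] b_pos[OF e] by (intro divide_nonneg_pos) auto
  have sq: "(\<Sum>(i, j)\<in>I. psi e (X i w) (Y j w))^2 = (\<Sum>z\<in>I \<times> I. ?p (fst z) w * ?p (snd z) w)" for w
    by (simp add: power2_eq_square sum_product case_prod_unfold sum.cartesian_product)
  have int: "integrable M (\<lambda>w. ?p (fst z) w * ?p (snd z) w)" if "z \<in> I \<times> I" for z
    using that by (intro integrable_psi_products e pos) auto
  show "integrable M (\<lambda>w. (\<Sum>(i, j)\<in>I. psi e (X i w) (Y j w))^2)"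
    unfolding sq using int by (intro Bochner_Integration.integrable_sum)
  have "expectation (\<lambda>w. (\<Sum>(i, j)\<in>I. psi e (X i w) (Y j w))^2)
      = (\<Sum>z\<in>I \<times> I. expectation (\<lambda>w. ?p (fst z) w * ?p (snd z) w))"
    unfolding sq using int by (intro Bochner_Integration.integral_sum) auto
  also have "\<dots> = (\<Sum>z\<in>(I \<times> I) \<inter> paired_quadruples m n. expectation (\<lambda>w. ?p (fst z) w * ?p (snd z) w))"
  proof (rule sum.mono_neutral_right)
    show "\<forall>z\<in>I \<times> I - (I \<times> I) \<inter> paired_quadruples m n. expectation (\<lambda>w. ?p (fst z) w * ?p (snd z) w) = 0"
    proof
      fix z assume z: "z \<in> I \<times> I - (I \<times> I) \<inter> paired_quadruples m n"
      obtain i j k l where zeq: "z = ((i, j), k, l)" by (metis surj_pair)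
      have pos: "i \<in> {1..n}" "j \<in> {1..n}" "k \<in> {1..n}" "l \<in> {1..n}" using z zeq I(1) by auto
      then have "\<not> (near m i j \<and> near m k l \<or> near m i k \<and> near m j l \<or> near m i l \<and> near m j k)"
        using z zeq by (auto simp: paired_quadruples_def)
      then have "isolated m i {j, k, l} \<or> isolated m j {i, k, l} \<or> isolated m k {i, j, l} \<or> isolated m l {i, j, k}"
        using paired_or_isolated[of m i j k l] by blast
      then show "expectation (\<lambda>w. ?p (fst z) w * ?p (snd z) w) = 0"
        using expectation_psi_product_zero[OF e, of i j k l] pos by (simp add: zeq)
    qed
  qed (use fin in auto)
  also have "\<dots> \<le> (\<Sum>z\<in>(I \<times> I) \<inter> paired_quadruples m n. ?V)"
  proof (rule sum_mono)
    fix z assume "z \<in> (I \<times> I) \<inter> paired_quadruples m n"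
    then have ab: "fst z \<in> I" "snd z \<in> I" by auto
    have sq: "expectation (\<lambda>w. (?p a w)^2) \<le> ?V" if "a \<in> I" for a
      using that I(2) by (intro expectation_psi_square_le e pos) auto
    have isq: "integrable M (\<lambda>w. (?p a w)^2)" if "a \<in> I" for a
      unfolding power2_eq_square by (intro integrable_psi_products e pos that)
    have meas: "?p a \<in> borel_measurable M" if "a \<in> I" for a
      using integrable_psi_products(1)[OF e pos(1)[OF that] pos(2)[OF that] pos(1)[OF that] pos(2)[OF that]] by simp
    have "x \<le> v" if "\<bar>x\<bar> \<le> (s + t) / 2" "s \<le> v" "t \<le> v" for x s t v :: real
      using that abs_ge_self[of x] by argo
    from this[OF integrable_mult_of_square_integrable(2)[OF meas[OF ab(1)] meas[OF ab(2)] isq[OF ab(1)] isq[OF ab(2)]]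
        sq[OF ab(1)] sq[OF ab(2)]]
    show "expectation (\<lambda>w. ?p (fst z) w * ?p (snd z) w) \<le> ?V" .
  qed
  also have "\<dots> = real (card ((I \<times> I) \<inter> paired_quadruples m n)) * ?V" by simp
  also have "\<dots> \<le> real (3 * (n * (2 * m + 1))^2) * ?V"
  proof (rule mult_right_mono[OF _ V])
    have "card ((I \<times> I) \<inter> paired_quadruples m n) \<le> card (paired_quadruples m n)"
      using card_paired_quadruples(1) by (intro card_mono) auto
    then show "real (card ((I \<times> I) \<inter> paired_quadruples m n)) \<le> real (3 * (n * (2 * m + 1))^2)"
      using card_paired_quadruples(2)[of m n] by linarith
  qed
  also have "real (3 * (n * (2 * m + 1))^2) = 3 * (real n * real (2 * m + 1))^2" by (simp add: algebra_simps)
  also have "3 * (real n * real (2 * m + 1))^2 * ?V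
      = 12 * (real n * real (2 * m + 1))^2 * (\<bar>C\<bar> + 4 * bound_q) / ball_vol TYPE('a) e"
    by simp
  finally show "expectation (\<lambda>w. (\<Sum>(i, j)\<in>I. psi e (X i w) (Y j w))^2)
      \<le> 12 * (real n * real (2 * m + 1))^2 * (\<bar>C\<bar> + 4 * bound_q) / ball_vol TYPE('a) e" .
qed

definition q :: real where "q = (LINT x|lborel. pX x * pY x)"

text \<open>
The influence function: the limit of the linear part of the decomposition for vanishing radius. The difference between
the two is \<open>score_error\<close>, centred by the bias.
\<close>

definition score :: "'a \<times> 'a \<Rightarrow> real" where
  "score z = (pY (fst z) + pX (snd z)) / 2 - q"

definition score_error :: "real \<Rightarrow> 'a \<times> 'a \<Rightarrow> real" where
  "score_error e z = (smooth e pY (fst z) - pY (fst z) + (smooth e pX (snd z) - pX (snd z))) / 2 - (qe e - q)"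

definition estimator :: "(nat \<times> nat) set \<Rightarrow> real \<Rightarrow> 'w \<Rightarrow> real" where
  "estimator I e w = (\<Sum>(i, j)\<in>I. kern e (X i w) (Y j w)) / real (card I)"

definition remainder :: "nat \<Rightarrow> (nat \<times> nat) set \<Rightarrow> real \<Rightarrow> 'w \<Rightarrow> real" where
  "remainder n I e w = (\<Sum>(i, j)\<in>I. psi e (X i w) (Y j w)) / real (card I)
     + 2 * average (score_error e) n w + (qe e - q)"

lemma measurable_score[measurable]: "score \<in> borel_measurable borel"
  unfolding score_def by measurable

lemma measurable_score_error[measurable]: "0 < e \<Longrightarrow> score_error e \<in> borel_measurable borel"
  unfolding score_error_def using measurable_smooths[of e] by measurable

text \<open>
Summing the definition of \<open>psi\<close> over the index set replaces the conditional expectations by row and column averages.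
\<close>

lemma estimator_decomposition:
  assumes reg: "regular_index_set n r I" and "0 < n" "0 < r"
  shows "estimator I e w - q = 2 * average score n w + remainder n I e w"
proof -
  have N: "real (card I) = real n * real r" and N0: "real n * real r > 0"
    using assms by (simp_all add: regular_index_set_card)
  let ?a = "\<lambda>i. smooth e pY (X i w)" and ?b = "\<lambda>j. smooth e pX (Y j w)"
  have "(\<Sum>(i, j)\<in>I. kern e (X i w) (Y j w))
      = (\<Sum>(i, j)\<in>I. psi e (X i w) (Y j w) + ?a i + ?b j - qe e)"
    by (intro sum.cong) (auto simp: psi_def)
  also have "\<dots> = (\<Sum>(i, j)\<in>I. psi e (X i w) (Y j w)) + (\<Sum>(i, j)\<in>I. ?a i) + (\<Sum>(i, j)\<in>I. ?b j) - real (card I) * qe e"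
    by (simp add: sum.distrib sum_subtractf case_prod_unfold)
  also have "\<dots> = (\<Sum>(i, j)\<in>I. psi e (X i w) (Y j w)) + real r * (\<Sum>i=1..n. ?a i + ?b i) - real n * real r * qe e"
    using reg by (simp add: regular_index_set_sum_fst regular_index_set_sum_snd N sum.distrib distrib_left)
  finally have "estimator I e w
      = ((\<Sum>(i, j)\<in>I. psi e (X i w) (Y j w)) + real r * (\<Sum>i=1..n. ?a i + ?b i) - real n * real r * qe e) / (real n * real r)"
    by (simp add: estimator_def N)
  also have "\<dots> = (\<Sum>(i, j)\<in>I. psi e (X i w) (Y j w)) / (real n * real r)
      + (\<Sum>i=1..n. ?a i + ?b i) / real n - qe e"
    using assms by (simp add: field_simps)
  finally have 1: "estimator I e w = (\<Sum>(i, j)\<in>I. psi e (X i w) (Y j w)) / (real n * real r)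
      + (\<Sum>i=1..n. ?a i + ?b i) / real n - qe e" .
  have "(\<Sum>i=1..n. ?a i + ?b i)
      = (\<Sum>i=1..n. 2 * score (X i w, Y i w) + 2 * score_error e (X i w, Y i w) + 2 * qe e)"
    by (intro sum.cong) (auto simp: score_def score_error_def field_simps)
  also have "\<dots> = 2 * (\<Sum>i=1..n. score (X i w, Y i w)) + 2 * (\<Sum>i=1..n. score_error e (X i w, Y i w)) + real n * (2 * qe e)"
    by (simp add: sum.distrib sum_distrib_left)
  finally have "(\<Sum>i=1..n. ?a i + ?b i) / real n = 2 * average score n w + 2 * average (score_error e) n w + 2 * qe e"
    using \<open>0 < n\<close> by (simp add: average_def field_simps)
  then show ?thesis by (simp add: 1 remainder_def N)
qed

lemma
  shows score_square_integrable: "integrable M (\<lambda>w. (score (X 1 w, Y 1 w))^2)"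
    and expectation_density_at_sample:
      "1 \<le> i \<Longrightarrow> expectation (\<lambda>w. pY (X i w)) = q" "1 \<le> i \<Longrightarrow> expectation (\<lambda>w. pX (Y i w)) = q"
      "1 \<le> i \<Longrightarrow> integrable M (\<lambda>w. pY (X i w))" "1 \<le> i \<Longrightarrow> integrable M (\<lambda>w. pX (Y i w))"
    and expectation_score: "expectation (\<lambda>w. score (X 1 w, Y 1 w)) = 0"
proof -
  have X1: "integrable M (\<lambda>w. pY (X i w))" and Y1: "integrable M (\<lambda>w. pX (Y i w))" if "1 \<le> i" for i
    using that nonneg_L1_L3_mult[OF pX pY] nonneg_L1_L3_mult[OF pY pX] by (simp_all add: integrable_X_iff integrable_Y_iff)
  have EX: "expectation (\<lambda>w. pY (X i w)) = q" and EY: "expectation (\<lambda>w. pX (Y i w)) = q" if "1 \<le> i" for i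
    using that by (simp_all add: expectation_X expectation_Y q_def mult.commute)
  show "1 \<le> i \<Longrightarrow> expectation (\<lambda>w. pY (X i w)) = q" "1 \<le> i \<Longrightarrow> expectation (\<lambda>w. pX (Y i w)) = q"
    "1 \<le> i \<Longrightarrow> integrable M (\<lambda>w. pY (X i w))" "1 \<le> i \<Longrightarrow> integrable M (\<lambda>w. pX (Y i w))"
    using X1 Y1 EX EY by auto
  have sX: "integrable M (\<lambda>w. (pY (X 1 w))^2)" and sY: "integrable M (\<lambda>w. (pX (Y 1 w))^2)"
    using nonneg_L1_L3_mult_square[OF pX pY] nonneg_L1_L3_mult_square[OF pY pX]
    by (simp_all add: integrable_X_iff[of "\<lambda>x. (pY x)^2"] integrable_Y_iff[of "\<lambda>x. (pX x)^2"])
  have "integrable M (\<lambda>w. pY (X 1 w) * pX (Y 1 w))"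
    by (intro integrable_mult_of_square_integrable sX sY) measurable
  then show "integrable M (\<lambda>w. (score (X 1 w, Y 1 w))^2)"
    using X1[of 1] Y1[of 1] sX sY
    by (simp add: score_def power2_eq_square algebra_simps add_divide_distrib diff_divide_distrib)
  show "expectation (\<lambda>w. score (X 1 w, Y 1 w)) = 0"
    using X1[of 1] Y1[of 1] EX[of 1] EY[of 1] by (simp add: score_def prob_space)
qed

text \<open>
The bias is the mean of a smoothing error, so its square is controlled by the same \<open>\<eta>\<close>.
\<close>

lemma score_error_moments:
  assumes e: "0 < e"
    and \<eta>: "\<And>u. norm u \<le> e \<Longrightarrow> (LINT x|lborel. pX x * (pY (x - u) - pY x)^2) \<le> \<eta>"
      "\<And>u. norm u \<le> e \<Longrightarrow> (LINT x|lborel. pY x * (pX (x - u) - pX x)^2) \<le> \<eta>"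
  shows "integrable M (\<lambda>w. (score_error e (X 1 w, Y 1 w))^2)"
    and "expectation (\<lambda>w. score_error e (X 1 w, Y 1 w)) = 0"
    and "expectation (\<lambda>w. (score_error e (X 1 w, Y 1 w))^2) \<le> \<eta>"
    and "(qe e - q)^2 \<le> \<eta>"
proof -
  note [measurable] = measurable_smooths[OF e]
  let ?U = "\<lambda>w. smooth e pY (X 1 w) - pY (X 1 w)" and ?V = "\<lambda>w. smooth e pX (Y 1 w) - pX (Y 1 w)"
  note errX = smooth_weighted_L2_error[OF e pX pY \<eta>(1)] and errY = smooth_weighted_L2_error[OF e pY pX \<eta>(2)]
  have iU: "integrable M (\<lambda>w. (?U w)^2)" and EU: "expectation (\<lambda>w. (?U w)^2) \<le> \<eta>"
    using errX integrable_X_iff[of "\<lambda>x. (smooth e pY x - pY x)^2" 1] expectation_X[of "\<lambda>x. (smooth e pY x - pY x)^2" 1]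
    by simp_all
  have iV: "integrable M (\<lambda>w. (?V w)^2)" and EV: "expectation (\<lambda>w. (?V w)^2) \<le> \<eta>"
    using errY integrable_Y_iff[of "\<lambda>x. (smooth e pX x - pX x)^2" 1] expectation_Y[of "\<lambda>x. (smooth e pX x - pX x)^2" 1]
    by simp_all
  have meanU: "expectation ?U = qe e - q" and meanV: "expectation ?V = qe e - q"
    and iU1: "integrable M ?U" and iV1: "integrable M ?V"
    using expectation_smooth[OF e, of 1] expectation_density_at_sample[of 1] by simp_all
  have "0 \<le> variance ?U" by (rule variance_positive)
  then have "(qe e - q)^2 \<le> expectation (\<lambda>w. (?U w)^2)"
    using variance_eq[OF iU1 iU] unfolding meanU by linarith
  then show "(qe e - q)^2 \<le> \<eta>" using EU by linarith
  let ?H = "\<lambda>w. (?U w + ?V w) / 2"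
  have iUV: "integrable M (\<lambda>w. ?U w * ?V w)"
    by (intro integrable_mult_of_square_integrable iU iV) measurable
  have iH1: "integrable M ?H" and meanH: "expectation ?H = qe e - q"
    using iU1 iV1 meanU meanV by (simp_all del: integral_diff)
  have sqH: "(?H w)^2 = (?U w)^2 / 4 + (?V w)^2 / 4 + ?U w * ?V w / 2" for w
    by (simp only: power_divide power2_sum) (simp add: field_simps)
  have iH: "integrable M (\<lambda>w. (?H w)^2)"
    unfolding sqH using iU iV iUV by (intro Bochner_Integration.integrable_add integrable_divide) auto
  have err: "score_error e (X 1 w, Y 1 w) = ?H w - (qe e - q)" for w by (simp add: score_error_def)
  show "expectation (\<lambda>w. score_error e (X 1 w, Y 1 w)) = 0"
    unfolding err using iH1 meanH by (subst Bochner_Integration.integral_diff) (auto simp: prob_space)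
  show "integrable M (\<lambda>w. (score_error e (X 1 w, Y 1 w))^2)"
  proof -
    have "integrable M (\<lambda>w. (h w - c)^2)" if "integrable M h" "integrable M (\<lambda>w. (h w)^2)"
      for h :: "'w \<Rightarrow> real" and c using that by (simp add: power2_diff)
    from this[OF iH1 iH] show ?thesis unfolding err .
  qed
  have "expectation (\<lambda>w. (score_error e (X 1 w, Y 1 w))^2) = variance ?H"
    unfolding err meanH ..
  also have "\<dots> \<le> expectation (\<lambda>w. (?H w)^2)" using variance_eq[OF iH1 iH] by simp
  also have "\<dots> \<le> expectation (\<lambda>w. ((?U w)^2 + (?V w)^2) / 2)"
  proof (intro integral_mono iH)
    have "x^2 / 4 + y^2 / 4 + x * y / 2 \<le> (x^2 + y^2) / 2" for x y :: real
      using sum_squares_bound[of x y] by (simp add: field_simps)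
    then show "(?H w)^2 \<le> ((?U w)^2 + (?V w)^2) / 2" for w unfolding sqH .
  qed (use iU iV in auto)
  also have "\<dots> = (expectation (\<lambda>w. (?U w)^2) + expectation (\<lambda>w. (?V w)^2)) / 2" using iU iV by simp
  also have "\<dots> \<le> \<eta>" using EU EV by argo
  finally show "expectation (\<lambda>w. (score_error e (X 1 w, Y 1 w))^2) \<le> \<eta>" .
qed

end

section \<open>Mean-square error up to a remainder\<close>

context two_sample
begin

text \<open>
From \<open>12 (2 m + 1)\<^sup>2\<close> in the bound for the degenerate sum; the further factor \<open>4\<close> accounts for index sets with only
\<open>n / 2\<close> entries per row.
\<close>

definition remainder_const :: real where
  "remainder_const = 48 * (real (2 * m + 1))^2 * (\<bar>C\<bar> + 4 * bound_q)"

lemma remainder_const_nonneg: "0 \<le> remainder_const"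
proof -
  have "0 \<le> bound_q" using order_trans[OF qe_bounds(1,2)[of 1]] by simp
  then show ?thesis by (simp add: remainder_const_def)
qed

lemma remainder_mean_square:
  assumes e: "0 < e" and reg: "regular_index_set n r I" and IP: "I \<subseteq> P"
    and n: "0 < n" and r: "n \<le> 2 * r"
    and \<eta>: "\<And>u. norm u \<le> e \<Longrightarrow> (LINT x|lborel. pX x * (pY (x - u) - pY x)^2) \<le> \<eta>"
      "\<And>u. norm u \<le> e \<Longrightarrow> (LINT x|lborel. pY x * (pX (x - u) - pX x)^2) \<le> \<eta>"
  shows "integrable M (\<lambda>w. (remainder n I e w)^2)" "remainder n I e \<in> borel_measurable M"
    and "expectation (\<lambda>w. (remainder n I e w)^2)
      \<le> 3 * (remainder_const / ((real n)^2 * ball_vol TYPE('a) e)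
            + 4 * real (2 * m + 1) * \<eta> / real n + (qe e - q)^2)"
proof -
  let ?R = "\<lambda>w. (\<Sum>(i, j)\<in>I. psi e (X i w) (Y j w)) / real (card I)"
  let ?D = "\<lambda>w. average (score_error e) n w"
  let ?b = "ball_vol TYPE('a) e"
  note mom = score_error_moments[OF e \<eta>]
  note fin = regular_index_set_finite[OF reg]
  have I: "I \<subseteq> {1..n} \<times> {1..n}" using reg by (simp add: regular_index_set_def)
  have N: "real (card I) = real n * real r" by (simp add: regular_index_set_card[OF reg])
  have w0: "0 < r" using n r by simp
  have b: "0 < ?b" by (rule b_pos[OF e])
  have bq: "0 \<le> \<bar>C\<bar> + 4 * bound_q" using order_trans[OF qe_bounds(1,2)[OF e]] by simp
  have mR[measurable]: "?R \<in> borel_measurable M"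
    unfolding case_prod_unfold
  proof (intro borel_measurable_divide borel_measurable_sum borel_measurable_const)
    fix z assume "z \<in> I"
    then have "1 \<le> fst z" "1 \<le> snd z" using I by auto
    then show "(\<lambda>w. psi e (X (fst z) w) (Y (snd z) w)) \<in> borel_measurable M"
      using integrable_psi_products(1)[OF e, of "fst z" "snd z" 1 1] by simp
  qed
  have mD[measurable]: "?D \<in> borel_measurable M" by (rule measurable_average[OF measurable_score_error[OF e]])
  have iR: "integrable M (\<lambda>w. (?R w)^2)"
    unfolding power_divide by (intro integrable_divide expectation_degenerate_sum_square_le(1)[OF e I IP])
  have ER: "expectation (\<lambda>w. (?R w)^2) \<le> remainder_const / ((real n)^2 * ?b)"
  proof -
    have "expectation (\<lambda>w. (?R w)^2)
        = expectation (\<lambda>w. (\<Sum>(i, j)\<in>I. psi e (X i w) (Y j w))^2) / (real n * real r)^2"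
      unfolding power_divide N by simp
    also have "\<dots> \<le> (12 * (real n * real (2 * m + 1))^2 * (\<bar>C\<bar> + 4 * bound_q) / ?b) / (real n * real r)^2"
      by (intro divide_right_mono expectation_degenerate_sum_square_le(2)[OF e I IP]) simp
    also have "\<dots> = (12 * (real (2 * m + 1))^2 * (\<bar>C\<bar> + 4 * bound_q) / ?b) / (real r)^2"
      using n w0 by (simp add: power_mult_distrib)
    also have "\<dots> \<le> (12 * (real (2 * m + 1))^2 * (\<bar>C\<bar> + 4 * bound_q) / ?b) / (real n / 2)^2"
    proof (rule divide_left_mono)
      show "(real n / 2)^2 \<le> (real r)^2" using r by (intro power_mono) auto
      show "0 \<le> 12 * (real (2 * m + 1))^2 * (\<bar>C\<bar> + 4 * bound_q) / ?b"
        using bq b by (intro divide_nonneg_pos mult_nonneg_nonneg) auto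
    qed (use n w0 in auto)
    also have "\<dots> = remainder_const / ((real n)^2 * ?b)"
      by (simp add: remainder_const_def power_divide mult_ac)
    finally show ?thesis .
  qed
  have iD: "integrable M (\<lambda>w. (?D w)^2)"
    by (rule integrable_average_square[OF measurable_score_error[OF e] mom(1,2)])
  have ED: "expectation (\<lambda>w. (?D w)^2) \<le> real (2 * m + 1) * \<eta> / real n"
  proof -
    have "expectation (\<lambda>w. (?D w)^2)
        \<le> real (2 * m + 1) * expectation (\<lambda>w. (score_error e (X 1 w, Y 1 w))^2) / real n"
      by (rule mean_square_average_le[OF measurable_score_error[OF e] mom(1,2) n])
    also have "\<dots> \<le> real (2 * m + 1) * \<eta> / real n"
      using mom(3) by (intro divide_right_mono mult_left_mono) auto
    finally show ?thesis .
  qed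
  have rem: "remainder n I e = (\<lambda>w. ?R w + 2 * ?D w + (qe e - q))" by (simp add: remainder_def fun_eq_iff)
  show meas: "remainder n I e \<in> borel_measurable M" unfolding rem by measurable
  have three: "(x + y + z)^2 \<le> 3 * (x^2 + y^2 + z^2)" for x y z :: real
    using sum_squares_bound[of x y] sum_squares_bound[of x z] sum_squares_bound[of y z]
    by (simp add: power2_eq_square algebra_simps)
  let ?B = "\<lambda>w. 3 * ((?R w)^2 + (2 * ?D w)^2 + (qe e - q)^2)"
  have iB: "integrable M ?B" using iR iD by (simp add: power_mult_distrib)
  show int: "integrable M (\<lambda>w. (remainder n I e w)^2)"
  proof (rule Bochner_Integration.integrable_bound[OF iB])
    show "AE w in M. norm ((remainder n I e w)^2) \<le> norm (?B w)"
      unfolding rem real_norm_def abs_power2 by (intro AE_I2 order_trans[OF three abs_ge_self])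
  qed (use meas in measurable)
  have "expectation (\<lambda>w. (remainder n I e w)^2) \<le> expectation ?B"
    by (intro integral_mono int iB) (unfold rem, rule three)
  also have "\<dots> = 3 * (expectation (\<lambda>w. (?R w)^2) + 4 * expectation (\<lambda>w. (?D w)^2) + (qe e - q)^2)"
    using iR iD by (simp add: power_mult_distrib prob_space)
  also have "\<dots> \<le> 3 * (remainder_const / ((real n)^2 * ?b) + 4 * (real (2 * m + 1) * \<eta> / real n) + (qe e - q)^2)"
    by (intro mult_left_mono add_mono ER ED order_refl) auto
  finally show "expectation (\<lambda>w. (remainder n I e w)^2)
      \<le> 3 * (remainder_const / ((real n)^2 * ?b) + 4 * real (2 * m + 1) * \<eta> / real n + (qe e - q)^2)"
    by (simp only: mult.assoc times_divide_eq_right)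
qed

definition mse :: "(nat \<Rightarrow> (nat \<times> nat) set) \<Rightarrow> (nat \<Rightarrow> real) \<Rightarrow> nat \<Rightarrow> real" where
  "mse I \<epsilon> n = expectation (\<lambda>w. (estimator (I n) (\<epsilon> n) w - q)^2)"

definition avg_mse :: "nat \<Rightarrow> real" where
  "avg_mse n = expectation (\<lambda>w. (average score n w)^2)"

definition rem_mse :: "(nat \<Rightarrow> (nat \<times> nat) set) \<Rightarrow> (nat \<Rightarrow> real) \<Rightarrow> nat \<Rightarrow> real" where
  "rem_mse I \<epsilon> n = expectation (\<lambda>w. (remainder n (I n) (\<epsilon> n) w)^2)"

lemma avg_mse_le: "0 < n \<Longrightarrow> avg_mse n \<le> real (2 * m + 1) * expectation (\<lambda>w. (score (X 1 w, Y 1 w))^2) / real n"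
  unfolding avg_mse_def
  by (rule mean_square_average_le[OF measurable_score score_square_integrable expectation_score])

lemma avg_mse_nonneg: "0 \<le> avg_mse n"
  unfolding avg_mse_def by (simp add: integral_nonneg_AE)

definition score_variance :: real where
  "score_variance = expectation (\<lambda>w. (score (X 1 w, Y 1 w))^2)
     + 2 * (\<Sum>h=1..m. expectation (\<lambda>w. score (X 1 w, Y 1 w) * score (X (1 + h) w, Y (1 + h) w)))"

lemma avg_mse_limit: "(\<lambda>n. real n * avg_mse n) \<longlonglongrightarrow> score_variance"
  using mean_square_average_limit[OF measurable_score score_square_integrable expectation_score]
  unfolding avg_mse_def score_variance_def by (simp add: power2_eq_square)

lemma long_run_variance_score:
  "long_run_variance M m (\<lambda>i w. 1 / 2 * (pY (X i w) + pX (Y i w))) = score_variance"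
proof -
  have mean: "expectation (\<lambda>w. 1 / 2 * (pY (X i w) + pX (Y i w))) = q" if "1 \<le> i" for i
    using expectation_density_at_sample[OF that] by simp
  have score: "1 / 2 * (pY (X i w) + pX (Y i w)) - q = score (X i w, Y i w)" for i w
    by (simp add: score_def)
  show ?thesis
    unfolding long_run_variance_def cov_def score_variance_def
    using mean[of 1] mean[of "1 + h" for h] by (simp only: score le_add1 order_refl)
qed

end

text \<open>
The off-diagonal index set is empty for \<open>n = 1\<close>; the requirements on index sets therefore start at \<open>n = 2\<close>.
\<close>

locale two_sample_sequence = two_sample M X Y m pX pY P C
  for M :: "'w measure" and X Y :: "nat \<Rightarrow> 'w \<Rightarrow> 'a::euclidean_space" and m :: nat
    and pX pY :: "'a \<Rightarrow> real" and P :: "(nat \<times> nat) set" and C :: real +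
  fixes I :: "nat \<Rightarrow> (nat \<times> nat) set" and r :: "nat \<Rightarrow> nat" and \<epsilon> :: "nat \<Rightarrow> real"
  assumes reg: "\<And>n. 2 \<le> n \<Longrightarrow> regular_index_set n (r n) (I n)"
    and sub: "\<And>n. 2 \<le> n \<Longrightarrow> I n \<subseteq> P"
    and row_size: "\<And>n. 2 \<le> n \<Longrightarrow> n \<le> 2 * r n"
    and \<epsilon>_pos: "\<And>n. 1 \<le> n \<Longrightarrow> 0 < \<epsilon> n" and \<epsilon>_lim: "\<epsilon> \<longlonglongrightarrow> 0"
begin

lemma eventually_small_oscillation:
  assumes "0 < \<eta>"
  shows "\<forall>\<^sub>F n in sequentially. 2 \<le> n \<and>
      (\<forall>u. norm u \<le> \<epsilon> n \<longrightarrow> (LINT x|lborel. pX x * (pY (x - u) - pY x)^2) \<le> \<eta>) \<and>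
      (\<forall>u. norm u \<le> \<epsilon> n \<longrightarrow> (LINT x|lborel. pY x * (pX (x - u) - pX x)^2) \<le> \<eta>)"
proof -
  obtain r where r: "r > 0" "\<And>u. norm u \<le> r \<Longrightarrow> (LINT x|lborel. pX x * (pY (x - u) - pY x)^2) \<le> \<eta>"
    using translate_weighted_L2_small[OF pX pY assms] by blast
  obtain r' where r': "r' > 0" "\<And>u. norm u \<le> r' \<Longrightarrow> (LINT x|lborel. pY x * (pX (x - u) - pX x)^2) \<le> \<eta>"
    using translate_weighted_L2_small[OF pY pX assms] by blast
  have "\<forall>\<^sub>F n in sequentially. \<epsilon> n < min r r'"
    by (rule order_tendstoD(2)[OF \<epsilon>_lim]) (use r(1) r'(1) in simp)
  then show ?thesis using eventually_ge_at_top[of 2]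
  proof eventually_elim
    case (elim n)
    then have "norm u \<le> r \<and> norm u \<le> r'" if "norm u \<le> \<epsilon> n" for u :: 'a using that by auto
    then show ?case using elim(2) r(2) r'(2) by blast
  qed
qed

lemma eventually_bias_le:
  assumes "0 < \<eta>" shows "\<forall>\<^sub>F n in sequentially. (qe (\<epsilon> n) - q)^2 \<le> \<eta>"
  using eventually_small_oscillation[OF assms]
proof eventually_elim
  case (elim n)
  then have "0 < \<epsilon> n" using \<epsilon>_pos by auto
  then show ?case using elim by (intro score_error_moments(4)[of "\<epsilon> n"]) auto
qed

lemma eventually_rem_mse_le:
  assumes "0 < \<eta>"
  shows "\<forall>\<^sub>F n in sequentially. rem_mse I \<epsilon> n
      \<le> 3 * (remainder_const / ((real n)^2 * ball_vol TYPE('a) (\<epsilon> n))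
            + 4 * real (2 * m + 1) * \<eta> / real n + (qe (\<epsilon> n) - q)^2)"
  using eventually_small_oscillation[OF assms]
proof eventually_elim
  case (elim n)
  then have n: "2 \<le> n" "0 < \<epsilon> n" using \<epsilon>_pos by auto
  then show ?case unfolding rem_mse_def
    using elim by (intro remainder_mean_square(3)[OF _ reg[OF n(1)] sub[OF n(1)] _ row_size[OF n(1)]]) auto
qed

lemma rem_mse_nonneg: "0 \<le> rem_mse I \<epsilon> n"
  unfolding rem_mse_def by (simp add: integral_nonneg_AE)

text \<open>
The mixed term of \<open>(2 A + T)\<^sup>2\<close> is split with a free weight \<open>s\<close>: \<open>s = 1\<close> gives an upper bound of the right order,
and a small \<open>s\<close> makes the mixed term negligible against the main term.
\<close>

lemma eventually_mse_expansion:
  "\<forall>\<^sub>F n in sequentially. \<forall>s>0. \<bar>mse I \<epsilon> n - 4 * avg_mse n\<bar> \<le> rem_mse I \<epsilon> n + 2 * (s * avg_mse n + rem_mse I \<epsilon> n / s)"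
  using eventually_small_oscillation[of 1, OF zero_less_one]
proof eventually_elim
  case (elim n)
  then have n: "2 \<le> n" "0 < \<epsilon> n" using \<epsilon>_pos by auto
  let ?A = "\<lambda>w. average score n w" and ?T = "\<lambda>w. remainder n (I n) (\<epsilon> n) w"
  have T: "integrable M (\<lambda>w. (?T w)^2)" "?T \<in> borel_measurable M"
    using elim n by (auto intro!: remainder_mean_square[OF _ reg[OF n(1)] sub[OF n(1)] _ row_size[OF n(1)], of _ 1])
  have A: "integrable M (\<lambda>w. (?A w)^2)"
    by (rule integrable_average_square[OF measurable_score score_square_integrable expectation_score])
  have mA: "?A \<in> borel_measurable M" by (rule measurable_average[OF measurable_score])
  have AT: "integrable M (\<lambda>w. ?A w * ?T w)"
    by (rule integrable_mult_of_square_integrable(1)[OF mA T(2) A T(1)])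
  have "mse I \<epsilon> n = expectation (\<lambda>w. 4 * (?A w)^2 + 4 * (?A w * ?T w) + (?T w)^2)"
    unfolding mse_def
  proof (intro Bochner_Integration.integral_cong refl)
    fix w
    have "estimator (I n) (\<epsilon> n) w - q = 2 * ?A w + ?T w"
      using row_size[OF n(1)] n by (intro estimator_decomposition[OF reg[OF n(1)]]) auto
    then show "(estimator (I n) (\<epsilon> n) w - q)^2 = 4 * (?A w)^2 + 4 * (?A w * ?T w) + (?T w)^2"
      by (simp add: power2_eq_square algebra_simps)
  qed
  also have "\<dots> = 4 * avg_mse n + 4 * expectation (\<lambda>w. ?A w * ?T w) + rem_mse I \<epsilon> n"
    using A T(1) AT by (simp add: avg_mse_def rem_mse_def)
  finally have eq: "mse I \<epsilon> n = 4 * avg_mse n + 4 * expectation (\<lambda>w. ?A w * ?T w) + rem_mse I \<epsilon> n" .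
  show ?case
  proof (intro allI impI)
    fix s :: real assume s: "0 < s"
    have "\<bar>expectation (\<lambda>w. (sqrt s * ?A w) * (?T w / sqrt s))\<bar>
        \<le> (expectation (\<lambda>w. (sqrt s * ?A w)^2) + expectation (\<lambda>w. (?T w / sqrt s)^2)) / 2"
      using A T mA s by (intro integrable_mult_of_square_integrable(2)) (auto simp: power_mult_distrib power_divide)
    also have "(\<lambda>w. (sqrt s * ?A w) * (?T w / sqrt s)) = (\<lambda>w. ?A w * ?T w)"
      using s by (simp add: fun_eq_iff)
    also have "expectation (\<lambda>w. (sqrt s * ?A w)^2) = s * avg_mse n"
      using s by (simp add: power_mult_distrib avg_mse_def)
    also have "expectation (\<lambda>w. (?T w / sqrt s)^2) = rem_mse I \<epsilon> n / s"
      using s by (simp add: power_divide rem_mse_def)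
    finally have "4 * \<bar>expectation (\<lambda>w. ?A w * ?T w)\<bar> \<le> 2 * (s * avg_mse n + rem_mse I \<epsilon> n / s)"
      by argo
    moreover have "\<bar>(4 * a + 4 * x + r) - 4 * a\<bar> \<le> r + y" if "4 * \<bar>x\<bar> \<le> y" "0 \<le> r" for a x r y :: real
      using that abs_ge_self[of x] abs_ge_minus_self[of x] by (intro abs_leI) argo+
    ultimately show "\<bar>mse I \<epsilon> n - 4 * avg_mse n\<bar> \<le> rem_mse I \<epsilon> n + 2 * (s * avg_mse n + rem_mse I \<epsilon> n / s)"
      unfolding eq using rem_mse_nonneg[of n] by blast
  qed
qed

end

section \<open>Growth of slowly varying functions\<close>

lemma integral_indicator_of_bool_tendsto_0:
  fixes B :: "nat \<Rightarrow> real \<Rightarrow> bool"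
  assumes meas: "\<And>n. Measurable.pred borel (B n)"
    and ev: "\<And>s. s \<in> {a..b} \<Longrightarrow> \<forall>\<^sub>F n in sequentially. \<not> B n s"
  shows "(\<lambda>n. LINT s|lborel. indicator {a..b} s * of_bool (B n s) :: real) \<longlonglongrightarrow> 0"
proof -
  note [measurable] = meas
  have "(\<lambda>n. LINT s|lborel. indicator {a..b} s * of_bool (B n s) :: real) \<longlonglongrightarrow> (LINT s|(lborel :: real measure). 0)"
  proof (rule integral_dominated_convergence[where w="indicator {a..b}"])
    show "integrable lborel (indicator {a..b} :: real \<Rightarrow> real)"
      by (simp add: integrable_indicator_iff emeasure_lborel_Icc_eq)
    show "AE s in lborel. (\<lambda>n. indicator {a..b} s * of_bool (B n s) :: real) \<longlonglongrightarrow> 0"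
    proof (intro AE_I2 tendsto_eventually)
      fix s :: real
      show "\<forall>\<^sub>F n in sequentially. indicator {a..b} s * of_bool (B n s) = (0 :: real)"
      proof (cases "s \<in> {a..b}")
        case True
        from ev[OF this] show ?thesis by eventually_elim simp
      qed simp
    qed
    show "AE s in lborel. norm (indicator {a..b} s * of_bool (B n s) :: real) \<le> indicator {a..b} s" for n
      by (intro AE_I2) (auto simp: indicator_def)
  qed auto
  then show ?thesis by simp
qed

lemma slowly_varying_ratio:
  assumes L: "slowly_varying L" and y: "filterlim y at_top sequentially" and "0 < t" "0 < c" "c < 1"
  shows "\<forall>\<^sub>F n in sequentially. c * L (y n) < L (t * y n) \<and> c * L (t * y n) < L (y n)"
proof -
  have pos: "\<And>x. 1 \<le> x \<Longrightarrow> 0 < L x" and "((\<lambda>x. L (t * x) / L x) \<longlongrightarrow> 1) at_top"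
    using L \<open>0 < t\<close> by (auto simp: slowly_varying_def)
  then have lim: "(\<lambda>n. L (t * y n) / L (y n)) \<longlonglongrightarrow> 1"
    using y by (rule_tac filterlim_compose)
  have "1 < 1 / c" using assms by simp
  from order_tendstoD(1)[OF lim \<open>c < 1\<close>] order_tendstoD(2)[OF lim this] filterlim_at_top_dense[THEN iffD1, OF y, rule_format, of 1]
  show ?thesis
  proof eventually_elim
    case (elim n)
    then have "0 < L (y n)" by (intro pos) simp
    then show ?case using elim \<open>0 < c\<close> by (simp add: field_simps)
  qed
qed

text \<open>
Slow variation gives a limit for each fixed factor \<open>t\<close>; uniformity in \<open>t\<close> requires measurability. Suppose that
\<open>L\<close> grows by more than \<open>4\<close> from \<open>x\<^sub>n\<close> to \<open>y\<^sub>n = t\<^sub>n x\<^sub>n\<close>. No point \<open>s x\<^sub>n\<close> can have a value of \<open>L\<close> both within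
a factor \<open>2\<close> of \<open>L(x\<^sub>n)\<close> and within a factor \<open>2\<close> of \<open>L(y\<^sub>n)\<close>. So the two exceptional sets of factors cover
\<open>[2, 6]\<close>, whereas the measure of each of them tends to zero by dominated convergence.
\<close>

lemma slowly_varying_locally_bounded:
  assumes L: "slowly_varying L"
  shows "\<exists>x0\<ge>1. \<forall>x\<ge>x0. \<forall>t\<in>{1..2}. L (t * x) \<le> 4 * L x"
proof (rule ccontr)
  assume contr: "\<not> ?thesis"
  have "\<exists>x t. real n + 1 \<le> x \<and> t \<in> {1..2} \<and> 4 * L x < L (t * x)" for n
  proof -
    have "1 \<le> real n + 1" by simp
    then have "\<not> (\<forall>x\<ge>real n + 1. \<forall>t\<in>{1..2}. L (t * x) \<le> 4 * L x)" using contr by blast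
    then show ?thesis by (meson not_le)
  qed
  then obtain x t where x: "\<And>n. real n + 1 \<le> x n" and t: "\<And>n. t n \<in> {1..2}"
    and big: "\<And>n. 4 * L (x n) < L (t n * x n)" by metis
  define y where "y n = t n * x n" for n
  have x1: "1 \<le> x n" for n using x[of n] by linarith
  have xy: "x n \<le> y n" for n
    unfolding y_def using mult_right_mono[of 1 "t n" "x n"] t[of n] x1[of n] by simp
  have x_lim: "filterlim x at_top sequentially"
    by (rule filterlim_at_top_mono[OF filterlim_real_sequentially]) (use x in \<open>auto intro!: always_eventually less_imp_le simp: less_le_trans[OF _ x]\<close>)
  have y_lim: "filterlim y at_top sequentially"
    by (rule filterlim_at_top_mono[OF x_lim]) (use xy in auto)
  define L1 where "L1 s = indicator {1..} s * L s" for s :: real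
  have [measurable]: "L1 \<in> borel_measurable borel"
    using L unfolding L1_def slowly_varying_def set_borel_measurable_def by simp
  have L1: "L1 s = L s" if "1 \<le> s" for s using that by (simp add: L1_def)
  let ?B = "\<lambda>n s. 2 * L1 (x n) < L1 (s * x n)" and ?B' = "\<lambda>n r. 2 * L1 (r * y n) < L1 (y n)"
  have lim1: "(\<lambda>n. LINT s|lborel. indicator {2..6} s * of_bool (?B n s) :: real) \<longlonglongrightarrow> 0"
  proof (rule integral_indicator_of_bool_tendsto_0)
    fix s :: real assume s: "s \<in> {2..6}"
    have "\<forall>\<^sub>F n in sequentially. 1/2 * L (x n) < L (s * x n) \<and> 1/2 * L (s * x n) < L (x n)"
      by (rule slowly_varying_ratio[OF L x_lim]) (use s in auto)
    then show "\<forall>\<^sub>F n in sequentially. \<not> ?B n s"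
    proof eventually_elim
      case (elim n)
      have "1 \<le> s * x n" using mult_mono[of 1 s 1 "x n"] s x1[of n] by simp
      then show ?case using elim x1[of n] by (simp add: L1)
    qed
  qed measurable
  have lim2: "(\<lambda>n. LINT r|lborel. indicator {1..6} r * of_bool (?B' n r) :: real) \<longlonglongrightarrow> 0"
  proof (rule integral_indicator_of_bool_tendsto_0)
    fix s :: real assume s: "s \<in> {1..6}"
    have "\<forall>\<^sub>F n in sequentially. 1/2 * L (y n) < L (s * y n) \<and> 1/2 * L (s * y n) < L (y n)"
      by (rule slowly_varying_ratio[OF L y_lim]) (use s in auto)
    then show "\<forall>\<^sub>F n in sequentially. \<not> ?B' n s"
    proof eventually_elim
      case (elim n)
      have y1: "1 \<le> y n" using x1[of n] xy[of n] by linarith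
      then have "1 \<le> s * y n" using mult_mono[of 1 s 1 "y n"] s by simp
      then show ?case using elim y1 by (simp add: L1)
    qed
  qed measurable
  have "4 \<le> (LINT s|lborel. indicator {2..6} s * of_bool (?B n s)) + 2 * (LINT r|lborel. indicator {1..6} r * of_bool (?B' n r) :: real)" for n
  proof -
    let ?f = "\<lambda>s. indicator {2..6} s * of_bool (?B n s) :: real" and ?g = "\<lambda>r. indicator {1..6} r * of_bool (?B' n r) :: real"
    have tn: "1 \<le> t n" "t n \<le> 2" "0 < t n" using t[of n] by auto
    have fint: "integrable lborel ?f"
      by (rule Bochner_Integration.integrable_bound[of lborel "indicator {2..6}"])
         (auto simp: integrable_indicator_iff indicator_def)
    have gint: "integrable lborel ?g"
      by (rule Bochner_Integration.integrable_bound[of lborel "indicator {1..6}"])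
         (auto simp: integrable_indicator_iff indicator_def)
    \<comment> \<open>The factor \<open>s\<close> relative to \<open>x\<^sub>n\<close> is the factor \<open>s / t\<^sub>n\<close> relative to \<open>y\<^sub>n\<close>; it lies in \<open>[1, 6]\<close>.\<close>
    have gint': "integrable lborel (\<lambda>s. ?g (s / t n))"
      using lborel_integrable_real_affine[OF gint, of "1 / t n" 0] tn by simp
    have ptw: "indicator {2..6} s \<le> ?f s + ?g (s / t n)" for s :: real
    proof (cases "s \<in> {2..6} \<and> \<not> ?B n s")
      case True
      then have s: "2 \<le> s" "s \<le> 6" "L1 (s * x n) \<le> 2 * L1 (x n)" by auto
      have r: "s / t n \<in> {1..6}"
        using s tn mult_mono[of s 6 1 "t n"] by (auto simp: field_simps)
      have "s / t n * y n = s * x n" using tn by (simp add: y_def)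
      moreover have "L1 (x n) = L (x n)" "L1 (y n) = L (y n)"
        using x1[of n] xy[of n] by (auto intro!: L1)
      ultimately have "?B' n (s / t n)"
        using s(3) big[of n] by (simp add: y_def)
      then show ?thesis using r by (auto simp: indicator_def)
    qed (auto simp: indicator_def)
    have "4 = (LINT s|lborel. indicator {2..6::real} s :: real)" by simp
    also have "\<dots> \<le> (LINT s|lborel. ?f s + ?g (s / t n))"
      using fint gint' by (intro integral_mono ptw) (auto simp: integrable_indicator_iff)
    also have "\<dots> = (LINT s|lborel. ?f s) + (LINT s|lborel. ?g (s / t n))"
      using fint gint' by (rule Bochner_Integration.integral_add)
    also have "(LINT s|lborel. ?g (s / t n)) = t n * (LINT r|lborel. ?g r)"
      using lborel_integral_real_affine[of "1 / t n" ?g 0] tn by simp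
    also have "\<dots> \<le> 2 * (LINT r|lborel. ?g r)"
      using tn by (intro mult_right_mono integral_nonneg_AE) auto
    finally show ?thesis by simp
  qed
  moreover have "(\<lambda>n. (LINT s|lborel. indicator {2..6} s * of_bool (?B n s)) + 2 * (LINT r|lborel. indicator {1..6} r * of_bool (?B' n r) :: real)) \<longlonglongrightarrow> 0 + 2 * 0"
    by (intro tendsto_intros lim1 lim2)
  ultimately have "(4::real) \<le> 0 + 2 * 0" by (intro LIMSEQ_le_const) auto
  then show False by simp
qed

text \<open>
Doubling the argument eventually multiplies \<open>L\<close> by at most \<open>2\<^sup>\<delta>\<close>, and the local bound interpolates between powers
of two.
\<close>

lemma slowly_varying_growth_bound:
  assumes L: "slowly_varying L" and \<delta>: "0 < \<delta>"
  obtains x0 K where "1 \<le> x0" "0 < K" "\<And>x. x0 \<le> x \<Longrightarrow> L x \<le> K * x powr \<delta>"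
proof -
  obtain x1 where x1: "1 \<le> x1" "\<And>x t. x1 \<le> x \<Longrightarrow> t \<in> {1..2} \<Longrightarrow> L (t * x) \<le> 4 * L x"
    using slowly_varying_locally_bounded[OF L] by blast
  have pos: "\<And>x. 1 \<le> x \<Longrightarrow> 0 < L x" and lim: "((\<lambda>x. L (2 * x) / L x) \<longlongrightarrow> 1) at_top"
    using L by (auto simp: slowly_varying_def)
  have "1 < 2 powr \<delta>" using \<delta> by simp
  from order_tendstoD(2)[OF lim this]
  obtain x2 where x2: "\<And>x. x2 \<le> x \<Longrightarrow> L (2 * x) / L x < 2 powr \<delta>"
    by (auto simp: eventually_at_top_linorder)
  define x0 where "x0 = max x1 x2"
  have x0: "1 \<le> x0" using x1(1) by (simp add: x0_def)
  have L0: "0 < L x0" by (rule pos[OF x0])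
  have double: "L (2 * x) \<le> 2 powr \<delta> * L x" if "x0 \<le> x" for x
    using x2[of x] pos[of x] that x0 by (simp add: x0_def field_simps less_imp_le)
  have claim: "L x \<le> 4 * L x0 * (x / x0) powr \<delta>" if "x0 \<le> x" "x \<le> 2 ^ Suc k * x0" for k x
    using that
  proof (induction k arbitrary: x)
    case 0
    have "x / x0 \<in> {1..2}" using 0 x0 by (simp add: field_simps)
    then have "L (x / x0 * x0) \<le> 4 * L x0" by (intro x1(2)) (simp_all add: x0_def)
    also have "\<dots> \<le> 4 * L x0 * (x / x0) powr \<delta>"
    proof -
      have "1 \<le> (x / x0) powr \<delta>" using \<open>x / x0 \<in> {1..2}\<close> \<delta> by (intro ge_one_powr_ge_zero) auto
      then show ?thesis using L0 by simp
    qed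
    finally show ?case using x0 by simp
  next
    case (Suc k)
    show ?case
    proof (cases "x \<le> 2 ^ Suc k * x0")
      case True
      then show ?thesis using Suc by simp
    next
      case False
      have p: "(1::real) \<le> 2 ^ k" by simp
      have "2 * x0 \<le> 2 ^ Suc k * x0" using mult_right_mono[OF p, of "2 * x0"] x0 by simp
      then have h: "x0 \<le> x / 2" "x / 2 \<le> 2 ^ Suc k * x0" using False Suc.prems by auto
      have "L x \<le> 2 powr \<delta> * L (x / 2)" using double[OF h(1)] by simp
      also have "\<dots> \<le> 2 powr \<delta> * (4 * L x0 * (x / 2 / x0) powr \<delta>)"
        by (intro mult_left_mono Suc.IH h) auto
      also have "\<dots> = 4 * L x0 * (2 powr \<delta> * (x / 2 / x0) powr \<delta>)" by simp
      also have "2 powr \<delta> * (x / 2 / x0) powr \<delta> = (x / x0) powr \<delta>"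
        using x0 h by (subst powr_mult[symmetric]) auto
      finally show ?thesis .
    qed
  qed
  have "L x \<le> 4 * L x0 * x powr \<delta>" if x: "x0 \<le> x" for x
  proof -
    obtain k where "x / x0 < 2 ^ k" using real_arch_pow[of 2 "x / x0"] by auto
    then have "x \<le> 2 ^ Suc k * x0" using x0 x by (simp add: field_simps)
    from claim[OF x this] have "L x \<le> 4 * L x0 * (x / x0) powr \<delta>" .
    also have "\<dots> \<le> 4 * L x0 * x powr \<delta>"
    proof -
      have "x / x0 \<le> x" using x0 x by (simp add: field_simps)
      then show ?thesis using x0 x L0 \<delta> by (intro mult_left_mono powr_mono2) auto
    qed
    finally show ?thesis .
  qed
  then show ?thesis using that[of x0 "4 * L x0"] x0 L0 by auto
qed

lemma slowly_varying_subpolynomial: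
  assumes L: "slowly_varying L" and \<delta>: "0 < \<delta>"
  shows "(\<lambda>n. L (real n) * real n powr (- \<delta>)) \<longlonglongrightarrow> 0"
proof -
  obtain x0 K where K: "1 \<le> x0" "0 < K" "\<And>x. x0 \<le> x \<Longrightarrow> L x \<le> K * x powr (\<delta> / 2)"
    using slowly_varying_growth_bound[OF L half_gt_zero[OF \<delta>]] by metis
  have ev: "\<forall>\<^sub>F n in sequentially. x0 \<le> real n"
    using filterlim_real_sequentially by (simp add: filterlim_at_top)
  show ?thesis
  proof (rule tendsto_sandwich[OF _ _ tendsto_const])
    show "\<forall>\<^sub>F n in sequentially. 0 \<le> L (real n) * real n powr (- \<delta>)"
      using ev
    proof eventually_elim
      case (elim n)
      then have "0 < L (real n)" using L K(1) by (simp add: slowly_varying_def)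
      then show ?case by simp
    qed
    show "\<forall>\<^sub>F n in sequentially. L (real n) * real n powr (- \<delta>) \<le> K * real n powr (- (\<delta> / 2))"
      using ev
    proof eventually_elim
      case (elim n)
      have "L (real n) * real n powr (- \<delta>) \<le> K * real n powr (\<delta> / 2) * real n powr (- \<delta>)"
        by (intro mult_right_mono K(3) elim) simp
      also have "\<dots> = K * real n powr (- (\<delta> / 2))"
        by (simp add: mult.assoc flip: powr_add)
      finally show ?case .
    qed
    have "(\<lambda>n. real n powr (- (\<delta> / 2))) \<longlonglongrightarrow> 0"
      using \<delta> by (intro tendsto_neg_powr filterlim_real_sequentially) auto
    then show "(\<lambda>n. K * real n powr (- (\<delta> / 2))) \<longlonglongrightarrow> 0"
      by (rule tendsto_mult_right_zero)
  qed
qed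

section \<open>Convergence rates\<close>

lemma asymp_equiv_eventually_bounds:
  fixes f g :: "nat \<Rightarrow> real"
  assumes eq: "f \<sim>[sequentially] g" and pos: "\<forall>\<^sub>F n in sequentially. 0 < g n"
  shows "\<forall>\<^sub>F n in sequentially. g n / 2 \<le> f n \<and> f n \<le> 2 * g n"
proof -
  have lim: "(\<lambda>n. if f n = 0 \<and> g n = 0 then 1 else f n / g n) \<longlonglongrightarrow> 1"
    using asymp_equivD[OF eq] .
  have "(1::real) / 2 < 1" "(1::real) < 2" by simp_all
  from order_tendstoD(1)[OF lim this(1)] order_tendstoD(2)[OF lim this(2)] pos
  show ?thesis
    by eventually_elim (auto simp: field_simps)
qed

context two_sample_sequence
begin

lemma ball_vol_\<epsilon>: "1 \<le> n \<Longrightarrow> ball_vol TYPE('a) (\<epsilon> n) = unit_ball_vol (real DIM('a)) * \<epsilon> n ^ DIM('a)"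
  using \<epsilon>_pos[of n] by (simp add: ball_vol_eq)

lemma eventually_mse_le: "\<forall>\<^sub>F n in sequentially. mse I \<epsilon> n \<le> 6 * avg_mse n + 3 * rem_mse I \<epsilon> n"
  using eventually_mse_expansion
proof eventually_elim
  case (elim n)
  then have "\<bar>mse I \<epsilon> n - 4 * avg_mse n\<bar> \<le> rem_mse I \<epsilon> n + 2 * (1 * avg_mse n + rem_mse I \<epsilon> n / 1)"
    by (elim allE[of _ 1]) simp
  then show ?case by simp
qed

lemma mse_nonneg: "0 \<le> mse I \<epsilon> n"
  unfolding mse_def by (simp add: integral_nonneg_AE)

lemma bias_tendsto: "(\<lambda>n. (qe (\<epsilon> n) - q)^2) \<longlonglongrightarrow> 0"
proof (rule order_tendstoI)
  fix a :: real assume "a < 0"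
  then show "\<forall>\<^sub>F n in sequentially. a < (qe (\<epsilon> n) - q)^2"
    by (intro always_eventually allI less_le_trans[OF _ zero_le_power2])
next
  fix a :: real assume "0 < a"
  then have "0 < a / 2" by simp
  from eventually_bias_le[OF this]
  show "\<forall>\<^sub>F n in sequentially. (qe (\<epsilon> n) - q)^2 < a"
    by eventually_elim (use \<open>0 < a\<close> in linarith)
qed

lemma avg_mse_tendsto: "avg_mse \<longlonglongrightarrow> 0"
proof (rule tendsto_sandwich[OF _ _ tendsto_const])
  show "\<forall>\<^sub>F n in sequentially. 0 \<le> avg_mse n" by (simp add: avg_mse_nonneg)
  show "\<forall>\<^sub>F n in sequentially. avg_mse n \<le> real (2 * m + 1) * expectation (\<lambda>w. (score (X 1 w, Y 1 w))^2) / real n"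
    using eventually_gt_at_top[of 0] by eventually_elim (rule avg_mse_le)
qed (rule lim_const_over_n)

lemma mse_tendsto_zero:
  assumes lim: "filterlim (\<lambda>n. (real n)^2 * \<epsilon> n ^ DIM('a)) at_top sequentially"
  shows "mse I \<epsilon> \<longlonglongrightarrow> 0"
proof (rule tendsto_sandwich[OF _ eventually_mse_le tendsto_const])
  let ?V = "unit_ball_vol (real DIM('a))"
  let ?bound = "\<lambda>n. 3 * ((remainder_const / ?V) / ((real n)^2 * \<epsilon> n ^ DIM('a)) + 4 * real (2 * m + 1) * 1 / real n + (qe (\<epsilon> n) - q)^2)"
  show "\<forall>\<^sub>F n in sequentially. 0 \<le> mse I \<epsilon> n" by (simp add: mse_nonneg)
  have "(\<lambda>n. (remainder_const / ?V) / ((real n)^2 * \<epsilon> n ^ DIM('a))) \<longlonglongrightarrow> 0"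
    by (rule real_tendsto_divide_at_top[OF tendsto_const lim])
  then have "?bound
      \<longlonglongrightarrow> 3 * (0 + 0 + 0)"
    by (intro tendsto_intros bias_tendsto lim_const_over_n)
  then have lim0: "?bound
      \<longlonglongrightarrow> 0" by simp
  have "rem_mse I \<epsilon> \<longlonglongrightarrow> 0"
  proof (rule tendsto_sandwich[OF _ _ tendsto_const lim0])
    show "\<forall>\<^sub>F n in sequentially. 0 \<le> rem_mse I \<epsilon> n" by (simp add: rem_mse_nonneg)
    show "\<forall>\<^sub>F n in sequentially. rem_mse I \<epsilon> n \<le> ?bound n"
      using eventually_rem_mse_le[OF zero_less_one] eventually_ge_at_top[of 1]
      by eventually_elim (simp add: ball_vol_\<epsilon> mult_ac)
  qed
  from tendsto_add[OF tendsto_mult_right_zero[OF avg_mse_tendsto, of 6] tendsto_mult_right_zero[OF this, of 3]]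
  show "(\<lambda>n. 6 * avg_mse n + 3 * rem_mse I \<epsilon> n) \<longlonglongrightarrow> 0" by simp
qed

lemma H2_class_translate_le:
  assumes p: "p \<in> H2_class \<alpha> K" and "0 < \<alpha>" "0 < K" "e \<le> 1" "norm u \<le> e"
  shows "(LINT x|lborel. (p (x - u) - p x)^2) \<le> (K * e powr \<alpha>)^2"
proof -
  let ?S = "LINT x|lborel. (p (x - u) - p x)^2"
  have "u \<in> cball 0 1" using assms by simp
  then have "sqrt ?S \<le> K * norm u powr \<alpha>" using p by (simp add: H2_class_def)
  also have "\<dots> \<le> K * e powr \<alpha>" using assms by (intro mult_left_mono powr_mono2) auto
  finally have "(sqrt ?S)^2 \<le> (K * e powr \<alpha>)^2" by (intro power_mono) (auto simp: integral_nonneg_AE)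
  then show ?thesis by (simp add: integral_nonneg_AE)
qed

lemma eventually_H2_bias_le:
  assumes "pX \<in> H2_class \<alpha> K" "pY \<in> H2_class \<alpha> K" "0 < \<alpha>" "0 < K"
  shows "\<forall>\<^sub>F n in sequentially. (qe (\<epsilon> n) - q)^2 \<le> K ^ 4 * \<epsilon> n powr (4 * \<alpha>)"
proof -
  have "\<forall>\<^sub>F n in sequentially. \<epsilon> n < 1" by (rule order_tendstoD(2)[OF \<epsilon>_lim]) simp
  then show ?thesis using eventually_ge_at_top[of 1]
  proof eventually_elim
    case (elim n)
    have e: "0 < \<epsilon> n" "\<epsilon> n \<le> 1" using elim \<epsilon>_pos by auto
    have "\<bar>qe (\<epsilon> n) - q\<bar> \<le> (K * \<epsilon> n powr \<alpha>)^2"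
      unfolding qe_def q_def
      by (rule smooth_bias_le[OF e(1) pX pY]) (rule H2_class_translate_le[OF _ assms(3,4) e(2)], use assms in auto)+
    then have "\<bar>qe (\<epsilon> n) - q\<bar>^2 \<le> ((K * \<epsilon> n powr \<alpha>)^2)^2" by (intro power_mono) auto
    also have "\<dots> = K ^ 4 * (\<epsilon> n powr \<alpha>) ^ 4" by (simp add: power_mult_distrib flip: power_mult)
    also have "(\<epsilon> n powr \<alpha>) ^ 4 = \<epsilon> n powr (4 * \<alpha>)" using e(1) by (simp add: powr_power mult.commute)
    finally show ?case by simp
  qed
qed

text \<open>
With \<open>\<epsilon>\<close> of order \<open>n\<close> to the power \<open>-2 / (4 \<alpha> + d)\<close> the terms \<open>1 / (n\<^sup>2 \<epsilon>\<^sup>d)\<close> and \<open>\<epsilon>\<^sup>4\<^sup>\<alpha>\<close> are balanced; the condition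
\<open>\<alpha> \<le> d / 4\<close> says that they dominate \<open>1 / n\<close>.
\<close>

lemma mse_bigo:
  assumes H2: "pX \<in> H2_class \<alpha> K" "pY \<in> H2_class \<alpha> K" "0 < \<alpha>" "0 < K"
    and \<alpha>: "\<alpha> \<le> real DIM('a) / 4" and c: "0 < c"
    and \<epsilon>: "\<epsilon> \<sim>[sequentially] (\<lambda>n. c * real n powr (- 2 / (4 * \<alpha> + real DIM('a))))"
  shows "mse I \<epsilon> \<in> O(\<lambda>n. real n powr (- 8 * \<alpha> / (4 * \<alpha> + real DIM('a))))"
proof -
  let ?d = "DIM('a)"
  let ?V = "unit_ball_vol (real DIM('a))"
  define p where "p = 4 * \<alpha> + real ?d"
  define r where "r = - 8 * \<alpha> / p"
  have p: "0 < p" using \<open>0 < \<alpha>\<close> by (simp add: p_def)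
  have r1: "- 1 \<le> r" using \<alpha> p by (simp add: r_def p_def field_simps)
  have r2: "2 - 2 * real ?d / p = - r" using p by (simp add: r_def p_def field_simps)
  have "\<forall>\<^sub>F n in sequentially. 0 < c * real n powr (- 2 / p)"
    using eventually_gt_at_top[of 0] by eventually_elim (use c in simp)
  then have bds: "\<forall>\<^sub>F n in sequentially. c * real n powr (- 2 / p) / 2 \<le> \<epsilon> n \<and> \<epsilon> n \<le> 2 * (c * real n powr (- 2 / p))"
    using asymp_equiv_eventually_bounds[OF \<epsilon>] by (simp add: p_def)
  define E where "E = expectation (\<lambda>w. (score (X 1 w, Y 1 w))^2)"
  have E: "0 \<le> E" unfolding E_def by (simp add: integral_nonneg_AE)
  define B where "B = 6 * real (2 * m + 1) * E + 9 * (remainder_const / (?V * (c / 2) ^ ?d)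
      + 4 * real (2 * m + 1) + K ^ 4 * (2 * c) powr (4 * \<alpha>))"
  have "\<forall>\<^sub>F n in sequentially. norm (mse I \<epsilon> n) \<le> B * norm (real n powr r)"
    using eventually_mse_le eventually_rem_mse_le[OF zero_less_one] eventually_H2_bias_le[OF H2] bds eventually_ge_at_top[of 1]
  proof eventually_elim
    case (elim n)
    have n: "0 < n" "0 < real n" "1 \<le> real n" using elim(5) by auto
    have inv: "1 / real n \<le> real n powr r"
      using powr_mono[OF r1 n(3)] n by (simp add: powr_minus_divide)
    have "avg_mse n \<le> real (2 * m + 1) * E / real n" unfolding E_def by (rule avg_mse_le[OF n(1)])
    also have "\<dots> = real (2 * m + 1) * E * (1 / real n)" by simp
    also have "\<dots> \<le> real (2 * m + 1) * E * real n powr r" using E inv by (intro mult_left_mono) auto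
    finally have avg: "avg_mse n \<le> real (2 * m + 1) * E * real n powr r" .
    have vol: "?V * (c / 2) ^ ?d * real n powr (- r) \<le> (real n)^2 * ball_vol TYPE('a) (\<epsilon> n)"
    proof -
      have "(c * real n powr (- 2 / p) / 2) ^ ?d \<le> \<epsilon> n ^ ?d" using elim(4) c by (intro power_mono) auto
      moreover have "(c * real n powr (- 2 / p) / 2) ^ ?d = (c / 2) ^ ?d * real n powr (- 2 / p * real ?d)"
        using n by (simp add: power_mult_distrib power_divide powr_power mult.commute)
      ultimately have le: "(real n)^2 * (?V * ((c / 2) ^ ?d * real n powr (- 2 / p * real ?d))) \<le> (real n)^2 * (?V * \<epsilon> n ^ ?d)"
        by (intro mult_left_mono) auto
      have eqn: "(real n)^2 * real n powr (- 2 / p * real ?d) = real n powr (- r)"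
      proof -
        have "(real n)^2 * real n powr (- 2 / p * real ?d) = real n powr 2 * real n powr (- 2 / p * real ?d)"
          using n by (simp add: powr_numeral)
        also have "\<dots> = real n powr (2 + - 2 / p * real ?d)" by (rule powr_add[symmetric])
        also have "2 + - 2 / p * real ?d = - r" using r2 by simp
        finally show ?thesis .
      qed
      have "?V * (c / 2) ^ ?d * real n powr (- r) = (real n)^2 * (?V * ((c / 2) ^ ?d * real n powr (- 2 / p * real ?d)))"
        by (simp only: eqn[symmetric] mult_ac)
      also note le
      also have "(real n)^2 * (?V * \<epsilon> n ^ ?d) = (real n)^2 * ball_vol TYPE('a) (\<epsilon> n)"
        using ball_vol_\<epsilon>[OF elim(5)] by simp
      finally show ?thesis .
    qed
    have "remainder_const / ((real n)^2 * ball_vol TYPE('a) (\<epsilon> n)) \<le> remainder_const / (?V * (c / 2) ^ ?d * real n powr (- r))"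
      using vol c n remainder_const_nonneg \<epsilon>_pos[OF elim(5)]
      by (intro divide_left_mono mult_pos_pos) (auto simp: ball_vol_pos)
    also have "\<dots> = remainder_const / (?V * (c / 2) ^ ?d) * real n powr r"
      by (simp add: powr_minus_divide)
    finally have t1: "remainder_const / ((real n)^2 * ball_vol TYPE('a) (\<epsilon> n)) \<le> remainder_const / (?V * (c / 2) ^ ?d) * real n powr r" .
    have "\<epsilon> n powr (4 * \<alpha>) \<le> (2 * c * real n powr (- 2 / p)) powr (4 * \<alpha>)"
      using elim(4) \<epsilon>_pos[OF elim(5)] \<open>0 < \<alpha>\<close> by (intro powr_mono2) auto
    also have "\<dots> = (2 * c) powr (4 * \<alpha>) * real n powr r"
      using c by (simp add: powr_mult powr_powr r_def)
    finally have "K ^ 4 * \<epsilon> n powr (4 * \<alpha>) \<le> K ^ 4 * ((2 * c) powr (4 * \<alpha>) * real n powr r)"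
      using \<open>0 < K\<close> by (intro mult_left_mono) auto
    then have t3: "(qe (\<epsilon> n) - q)^2 \<le> K ^ 4 * (2 * c) powr (4 * \<alpha>) * real n powr r"
      using elim(3) by (simp add: mult.assoc)
    have t2: "4 * real (2 * m + 1) * 1 / real n \<le> 4 * real (2 * m + 1) * real n powr r"
      using mult_left_mono[OF inv, of "4 * real (2 * m + 1)"] by simp
    have "rem_mse I \<epsilon> n \<le> 3 * (remainder_const / (?V * (c / 2) ^ ?d) * real n powr r
        + 4 * real (2 * m + 1) * real n powr r + K ^ 4 * (2 * c) powr (4 * \<alpha>) * real n powr r)"
      using elim(2) by (rule order_trans) (intro mult_left_mono add_mono t1 t2 t3, simp)
    then have "6 * avg_mse n + 3 * rem_mse I \<epsilon> n \<le> 6 * (real (2 * m + 1) * E * real n powr r)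
        + 3 * (3 * (remainder_const / (?V * (c / 2) ^ ?d) * real n powr r
        + 4 * real (2 * m + 1) * real n powr r + K ^ 4 * (2 * c) powr (4 * \<alpha>) * real n powr r))"
      by (intro add_mono mult_left_mono avg) auto
    also have "\<dots> = B * real n powr r" unfolding B_def by (simp add: algebra_simps)
    finally show ?case using elim(1) mse_nonneg[of n] by simp
  qed
  then show ?thesis unfolding r_def p_def by (rule bigoI)
qed

text \<open>
After multiplication by \<open>n\<close> the mixed term is bounded by \<open>2 s n E A\<^sub>n\<^sup>2\<close> up to a null sequence, for every \<open>s > 0\<close>.
\<close>

lemma expansion_from_negligible_remainder:
  assumes rem: "(\<lambda>n. real n * rem_mse I \<epsilon> n) \<longlonglongrightarrow> 0"
  shows "(\<lambda>n. mse I \<epsilon> n - 4 * score_variance / real n) \<in> o(\<lambda>n. 1 / real n)"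
proof -
  have main: "(\<lambda>n. real n * (mse I \<epsilon> n - 4 * avg_mse n)) \<longlonglongrightarrow> 0"
  proof (rule LIMSEQ_I)
    fix \<delta> :: real assume \<delta>: "0 < \<delta>"
    define S where "S = \<bar>score_variance\<bar> + 1"
    have S: "0 < S" "score_variance < S" by (auto simp: S_def)
    define s where "s = \<delta> / (4 * S)"
    have s: "0 < s" using S \<delta> by (simp add: s_def)
    have "\<forall>\<^sub>F n in sequentially. real n * avg_mse n < S"
      by (rule order_tendstoD(2)[OF avg_mse_limit S(2)])
    moreover have "\<forall>\<^sub>F n in sequentially. (1 + 2 / s) * (real n * rem_mse I \<epsilon> n) < \<delta> / 2"
      by (rule order_tendstoD(2)[OF tendsto_mult_right_zero[OF rem]]) (use \<delta> in simp)
    ultimately have "\<forall>\<^sub>F n in sequentially. norm (real n * (mse I \<epsilon> n - 4 * avg_mse n) - 0) < \<delta>"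
      using eventually_mse_expansion
    proof eventually_elim
      case (elim n)
      have "norm (real n * (mse I \<epsilon> n - 4 * avg_mse n) - 0) = real n * \<bar>mse I \<epsilon> n - 4 * avg_mse n\<bar>"
        by (simp add: abs_mult)
      also have "\<dots> \<le> real n * (rem_mse I \<epsilon> n + 2 * (s * avg_mse n + rem_mse I \<epsilon> n / s))"
        using elim(3) s by (intro mult_left_mono) auto
      also have "\<dots> = (1 + 2 / s) * (real n * rem_mse I \<epsilon> n) + 2 * s * (real n * avg_mse n)"
        by (simp add: algebra_simps)
      also have "\<dots> < \<delta> / 2 + 2 * s * S"
        using elim(1,2) s by (intro add_strict_mono mult_strict_left_mono) auto
      also have "\<dots> = \<delta>" using S by (simp add: s_def)
      finally show ?case .
    qed
    then show "\<exists>no. \<forall>n\<ge>no. norm (real n * (mse I \<epsilon> n - 4 * avg_mse n) - 0) < \<delta>"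
      by (simp add: eventually_sequentially)
  qed
  have "(\<lambda>n. real n * (mse I \<epsilon> n - 4 * avg_mse n) + 4 * (real n * avg_mse n - score_variance)) \<longlonglongrightarrow> 0 + 4 * (score_variance - score_variance)"
    by (intro tendsto_intros main avg_mse_limit)
  then have "(\<lambda>n. real n * (mse I \<epsilon> n - 4 * avg_mse n) + 4 * (real n * avg_mse n - score_variance)) \<longlonglongrightarrow> 0" by simp
  moreover have "\<forall>\<^sub>F n in sequentially. real n * (mse I \<epsilon> n - 4 * avg_mse n) + 4 * (real n * avg_mse n - score_variance)
      = (mse I \<epsilon> n - 4 * score_variance / real n) / (1 / real n)"
    using eventually_gt_at_top[of 0] by eventually_elim (simp add: field_simps)
  ultimately have "(\<lambda>n. (mse I \<epsilon> n - 4 * score_variance / real n) / (1 / real n)) \<longlonglongrightarrow> 0"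
    by (rule Lim_transform_eventually)
  then show ?thesis
    by (rule smalloI_tendsto) (use eventually_gt_at_top[of 0] in \<open>eventually_elim, simp\<close>)
qed

text \<open>
Here \<open>1 / (n\<^sup>2 \<epsilon>\<^sup>d)\<close> is of order \<open>1 / (n L(n)\<^sup>d)\<close>, and \<open>n \<epsilon>\<^sup>4\<^sup>\<alpha>\<close> is of order \<open>L(n)\<^sup>4\<^sup>\<alpha>\<close> times \<open>n\<close> to the negative
power \<open>1 - 4 \<alpha> / d\<close>.
\<close>

lemma mse_expansion:
  assumes H2: "pX \<in> H2_class \<alpha> K" "pY \<in> H2_class \<alpha> K" "0 < \<alpha>" "0 < K"
    and \<alpha>: "\<alpha> > real DIM('a) / 4" and L: "slowly_varying L"
    and L_lim: "filterlim (\<lambda>n. L (real n)) at_top sequentially"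
    and \<epsilon>: "\<epsilon> \<sim>[sequentially] (\<lambda>n. L (real n) * real n powr (- 1 / real DIM('a)))"
  shows "(\<lambda>n. mse I \<epsilon> n - 4 * score_variance / real n) \<in> o(\<lambda>n. 1 / real n)"
proof (rule expansion_from_negligible_remainder)
  let ?d = "DIM('a)"
  let ?V = "unit_ball_vol (real DIM('a))"
  have L_pos: "0 < L (real n)" if "1 \<le> n" for n using L that by (simp add: slowly_varying_def)
  have d: "0 < real ?d" by simp
  have "\<forall>\<^sub>F n in sequentially. 0 < L (real n) * real n powr (- 1 / real ?d)"
    using eventually_ge_at_top[of 1] by eventually_elim (use L_pos in simp)
  from asymp_equiv_eventually_bounds[OF \<epsilon> this]
  have bds: "\<forall>\<^sub>F n in sequentially. L (real n) * real n powr (- 1 / real ?d) / 2 \<le> \<epsilon> n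
      \<and> \<epsilon> n \<le> 2 * (L (real n) * real n powr (- 1 / real ?d))" .
  \<comment> \<open>Chosen such that \<open>- 4 \<alpha> \<delta>\<close> is this power.\<close>
  define \<delta> where "\<delta> = (4 * \<alpha> / real ?d - 1) / (4 * \<alpha>)"
  have \<delta>: "0 < \<delta>" using \<alpha> \<open>0 < \<alpha>\<close> d by (simp add: \<delta>_def field_simps)
  have Ld: "filterlim (\<lambda>n. L (real n) ^ ?d) at_top sequentially"
    by (rule filterlim_compose[OF filterlim_pow_at_top[OF DIM_positive filterlim_ident] L_lim])
  have lim1: "(\<lambda>n. (remainder_const / (?V * (1 / 2) ^ ?d)) / L (real n) ^ ?d) \<longlonglongrightarrow> 0"
    by (rule real_tendsto_divide_at_top[OF tendsto_const Ld])
  have "(\<lambda>n. (L (real n) * real n powr (- \<delta>)) powr (4 * \<alpha>)) \<longlonglongrightarrow> 0"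
  proof (rule tendsto_zero_powrI[OF slowly_varying_subpolynomial[OF L \<delta>] tendsto_const])
    show "\<forall>\<^sub>F n in sequentially. 0 \<le> L (real n) * real n powr (- \<delta>)"
      using eventually_ge_at_top[of 1] by eventually_elim (use L_pos in \<open>simp add: less_imp_le\<close>)
  qed (use \<open>0 < \<alpha>\<close> in simp)
  then have lim3: "(\<lambda>n. K ^ 4 * 2 powr (4 * \<alpha>) * (L (real n) * real n powr (- \<delta>)) powr (4 * \<alpha>)) \<longlonglongrightarrow> 0"
    by (rule tendsto_mult_right_zero)
  let ?bound = "\<lambda>\<eta> n. 3 * ((remainder_const / (?V * (1 / 2) ^ ?d)) / L (real n) ^ ?d
      + 4 * real (2 * m + 1) * \<eta> + K ^ 4 * 2 powr (4 * \<alpha>) * (L (real n) * real n powr (- \<delta>)) powr (4 * \<alpha>))"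
  have le: "\<forall>\<^sub>F n in sequentially. real n * rem_mse I \<epsilon> n \<le> ?bound \<eta> n"
    if \<eta>: "0 < \<eta>" for \<eta>
    using eventually_rem_mse_le[OF \<eta>] eventually_H2_bias_le[OF H2] bds eventually_ge_at_top[of 1]
  proof eventually_elim
    case (elim n)
    have n: "0 < real n" using elim(4) by simp
    have Ln: "0 < L (real n)" by (rule L_pos[OF elim(4)])
    have "?V * (1 / 2) ^ ?d * L (real n) ^ ?d \<le> real n * ball_vol TYPE('a) (\<epsilon> n)"
    proof -
      have "(L (real n) * real n powr (- 1 / real ?d) / 2) ^ ?d \<le> \<epsilon> n ^ ?d"
        using elim(3) Ln by (intro power_mono) auto
      moreover have "(L (real n) * real n powr (- 1 / real ?d) / 2) ^ ?d = (1 / 2) ^ ?d * L (real n) ^ ?d * (1 / real n)"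
        using n by (simp add: power_mult_distrib power_divide powr_power powr_minus_divide)
      ultimately have "real n * (?V * ((1 / 2) ^ ?d * L (real n) ^ ?d * (1 / real n))) \<le> real n * (?V * \<epsilon> n ^ ?d)"
        using n by (intro mult_left_mono) auto
      then show ?thesis using n ball_vol_\<epsilon>[OF elim(4)] by (simp add: mult_ac)
    qed
    then have "remainder_const / (real n * ball_vol TYPE('a) (\<epsilon> n)) \<le> remainder_const / (?V * (1 / 2) ^ ?d * L (real n) ^ ?d)"
      using Ln n remainder_const_nonneg \<epsilon>_pos[OF elim(4)]
      by (intro divide_left_mono mult_pos_pos) (auto simp: ball_vol_pos)
    then have t1: "remainder_const / (real n * ball_vol TYPE('a) (\<epsilon> n)) \<le> (remainder_const / (?V * (1 / 2) ^ ?d)) / L (real n) ^ ?d"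
      by simp
    have "\<epsilon> n powr (4 * \<alpha>) \<le> (2 * (L (real n) * real n powr (- 1 / real ?d))) powr (4 * \<alpha>)"
      using elim(3) \<epsilon>_pos[OF elim(4)] \<open>0 < \<alpha>\<close> by (intro powr_mono2) auto
    then have "real n * (K ^ 4 * \<epsilon> n powr (4 * \<alpha>))
        \<le> real n * (K ^ 4 * (2 * (L (real n) * real n powr (- 1 / real ?d))) powr (4 * \<alpha>))"
      using n \<open>0 < K\<close> by (intro mult_left_mono) auto
    also have "\<dots> = K ^ 4 * 2 powr (4 * \<alpha>) * (L (real n) powr (4 * \<alpha>) * (real n * real n powr (- 4 * \<alpha> / real ?d)))"
      using Ln n by (simp add: powr_mult powr_powr)
    also have "real n * real n powr (- 4 * \<alpha> / real ?d) = (real n powr (- \<delta>)) powr (4 * \<alpha>)"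
    proof -
      have "real n * real n powr (- 4 * \<alpha> / real ?d) = real n powr (1 + (- 4 * \<alpha> / real ?d))"
        using n by (subst powr_add) simp
      also have "1 + (- 4 * \<alpha> / real ?d) = - \<delta> * (4 * \<alpha>)" using \<open>0 < \<alpha>\<close> by (simp add: \<delta>_def)
      finally show ?thesis by (simp add: powr_powr)
    qed
    also have "L (real n) powr (4 * \<alpha>) * (real n powr (- \<delta>)) powr (4 * \<alpha>) = (L (real n) * real n powr (- \<delta>)) powr (4 * \<alpha>)"
      using Ln by (simp add: powr_mult)
    finally have "real n * (K ^ 4 * \<epsilon> n powr (4 * \<alpha>)) \<le> K ^ 4 * 2 powr (4 * \<alpha>) * (L (real n) * real n powr (- \<delta>)) powr (4 * \<alpha>)" .
    moreover have "real n * (qe (\<epsilon> n) - q)^2 \<le> real n * (K ^ 4 * \<epsilon> n powr (4 * \<alpha>))"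
      using elim(2) n by (intro mult_left_mono) auto
    ultimately have t3: "real n * (qe (\<epsilon> n) - q)^2 \<le> K ^ 4 * 2 powr (4 * \<alpha>) * (L (real n) * real n powr (- \<delta>)) powr (4 * \<alpha>)"
      by (rule order_trans[rotated])
    have "real n * rem_mse I \<epsilon> n \<le> real n * (3 * (remainder_const / ((real n)^2 * ball_vol TYPE('a) (\<epsilon> n))
            + 4 * real (2 * m + 1) * \<eta> / real n + (qe (\<epsilon> n) - q)^2))"
      using elim(1) n by (intro mult_left_mono) auto
    also have "\<dots> = 3 * (remainder_const / (real n * ball_vol TYPE('a) (\<epsilon> n))
            + 4 * real (2 * m + 1) * \<eta> + real n * (qe (\<epsilon> n) - q)^2)"
      using n by (simp add: distrib_left power2_eq_square)
    also have "\<dots> \<le> ?bound \<eta> n"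
      by (intro mult_left_mono add_mono t1 t3 order_refl) auto
    finally show ?case .
  qed
  show "(\<lambda>n. real n * rem_mse I \<epsilon> n) \<longlonglongrightarrow> 0"
  proof (rule order_tendstoI)
    fix a :: real assume "a < 0"
    then show "\<forall>\<^sub>F n in sequentially. a < real n * rem_mse I \<epsilon> n"
      by (intro always_eventually allI less_le_trans[OF _ mult_nonneg_nonneg[OF of_nat_0_le_iff rem_mse_nonneg]])
  next
    fix a :: real assume a: "0 < a"
    define \<eta> where "\<eta> = a / (24 * real (2 * m + 1))"
    have \<eta>: "0 < \<eta>" using a by (simp add: \<eta>_def)
    have "?bound \<eta>
      \<longlonglongrightarrow> 3 * (0 + 4 * real (2 * m + 1) * \<eta> + 0)"
      by (intro tendsto_intros lim1 lim3)
    moreover have frac: "3 * (0 + 4 * c * (a / (24 * c)) + 0) = a / 2" if "0 < c" for c :: real using that by simp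
    have "3 * (0 + 4 * real (2 * m + 1) * \<eta> + 0) = a / 2" unfolding \<eta>_def by (rule frac) simp
    then have "3 * (0 + 4 * real (2 * m + 1) * \<eta> + 0) < a" using a by simp
    ultimately have "\<forall>\<^sub>F n in sequentially. ?bound \<eta> n < a"
      by (rule order_tendstoD(2))
    then show "\<forall>\<^sub>F n in sequentially. real n * rem_mse I \<epsilon> n < a"
      using le[OF \<eta>] by eventually_elim simp
  qed
qed

end

section \<open>The two estimators\<close>

lemma has_bounded_density_ball:
  fixes U :: "'w \<Rightarrow> 'a::euclidean_space"
  assumes "prob_space M" and dens: "has_bounded_density M U"
  shows "\<exists>C\<ge>0. \<forall>e>0. measure M {w \<in> space M. norm (U w) \<le> e} \<le> C * ball_vol TYPE('a) e"
proof -
  interpret prob_space M by fact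
  obtain p where p: "\<And>x. 0 \<le> p x" and D: "distributed M lborel U (\<lambda>x. ennreal (p x))" and "bounded (range p)"
    using dens by (auto simp: has_bounded_density_def has_density_def)
  then obtain B where B: "\<And>x. \<bar>p x\<bar> \<le> B" by (auto simp: bounded_iff)
  have B0: "0 \<le> B" using B[of undefined] by linarith
  have U[measurable]: "U \<in> borel_measurable M" using distributed_measurable[OF D] by simp
  have "measure M {w \<in> space M. norm (U w) \<le> e} \<le> B * ball_vol TYPE('a) e" if "0 < e" for e
  proof -
    have b: "0 \<le> ball_vol TYPE('a) e" by (simp add: ball_vol_def)
    have "emeasure M {w \<in> space M. norm (U w) \<le> e} = emeasure M (U -` cball 0 e \<inter> space M)"
      by (rule arg_cong[where f="emeasure M"]) auto
    also have "\<dots> = (\<integral>\<^sup>+x. ennreal (p x) * indicator (cball 0 e) x \<partial>lborel)"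
      by (rule distributed_emeasure[OF D]) simp
    also have "\<dots> \<le> (\<integral>\<^sup>+x. ennreal B * indicator (cball (0::'a) e) x \<partial>lborel)"
      using B by (intro nn_integral_mono mult_right_mono ennreal_leI) (auto intro: order_trans[OF abs_ge_self])
    also have "\<dots> = ennreal (B * ball_vol TYPE('a) e)"
      using B0 b by (simp add: nn_integral_cmult_indicator emeasure_cball_ball_vol ennreal_mult)
    finally show ?thesis
      using B0 b by (simp add: emeasure_eq_measure)
  qed
  then show ?thesis using B0 by blast
qed

lemma sets_dist_fst_snd_le:
  "{z :: ('a::euclidean_space \<times> 'a) \<times> 'a \<times> 'a. dist (fst (fst z)) (snd (snd z)) \<le> e} \<in> sets (borel \<Otimes>\<^sub>M borel)"
proof -
  note [measurable] = measurable_compose[OF measurable_fst measurable_fst_borel]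
    measurable_compose[OF measurable_snd measurable_snd_borel]
  have "(\<lambda>z :: ('a \<times> 'a) \<times> 'a \<times> 'a. dist (fst (fst z)) (snd (snd z))) \<in> borel_measurable (borel \<Otimes>\<^sub>M borel)"
    by (intro borel_measurable_dist measurable_compose[OF measurable_fst measurable_fst_borel]
        measurable_compose[OF measurable_snd measurable_snd_borel])
  from measurable_sets[OF this, of "{..e}"] show ?thesis
    by (simp add: vimage_def space_pair_measure)
qed

context stationary_m_dependent
begin

text \<open>
By stationarity only the finitely many pairs with smaller index \<open>1\<close> and distance at most \<open>m\<close> matter, so the
individual constants combine into one.
\<close>

lemma near_pairs_uniform_bound:
  fixes A :: "real \<Rightarrow> ('b \<times> 'b) set" and g :: "real \<Rightarrow> real"
  assumes A: "\<And>e. A e \<in> sets (borel \<Otimes>\<^sub>M borel)" and g: "\<And>e. 0 \<le> g e"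
    and P: "\<And>i j h. (i + h, j + h) \<in> P \<longleftrightarrow> (i, j) \<in> P"
    and bd: "\<And>i j. (i, j) \<in> P \<Longrightarrow> 1 \<le> i \<Longrightarrow> 1 \<le> j \<Longrightarrow> i = 1 \<or> j = 1 \<Longrightarrow>
      \<exists>C\<ge>0. \<forall>e>0. prob {w \<in> space M. (W i w, W j w) \<in> A e} \<le> C * g e"
  shows "\<exists>C. \<forall>i j e. (i, j) \<in> P \<longrightarrow> 1 \<le> i \<longrightarrow> 1 \<le> j \<longrightarrow> near m i j \<longrightarrow> 0 < e \<longrightarrow>
      prob {w \<in> space M. (W i w, W j w) \<in> A e} \<le> C * g e"
proof -
  let ?p = "\<lambda>i j e. prob {w \<in> space M. (W i w, W j w) \<in> A e}"
  define Q where "Q = {(i, j). (i, j) \<in> P \<and> 1 \<le> i \<and> 1 \<le> j \<and> (i = 1 \<or> j = 1)}"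
  have "\<forall>z\<in>Q. \<exists>C\<ge>0. \<forall>e>0. ?p (fst z) (snd z) e \<le> C * g e" using bd by (auto simp: Q_def)
  then have "\<exists>c. \<forall>z\<in>Q. 0 \<le> c z \<and> (\<forall>e>0. ?p (fst z) (snd z) e \<le> c z * g e)" by (rule bchoice)
  then obtain c where c: "\<And>z. z \<in> Q \<Longrightarrow> 0 \<le> c z" "\<And>z e. z \<in> Q \<Longrightarrow> 0 < e \<Longrightarrow> ?p (fst z) (snd z) e \<le> c z * g e"
    by blast
  define S where "S = Q \<inter> {1..m + 1} \<times> {1..m + 1}"
  have fin: "finite S" by (simp add: S_def)
  have shift: "?p (i + h) (j + h) e = ?p i j e" if "1 \<le> i" "1 \<le> j" for i j h e
  proof -
    have meas: "(\<lambda>w. (W i w, W j w)) \<in> M \<rightarrow>\<^sub>M borel \<Otimes>\<^sub>M borel" if "1 \<le> i" "1 \<le> j" for i j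
      using measurable_W[OF that(1)] measurable_W[OF that(2)] by measurable
    have "?p i j e = measure (distr M (borel \<Otimes>\<^sub>M borel) (\<lambda>w. (W i w, W j w))) (A e)" if "1 \<le> i" "1 \<le> j" for i j
      using meas[OF that] A by (subst measure_distr) (auto intro!: arg_cong[where f=prob])
    from this[OF that] this[of "i + h" "j + h"] that distr_pair_shift[OF that, of h]
    show ?thesis by simp
  qed
  have "?p i j e \<le> (\<Sum>z\<in>S. c z) * g e" if "(i, j) \<in> P" "1 \<le> i" "1 \<le> j" "near m i j" "0 < e" for i j e
  proof -
    define h where "h = min i j - 1"
    have ij: "i = (i - h) + h" "j = (j - h) + h" "1 \<le> i - h" "1 \<le> j - h" using that(2,3) by (auto simp: h_def)
    have "(i - h, j - h) \<in> P" using P[of "i - h" h "j - h"] that(1) ij by simp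
    moreover have "i - h = 1 \<or> j - h = 1" using that(2,3) by (auto simp: h_def)
    ultimately have Q: "(i - h, j - h) \<in> Q" using ij by (simp add: Q_def)
    have "i - h \<le> m + 1" "j - h \<le> m + 1" using that(2-4) by (auto simp: near_def h_def)
    then have S: "(i - h, j - h) \<in> S" using Q ij by (simp add: S_def)
    have "?p i j e = ?p (i - h) (j - h) e" using shift[OF ij(3,4), of h e] ij(1,2) by simp
    also have "\<dots> \<le> c (i - h, j - h) * g e" using c(2)[OF Q that(5)] by simp
    also have "\<dots> \<le> (\<Sum>z\<in>S. c z) * g e"
      using S fin c(1) g by (intro mult_right_mono member_le_sum) (auto simp: S_def)
    finally show ?thesis .
  qed
  then show ?thesis by blast
qed

end

lemma nonneg_L1_L3_density:
  assumes "prob_space M" "has_density M Z p" "p \<in> L_space 3"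
  shows "nonneg_L1_L3 p" "distributed M lborel Z (\<lambda>x. ennreal (p x))"
proof -
  interpret prob_space M by fact
  have p: "\<And>x. 0 \<le> p x" and D: "distributed M lborel Z (\<lambda>x. ennreal (p x))"
    using assms(2) by (auto simp: has_density_def)
  show "distributed M lborel Z (\<lambda>x. ennreal (p x))" by fact
  have "integrable lborel (\<lambda>x. p x * 1)"
    using distributed_integrable[OF D, of "\<lambda>_. 1"] p by simp
  then show "nonneg_L1_L3 p"
    using assms(3) p by (simp add: nonneg_L1_L3_def L_space_def)
qed

definition offdiag :: "nat \<Rightarrow> (nat \<times> nat) set" where
  "offdiag n = {(i, j). i \<in> {1..n} \<and> j \<in> {1..n} \<and> i \<noteq> j}"

lemma regular_offdiag: "1 \<le> n \<Longrightarrow> regular_index_set n (n - 1) (offdiag n)"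
  unfolding regular_index_set_def
proof (intro conjI ballI)
  show "offdiag n \<subseteq> {1..n} \<times> {1..n}" by (auto simp: offdiag_def)
  fix i assume i: "i \<in> {1..n}"
  have "{j. (i, j) \<in> offdiag n} = {1..n} - {i}" "{j. (j, i) \<in> offdiag n} = {1..n} - {i}"
    using i by (auto simp: offdiag_def)
  then show "card {j. (i, j) \<in> offdiag n} = n - 1" "card {j. (j, i) \<in> offdiag n} = n - 1"
    using i by simp_all
qed

lemma regular_full: "regular_index_set n n ({1..n} \<times> {1..n})"
proof -
  have "{j. (i, j) \<in> {1..n} \<times> {1..n}} = {1..n}" "{j. (j, i) \<in> {1..n} \<times> {1..n}} = {1..n}" if "i \<in> {1..n}" for i
    using that by auto
  then show ?thesis by (simp add: regular_index_set_def)
qed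

lemma (in two_sample) estimator_full:
  "estimator ({1..n} \<times> {1..n}) e w = Q11 X Y e n w / ball_vol TYPE('a) e"
proof -
  have "(\<Sum>(i, j)\<in>{1..n} \<times> {1..n}. kern e (X i w) (Y j w)) = (\<Sum>i=1..n. \<Sum>j=1..n. kern e (X i w) (Y j w))"
    by (rule sum.cartesian_product[symmetric])
  also have "\<dots> = (\<Sum>i=1..n. \<Sum>j=1..n. of_bool (dist (X i w) (Y j w) \<le> e)) / ball_vol TYPE('a) e"
    unfolding kern_def sum_divide_distrib ..
  finally show ?thesis by (simp only: estimator_def Q11_def) (simp add: power2_eq_square)
qed

lemma kern_offdiag_sum:
  fixes X :: "nat \<Rightarrow> 'w \<Rightarrow> 'a::euclidean_space"
  assumes n: "2 \<le> n"
  shows "(\<Sum>(i, j)\<in>offdiag n. kern e (X i w) (X j w)) / real (card (offdiag n))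
    = Q20 X e n w / ball_vol TYPE('a) e"
proof -
  let ?U = "{(i, j). 1 \<le> i \<and> i < j \<and> j \<le> n}" and ?k = "\<lambda>(i, j). kern e (X i w) (X j w)"
  have fin: "finite ?U" by (rule finite_subset[of _ "{1..n} \<times> {1..n}"]) auto
  have split: "offdiag n = ?U \<union> prod.swap ` ?U"
    by (auto simp: offdiag_def image_iff)
  have disj: "?U \<inter> prod.swap ` ?U = {}" by auto
  have "sum ?k (offdiag n) = sum ?k ?U + sum ?k (prod.swap ` ?U)"
    unfolding split using fin disj by (intro sum.union_disjoint) auto
  also have "sum ?k (prod.swap ` ?U) = sum (?k \<circ> prod.swap) ?U"
    by (rule sum.reindex) simp
  also have "\<dots> = sum ?k ?U" by (intro sum.cong) (auto simp: kern_commute)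
  finally have 1: "sum ?k (offdiag n) = 2 * sum ?k ?U" by simp
  have 2: "sum ?k ?U = (\<Sum>(i, j)\<in>?U. of_bool (dist (X i w) (X j w) \<le> e)) / ball_vol TYPE('a) e"
    unfolding sum_divide_distrib by (intro sum.cong) (auto simp: kern_def)
  have "card (offdiag n) = n * (n - 1)" by (rule regular_index_set_card[OF regular_offdiag]) (use n in simp)
  also have "\<dots> = 2 * (n choose 2)"
  proof -
    have "even (n * (n - 1))" by (cases n) auto
    then show ?thesis unfolding choose_two by (rule dvd_mult_div_cancel[symmetric])
  qed
  finally have 3: "real (card (offdiag n)) = 2 * real (n choose 2)" by simp
  show ?thesis unfolding 1 2 3 Q20_def by simp
qed

lemma (in two_sample_sequence) rates:
  assumes F: "\<forall>\<^sub>F n in sequentially. F n = mse I \<epsilon> n" and S: "S = score_variance"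
  shows "(filterlim (\<lambda>n. (real n)^2 * \<epsilon> n ^ DIM('a)) at_top sequentially \<longrightarrow> F \<longlonglongrightarrow> 0)
   \<and> (\<forall>\<alpha> K c :: real.
        0 < \<alpha> \<and> \<alpha> \<le> 1 \<and> 0 < K \<and> pX \<in> H2_class \<alpha> K \<and> pY \<in> H2_class \<alpha> K
        \<and> \<alpha> \<le> real DIM('a) / 4 \<and> 0 < c
        \<and> \<epsilon> \<sim>[sequentially] (\<lambda>n. c * real n powr (- 2 / (4 * \<alpha> + real DIM('a)))) \<longrightarrow>
        F \<in> O(\<lambda>n. real n powr (- 8 * \<alpha> / (4 * \<alpha> + real DIM('a)))))
   \<and> (\<forall>(\<alpha>::real) (K::real) (L :: real \<Rightarrow> real).
        0 < \<alpha> \<and> \<alpha> \<le> 1 \<and> 0 < K \<and> pX \<in> H2_class \<alpha> K \<and> pY \<in> H2_class \<alpha> K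
        \<and> \<alpha> > real DIM('a) / 4
        \<and> slowly_varying L \<and> filterlim (\<lambda>n. L (real n)) at_top sequentially
        \<and> \<epsilon> \<sim>[sequentially] (\<lambda>n. L (real n) * real n powr (- 1 / real DIM('a))) \<longrightarrow>
        (\<lambda>n. F n - 4 * S / real n) \<in> o(\<lambda>n. 1 / real n))"
proof (intro conjI allI impI)
  assume "filterlim (\<lambda>n. (real n)^2 * \<epsilon> n ^ DIM('a)) at_top sequentially"
  from mse_tendsto_zero[OF this] show "F \<longlonglongrightarrow> 0"
    using tendsto_cong[OF F] by simp
next
  fix \<alpha> K c :: real
  assume "0 < \<alpha> \<and> \<alpha> \<le> 1 \<and> 0 < K \<and> pX \<in> H2_class \<alpha> K \<and> pY \<in> H2_class \<alpha> K
        \<and> \<alpha> \<le> real DIM('a) / 4 \<and> 0 < c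
        \<and> \<epsilon> \<sim>[sequentially] (\<lambda>n. c * real n powr (- 2 / (4 * \<alpha> + real DIM('a))))"
  then show "F \<in> O(\<lambda>n. real n powr (- 8 * \<alpha> / (4 * \<alpha> + real DIM('a))))"
    using mse_bigo[of \<alpha> K c] landau_o.big.in_cong[OF F] by blast
next
  fix \<alpha> K :: real and L :: "real \<Rightarrow> real"
  assume "0 < \<alpha> \<and> \<alpha> \<le> 1 \<and> 0 < K \<and> pX \<in> H2_class \<alpha> K \<and> pY \<in> H2_class \<alpha> K
        \<and> \<alpha> > real DIM('a) / 4
        \<and> slowly_varying L \<and> filterlim (\<lambda>n. L (real n)) at_top sequentially
        \<and> \<epsilon> \<sim>[sequentially] (\<lambda>n. L (real n) * real n powr (- 1 / real DIM('a)))"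
  then have mse: "(\<lambda>n. mse I \<epsilon> n - 4 * S / real n) \<in> o(\<lambda>n. 1 / real n)"
    unfolding S using mse_expansion[of \<alpha> K L] by blast
  have ev: "\<forall>\<^sub>F n in sequentially. F n - 4 * S / real n = mse I \<epsilon> n - 4 * S / real n"
    using F by eventually_elim simp
  show "(\<lambda>n. F n - 4 * S / real n) \<in> o(\<lambda>n. 1 / real n)"
    by (rule iffD2[OF landau_o.small.in_cong[OF ev] mse])
qed

theorem theorem1:
  fixes M :: "'w measure"
    and X Y :: "nat \<Rightarrow> 'w \<Rightarrow> 'a::euclidean_space"
    and pX pY :: "'a \<Rightarrow> real"
    and m k l :: nat
    and \<epsilon> :: "nat \<Rightarrow> real"
  assumes "prob_space M"
    and "\<forall>i\<ge>1. X i \<in> borel_measurable M" and "\<forall>i\<ge>1. Y i \<in> borel_measurable M"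
    and "strictly_stationary M X" and "m_dependent M m X"
    and "strictly_stationary M Y" and "m_dependent M m Y"
    and "has_density M (X 1) pX" and "has_density M (Y 1) pY"
    and "(k, l) \<in> {(2, 0), (1, 1)}"
    and "pX \<in> L_space 3" and "pY \<in> L_space 3"
    and "strictly_stationary M (\<lambda>i \<omega>. (X i \<omega>, Y i \<omega>))"
    and "m_dependent M m (\<lambda>i \<omega>. (X i \<omega>, Y i \<omega>))"
    and "\<forall>s\<ge>1. has_bounded_density M (\<lambda>\<omega>. X 1 \<omega> - X (1 + s) \<omega>)"
    and "\<forall>s\<ge>1. \<forall>t\<ge>1. has_bounded_density M (\<lambda>\<omega>. X s \<omega> - Y t \<omega>)"
    and "\<forall>n\<ge>1. \<epsilon> n > 0" and "\<epsilon> \<longlonglongrightarrow> 0"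
  shows
    "(filterlim (\<lambda>n. (real n)\<^sup>2 * \<epsilon> n ^ DIM('a)) at_top sequentially \<longrightarrow>
        (\<lambda>n. LINT \<omega>|M. (Q_est k l X Y (\<epsilon> n) n \<omega> - q_fun k l pX pY)\<^sup>2) \<longlonglongrightarrow> 0)
   \<and> (\<forall>\<alpha> K c :: real.
        0 < \<alpha> \<and> \<alpha> \<le> 1 \<and> 0 < K \<and> pX \<in> H2_class \<alpha> K \<and> pY \<in> H2_class \<alpha> K
        \<and> \<alpha> \<le> real DIM('a) / 4 \<and> 0 < c
        \<and> \<epsilon> \<sim>[sequentially] (\<lambda>n. c * real n powr (- 2 / (4 * \<alpha> + real DIM('a)))) \<longrightarrow>
        (\<lambda>n. LINT \<omega>|M. (Q_est k l X Y (\<epsilon> n) n \<omega> - q_fun k l pX pY)\<^sup>2)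
          \<in> O(\<lambda>n. real n powr (- 8 * \<alpha> / (4 * \<alpha> + real DIM('a)))))
   \<and> (\<forall>(\<alpha>::real) (K::real) (L :: real \<Rightarrow> real).
        0 < \<alpha> \<and> \<alpha> \<le> 1 \<and> 0 < K \<and> pX \<in> H2_class \<alpha> K \<and> pY \<in> H2_class \<alpha> K
        \<and> \<alpha> > real DIM('a) / 4
        \<and> slowly_varying L \<and> filterlim (\<lambda>n. L (real n)) at_top sequentially
        \<and> \<epsilon> \<sim>[sequentially] (\<lambda>n. L (real n) * real n powr (- 1 / real DIM('a))) \<longrightarrow>
        (\<lambda>n. (LINT \<omega>|M. (Q_est k l X Y (\<epsilon> n) n \<omega> - q_fun k l pX pY)\<^sup>2)
              - 4 * sigma_sq M m k l X Y pX pY / real n)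
          \<in> o(\<lambda>n. 1 / real n))"
proof -
  interpret prob_space M by fact
  note X_dens = nonneg_L1_L3_density[OF assms(1,8,11)] and Y_dens = nonneg_L1_L3_density[OF assms(1,9,12)]
  consider "(k, l) = (2, 0)" | "(k, l) = (1, 1)" using assms(10) by blast
  then show ?thesis
  proof cases
    case 1
    let ?W = "\<lambda>i \<omega>. (X i \<omega>, X i \<omega>)" and ?P = "{(i, j). i \<noteq> j} :: (nat \<times> nat) set"
    have dup: "(\<lambda>x::'a. (x, x)) \<in> borel_measurable borel" by measurable
    interpret W: stationary_m_dependent M ?W m
    proof
      show "strictly_stationary M ?W"
        by (rule strictly_stationary_compose[OF assms(4) _ dup]) (use assms(2) in auto)
      show "m_dependent M m ?W" by (rule m_dependent_compose[OF assms(1,5) dup])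
      show "?W i \<in> borel_measurable M" if "1 \<le> i" for i
        using assms(2) that measurable_compose[OF _ dup, of "X i" M] by simp
    qed
    have "\<exists>C. \<forall>i j e. (i, j) \<in> ?P \<longrightarrow> 1 \<le> i \<longrightarrow> 1 \<le> j \<longrightarrow> near m i j \<longrightarrow> 0 < e \<longrightarrow>
      prob {\<omega> \<in> space M. (?W i \<omega>, ?W j \<omega>) \<in> {z. dist (fst (fst z)) (snd (snd z)) \<le> e}} \<le> C * ball_vol TYPE('a) e"
    proof (rule W.near_pairs_uniform_bound)
      show "{z :: ('a \<times> 'a) \<times> 'a \<times> 'a. dist (fst (fst z)) (snd (snd z)) \<le> e} \<in> sets (borel \<Otimes>\<^sub>M borel)" for e
        by (rule sets_dist_fst_snd_le)
      show "0 \<le> ball_vol TYPE('a) e" for e by (simp add: ball_vol_def)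
      fix i j assume ij: "(i, j) \<in> ?P" "1 \<le> i" "1 \<le> j" "i = 1 \<or> j = 1"
      define s where "s = max i j - 1"
      have s: "1 \<le> s" "(i = 1 \<and> j = 1 + s) \<or> (i = 1 + s \<and> j = 1)" using ij by (auto simp: s_def)
      have "has_bounded_density M (\<lambda>\<omega>. X 1 \<omega> - X (1 + s) \<omega>)" using assms(15) s by blast
      from has_bounded_density_ball[OF assms(1) this] s(2)
      show "\<exists>C\<ge>0. \<forall>e>0. prob {\<omega> \<in> space M. (?W i \<omega>, ?W j \<omega>) \<in> {z. dist (fst (fst z)) (snd (snd z)) \<le> e}} \<le> C * ball_vol TYPE('a) e"
        by (auto simp: dist_norm norm_minus_commute)
    qed auto
    then obtain C where C: "\<And>i j e. (i, j) \<in> ?P \<Longrightarrow> 1 \<le> i \<Longrightarrow> 1 \<le> j \<Longrightarrow> near m i j \<Longrightarrow> 0 < e \<Longrightarrow>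
      prob {\<omega> \<in> space M. dist (X i \<omega>) (X j \<omega>) \<le> e} \<le> C * ball_vol TYPE('a) e" by auto
    interpret T: two_sample_sequence M X X m pX pX ?P C offdiag "\<lambda>n. n - 1" \<epsilon>
    proof unfold_locales
      show "regular_index_set n (n - 1) (offdiag n)" if "2 \<le> n" for n using that by (intro regular_offdiag) simp
    qed (use X_dens assms(17,18) C in \<open>auto simp: offdiag_def\<close>)
    have est: "Q_est k l X Y (\<epsilon> n) n \<omega> = T.estimator (offdiag n) (\<epsilon> n) \<omega>" if "2 \<le> n" for n \<omega>
      using 1 kern_offdiag_sum[OF that, of "\<epsilon> n" X \<omega>] by (simp add: Q_est_def T.estimator_def)
    have q: "q_fun k l pX pY = T.q" using 1 by (simp add: q_fun_def q20_def T.q_def power2_eq_square)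
    have sigma: "sigma_sq M m k l X Y pX pY = T.score_variance"
      using 1 T.long_run_variance_score by (simp add: sigma_sq_def sigma20_sq_def)
    have F: "\<forall>\<^sub>F n in sequentially. (LINT \<omega>|M. (Q_est k l X Y (\<epsilon> n) n \<omega> - q_fun k l pX pY)\<^sup>2) = T.mse offdiag \<epsilon> n"
      using eventually_ge_at_top[of 2] by eventually_elim (simp add: T.mse_def est q)
    show ?thesis using T.rates[OF F sigma] by blast
  next
    case 2
    let ?W = "\<lambda>i \<omega>. (X i \<omega>, Y i \<omega>)"
    interpret W: stationary_m_dependent M ?W m
    proof
      show "?W i \<in> borel_measurable M" if "1 \<le> i" for i
        using assms(2,3) that by (intro borel_measurable_Pair) auto
    qed (use assms in auto)
    have "\<exists>C. \<forall>i j e. (i, j) \<in> (UNIV :: (nat \<times> nat) set) \<longrightarrow> 1 \<le> i \<longrightarrow> 1 \<le> j \<longrightarrow> near m i j \<longrightarrow> 0 < e \<longrightarrow>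
      prob {\<omega> \<in> space M. (?W i \<omega>, ?W j \<omega>) \<in> {z. dist (fst (fst z)) (snd (snd z)) \<le> e}} \<le> C * ball_vol TYPE('a) e"
    proof (rule W.near_pairs_uniform_bound)
      show "{z :: ('a \<times> 'a) \<times> 'a \<times> 'a. dist (fst (fst z)) (snd (snd z)) \<le> e} \<in> sets (borel \<Otimes>\<^sub>M borel)" for e
        by (rule sets_dist_fst_snd_le)
      show "0 \<le> ball_vol TYPE('a) e" for e by (simp add: ball_vol_def)
      fix i j :: nat assume ij: "1 \<le> i" "1 \<le> j"
      have "has_bounded_density M (\<lambda>\<omega>. X i \<omega> - Y j \<omega>)" using assms(16) ij by blast
      from has_bounded_density_ball[OF assms(1) this]
      show "\<exists>C\<ge>0. \<forall>e>0. prob {\<omega> \<in> space M. (?W i \<omega>, ?W j \<omega>) \<in> {z. dist (fst (fst z)) (snd (snd z)) \<le> e}} \<le> C * ball_vol TYPE('a) e"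
        by (auto simp: dist_norm)
    qed auto
    then obtain C where C: "\<And>i j e. 1 \<le> i \<Longrightarrow> 1 \<le> j \<Longrightarrow> near m i j \<Longrightarrow> 0 < e \<Longrightarrow>
      prob {\<omega> \<in> space M. dist (X i \<omega>) (Y j \<omega>) \<le> e} \<le> C * ball_vol TYPE('a) e" by auto
    interpret T: two_sample_sequence M X Y m pX pY UNIV C "\<lambda>n. {1..n} \<times> {1..n}" "\<lambda>n. n" \<epsilon>
      by unfold_locales (use X_dens Y_dens assms(17,18) C regular_full in auto)
    have est: "Q_est k l X Y (\<epsilon> n) n \<omega> = T.estimator ({1..n} \<times> {1..n}) (\<epsilon> n) \<omega>" for n \<omega>
      using 2 by (simp add: Q_est_def T.estimator_full del: One_nat_def)
    have q: "q_fun k l pX pY = T.q" using 2 by (simp add: q_fun_def q11_def T.q_def)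
    have sigma: "sigma_sq M m k l X Y pX pY = T.score_variance"
      using 2 T.long_run_variance_score by (simp add: sigma_sq_def sigma11_sq_def)
    have F: "\<forall>\<^sub>F n in sequentially. (LINT \<omega>|M. (Q_est k l X Y (\<epsilon> n) n \<omega> - q_fun k l pX pY)\<^sup>2) = T.mse (\<lambda>n. {1..n} \<times> {1..n}) \<epsilon> n"
      by (simp add: T.mse_def est q)
    show ?thesis using T.rates[OF F sigma] by blast
  qed
qed

end
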